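(* Let $(\mathcal G,(\cdot,\cdot),\dot{\mathfrak h})\in\mathcal D$ (for a given $\nu\ge1$), with root system $\dot R$. For $1\le i\le\nu$ let $d_i\in\mathrm{Der}(\mathcal G)$ be the degree derivation $d_ix=n_ix$ for $x\in\mathcal G^{(n_1,\dots,n_\nu)}$ (these are linearly independent). Let $C=\bigoplus_{i=1}^\nu\mathbb F c_i$ be a $\nu$-dimensional vector space, $D=\bigoplus_{i=1}^\nu\mathbb F d_i$, $\mathcal L=\mathcal G\oplus C\oplus D$ and $\mathcal H=\dot{\mathfrak h}\oplus C\oplus D$. Define an anticommutative product $[\cdot,\cdot]'$ on $\mathcal L$ by $[\mathcal L,C]'=0$, $[D,D]'=0$, $[d_i,x]'=d_ix$ ($x\in\mathcal G$), $[x,y]'=[x,y]+\sum_{i=1}^\nu(d_ix,y)c_i$ ($x,y\in\mathcal G$), and extend $(\cdot,\cdot)$ to a symmetric bilinear form on $\mathcal L$ by $(C,C)=(D,D)=0$, $(c_i,d_j)=\delta_{ij}$, $(C,\mathcal G)=(D,\mathcal G)=0$. Then $(\mathcal L,[\cdot,\cdot]')$ is a Lie algebra, $(\mathcal L,(\cdot,\cdot),\mathcal H)\in\mathcal T$, $\mathcal L$ is tame of nullity $\nu$ and of the same type as $\dot R$, $\mathcal L_c=\mathcal G\oplus C$, $Z(\mathcal L_c)=C$, and $\mathcal L_{cc}\cong\mathcal G$.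
   Context: $\mathbb F$ is a field of characteristic $0$. If $V$ is a finite-dimensional space with a non-degenerate symmetric bilinear form and $\alpha\in V^\star$, $t_\alpha$ denotes the unique element of $V$ with $(t_\alpha,v)=\alpha(v)$ for all $v\in V$. A nonzero subalgebra $\mathcal H$ of a Lie algebra $\mathcal L$ is a (split) toral subalgebra if $\mathcal L=\bigoplus_{\alpha\in\mathcal H^\star}\mathcal L_\alpha$, where $\mathcal L_\alpha=\{x\in\mathcal L:[h,x]=\alpha(h)x\ \forall h\in\mathcal H\}$; its root system is $\{\alpha:\mathcal L_\alpha\neq0\}$. A finite root system is a subset $\Delta$ containing $0$ with $\Delta^\times:=\Delta\setminus\{0\}$ a finite root system in the sense of Bourbaki; $\Delta_{red}=\{0\}\cup\{\alpha\in\Delta:\alpha/2\notin\Delta\}$. The class $\mathcal T$ consists of triples $(\mathcal L,(\cdot,\cdot),\mathcal H)$ with: (T1) $\mathcal L$ is a Lie algebra over $\mathbb F$ with a non-degenerate symmetric invariant bilinear form; (T2) $\mathcal H$ is a finite-dimensional toral subalgebra and $(\cdot,\cdot)|_{\mathcal H\times\mathcal H}$ is non-degenerate; with $R$ the root system, $(\alpha,\beta):=(t_\alpha,t_\beta)$ on $\mathcal H^\star$, $R^\times=\{\alpha\in R:(\alpha,\alpha)\ne0\}$, $R^0=\{\alpha\in R:(\alpha,\alpha)=0\}$: (T3) for each $\delta\in R^0$ there are $x\in\mathcal L_\delta$, $y\in\mathcal L_{-\delta}$ with $[x,y]=t_\delta$, and for each $\alpha\in R^\times$ and each $0\ne x\in\mathcal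 L_\alpha$ there is $y\in\mathcal L_{-\alpha}$ with $[x,y]=t_\alpha$; (T4) $\mathrm{ad}\,x$ is locally nilpotent for $x\in\mathcal L_\alpha$, $\alpha\in R^\times$; (T5) (a) $R^\times$ is not a disjoint union of two nonempty mutually orthogonal subsets, (b) for each $\delta\in R^0$ there is $\alpha\in R^\times$ with $\alpha+\delta\in R$; (T6) $\Lambda=\mathrm{span}_{\mathbb Z}R^0$ is free abelian of finite rank (the nullity). $\mathcal L_c$ is the subalgebra generated by $\mathcal L_\alpha$, $\alpha\in R^\times$; $\mathcal L_{cc}=\mathcal L_c/Z(\mathcal L_c)$; $\mathcal L$ is tame if $C_{\mathcal L}(\mathcal L_c)\subseteq\mathcal L_c$. The type of $\mathcal L$ is the type of the irreducible finite root system obtained as the image of $R$ in $\mathcal V/\mathcal V^0$, where $\mathcal V=\mathbb R\otimes_{\mathbb Q}\mathrm{span}_{\mathbb Q}R$ (after normalizing the form so some $(\alpha,\alpha)=1$) and $\mathcal V^0$ is the radical of the induced form. The class $\mathcal D$ (for a fixed positive integer $\nu$) consists of triples $(\mathcal G,(\cdot,\cdot),\dot{\mathfrak h})$, $\mathcal G$ a Lie algebra, $(\cdot,\cdot)$ a symmetric bilinear form on $\mathcal G$, $\dot{\mathfrak h}$ a subalgebra, with: (D1) the form is non-degenerate and invariant; (D2) $\dot{\mathfrak h}$ is a finite-dimensional toral subalgebra of $\mathcal G$, with root system $\dot R$; (D3) the form on $\dot{\mathfrak h}$ is non-degenerate and is $\mathbb Q$-valued on $\mathrm{span}_{\mathbb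 Q}\{t_{\dot\alpha}:\dot\alpha\in\dot R\}$; transfer it to $\dot{\mathfrak h}^\star$ by $(\dot\alpha,\dot\beta)=(t_{\dot\alpha},t_{\dot\beta})$ and extend to $\dot{\mathcal U}=\mathbb R\otimes_{\mathbb Q}\mathrm{span}_{\mathbb Q}\dot R$; (D4) this form on $\dot{\mathcal U}$ is positive definite and $\dot R$ is an irreducible finite root system in $\dot{\mathcal U}$; (D5) $\mathcal G=\bigoplus_{\sigma\in\mathbb Z^\nu}\mathcal G^\sigma$ is a $\mathbb Z^\nu$-graded Lie algebra; (D6) $\mathcal G_{\dot\alpha}=\bigoplus_\sigma\mathcal G^\sigma_{\dot\alpha}$ with $\mathcal G^\sigma_{\dot\alpha}=\mathcal G^\sigma\cap\mathcal G_{\dot\alpha}$, for each $\dot\alpha\in\dot R$; (D7) $\dot{\mathfrak h}\subseteq\mathcal G^0_0$; (D8) $\mathcal G_0=\sum_{\dot\alpha\in\dot R^\times}[\mathcal G_{\dot\alpha},\mathcal G_{-\dot\alpha}]$; (D9) $\{\sigma:\mathcal G^\sigma\ne0\}$ generates a subgroup of $\mathbb Z^\nu$ of rank $\nu$; (D10) for $\sigma,\tau$ in the support, $(\mathcal G^\sigma,\mathcal G^\tau)=0$ unless $\sigma+\tau=0$; (D11) $\mathcal G^0\cap\mathcal G_{\dot\alpha}\ne0$ for all $\dot\alpha\in\dot R^\times_{red}$; (D12)(a) for $\dot\alpha\in\dot R^\times$, $\sigma\in\mathbb Z^\nu$, $0\ne x\in\mathcal G^\sigma_{\dot\alpha}$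 there is $y\in\mathcal G^{-\sigma}_{-\dot\alpha}$ with $[x,y]=t_{\dot\alpha}$; (b) for $\sigma$ with $\mathcal G^\sigma_0\ne0$ there are $x\in\mathcal G^\sigma_0$, $y\in\mathcal G^{-\sigma}_0$ with $[x,y]=0$ and $(x,y)=1$. *)

theory Defs
  imports Complex_Main "HOL-Library.Product_Plus" "HOL-Library.Function_Algebras"
begin

text \<open>Throughout, a Lie algebra is an abelian group type 'l with a scalar
multiplication s :: 'f => 'l => 'l (the field is 'f) and a bracket b;
symmetric bilinear forms are functions B :: 'l => 'l => 'f.  All algebras are
carried by their whole type.  Functionals on a toral subalgebra H (elements of
the dual of H) are represented by functions 'l => 'f which are linear on H
and vanish outside H.\<close>

definition bilinear_map :: "('f::field \<Rightarrow> 'l::ab_group_add \<Rightarrow> 'l) \<Rightarrow> ('l \<Rightarrow> 'l \<Rightarrow> 'l) \<Rightarrow> bool" where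
  "bilinear_map s b \<longleftrightarrow>
     (\<forall>x y z. b (x + y) z = b x z + b y z) \<and> (\<forall>x y z. b x (y + z) = b x y + b x z) \<and>
     (\<forall>c x y. b (s c x) y = s c (b x y)) \<and> (\<forall>c x y. b x (s c y) = s c (b x y))"

definition is_lie_algebra :: "('f::field \<Rightarrow> 'l::ab_group_add \<Rightarrow> 'l) \<Rightarrow> ('l \<Rightarrow> 'l \<Rightarrow> 'l) \<Rightarrow> bool" where
  "is_lie_algebra s b \<longleftrightarrow> vector_space s \<and> bilinear_map s b \<and> (\<forall>x. b x x = 0) \<and>
     (\<forall>x y z. b x (b y z) + b y (b z x) + b z (b x y) = 0)"

definition sym_bilinear_form :: "('f::field \<Rightarrow> 'l::ab_group_add \<Rightarrow> 'l) \<Rightarrow> ('l \<Rightarrow> 'l \<Rightarrow> 'f) \<Rightarrow> bool" where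
  "sym_bilinear_form s B \<longleftrightarrow> (\<forall>x y. B x y = B y x) \<and>
     (\<forall>x y z. B (x + y) z = B x z + B y z) \<and> (\<forall>c x y. B (s c x) y = c * B x y)"

definition invariant_form :: "('l \<Rightarrow> 'l \<Rightarrow> 'l) \<Rightarrow> ('l \<Rightarrow> 'l \<Rightarrow> 'f) \<Rightarrow> bool" where
  "invariant_form b B \<longleftrightarrow> (\<forall>x y z. B (b x y) z = B x (b y z))"

definition nondeg_on :: "('l \<Rightarrow> 'l \<Rightarrow> 'f::zero) \<Rightarrow> 'l::zero set \<Rightarrow> bool" where
  "nondeg_on B S \<longleftrightarrow> (\<forall>x\<in>S. (\<forall>y\<in>S. B x y = 0) \<longrightarrow> x = 0)"

definition subalgebra :: "('f::field \<Rightarrow> 'l::ab_group_add \<Rightarrow> 'l) \<Rightarrow> ('l \<Rightarrow> 'l \<Rightarrow> 'l) \<Rightarrow> 'l set \<Rightarrow> bool" where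
  "subalgebra s b S \<longleftrightarrow> module.subspace s S \<and> (\<forall>x\<in>S. \<forall>y\<in>S. b x y \<in> S)"

definition fin_dim :: "('f::field \<Rightarrow> 'l::ab_group_add \<Rightarrow> 'l) \<Rightarrow> 'l set \<Rightarrow> bool" where
  "fin_dim s S \<longleftrightarrow> (\<exists>A. finite A \<and> A \<subseteq> S \<and> module.span s A = S)"

definition dual_of :: "('f::field \<Rightarrow> 'l::ab_group_add \<Rightarrow> 'l) \<Rightarrow> 'l set \<Rightarrow> ('l \<Rightarrow> 'f) set" where
  "dual_of s H = {\<alpha>. (\<forall>x\<in>H. \<forall>y\<in>H. \<alpha> (x + y) = \<alpha> x + \<alpha> y) \<and>
                     (\<forall>c. \<forall>x\<in>H. \<alpha> (s c x) = c * \<alpha> x) \<and> (\<forall>x. x \<notin> H \<longrightarrow> \<alpha> x = 0)}"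

definition root_space :: "('f::field \<Rightarrow> 'l::ab_group_add \<Rightarrow> 'l) \<Rightarrow> ('l \<Rightarrow> 'l \<Rightarrow> 'l) \<Rightarrow> 'l set \<Rightarrow> ('l \<Rightarrow> 'f) \<Rightarrow> 'l set" where
  "root_space s b H \<alpha> = {x. \<forall>h\<in>H. b h x = s (\<alpha> h) x}"

text \<open>(Split) toral subalgebra: L is the sum of the root spaces L_alpha, alpha in H*
 (such a sum of weight spaces is automatically direct).\<close>
definition toral :: "('f::field \<Rightarrow> 'l::ab_group_add \<Rightarrow> 'l) \<Rightarrow> ('l \<Rightarrow> 'l \<Rightarrow> 'l) \<Rightarrow> 'l set \<Rightarrow> bool" where
  "toral s b H \<longleftrightarrow> subalgebra s b H \<and> H \<noteq> {0} \<and>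
     module.span s (\<Union>\<alpha>\<in>dual_of s H. root_space s b H \<alpha>) = UNIV"

definition roots :: "('f::field \<Rightarrow> 'l::ab_group_add \<Rightarrow> 'l) \<Rightarrow> ('l \<Rightarrow> 'l \<Rightarrow> 'l) \<Rightarrow> 'l set \<Rightarrow> ('l \<Rightarrow> 'f) set" where
  "roots s b H = {\<alpha> \<in> dual_of s H. root_space s b H \<alpha> \<noteq> {0}}"

definition tvec :: "('l \<Rightarrow> 'l \<Rightarrow> 'f) \<Rightarrow> 'l set \<Rightarrow> ('l \<Rightarrow> 'f) \<Rightarrow> 'l" where
  "tvec B H \<alpha> = (THE t. t \<in> H \<and> (\<forall>v\<in>H. B t v = \<alpha> v))"

definition rform :: "('l \<Rightarrow> 'l \<Rightarrow> 'f) \<Rightarrow> 'l set \<Rightarrow> ('l \<Rightarrow> 'f) \<Rightarrow> ('l \<Rightarrow> 'f) \<Rightarrow> 'f" where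
  "rform B H \<alpha> \<beta> = B (tvec B H \<alpha>) (tvec B H \<beta>)"

definition roots_x :: "('f::field \<Rightarrow> 'l::ab_group_add \<Rightarrow> 'l) \<Rightarrow> ('l \<Rightarrow> 'l \<Rightarrow> 'l) \<Rightarrow> ('l \<Rightarrow> 'l \<Rightarrow> 'f) \<Rightarrow> 'l set \<Rightarrow> ('l \<Rightarrow> 'f) set" where
  "roots_x s b B H = {\<alpha> \<in> roots s b H. rform B H \<alpha> \<alpha> \<noteq> 0}"

definition roots_0 :: "('f::field \<Rightarrow> 'l::ab_group_add \<Rightarrow> 'l) \<Rightarrow> ('l \<Rightarrow> 'l \<Rightarrow> 'l) \<Rightarrow> ('l \<Rightarrow> 'l \<Rightarrow> 'f) \<Rightarrow> 'l set \<Rightarrow> ('l \<Rightarrow> 'f) set" where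
  "roots_0 s b B H = {\<alpha> \<in> roots s b H. rform B H \<alpha> \<alpha> = 0}"

definition int_span :: "('l \<Rightarrow> 'f::field) set \<Rightarrow> ('l \<Rightarrow> 'f) set" where
  "int_span A = {f. \<exists>F k. finite F \<and> F \<subseteq> A \<and> f = (\<lambda>v. \<Sum>a\<in>F. of_int (k a) * a v)}"

definition rat_span_fun :: "('l \<Rightarrow> 'f::field_char_0) set \<Rightarrow> ('l \<Rightarrow> 'f) set" where
  "rat_span_fun A = {f. \<exists>F c. finite F \<and> F \<subseteq> A \<and> f = (\<lambda>v. \<Sum>a\<in>F. of_rat (c a) * a v)}"

definition rat_span :: "('f::field_char_0 \<Rightarrow> 'l::ab_group_add \<Rightarrow> 'l) \<Rightarrow> 'l set \<Rightarrow> 'l set" where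
  "rat_span s A = {x. \<exists>F c. finite F \<and> F \<subseteq> A \<and> x = (\<Sum>a\<in>F. s (of_rat (c a)) a)}"

definition free_abelian_rank :: "('l \<Rightarrow> 'f::field) set \<Rightarrow> nat \<Rightarrow> bool" where
  "free_abelian_rank \<Lambda> n \<longleftrightarrow> (\<exists>e :: nat \<Rightarrow> ('l \<Rightarrow> 'f).
      \<Lambda> = int_span (e ` {..<n}) \<and>
      (\<forall>k :: nat \<Rightarrow> int. (\<lambda>v. \<Sum>i<n. of_int (k i) * e i v) = (\<lambda>v. 0) \<longrightarrow> (\<forall>i<n. k i = 0)))"

definition class_T :: "('f::field \<Rightarrow> 'l::ab_group_add \<Rightarrow> 'l) \<Rightarrow> ('l \<Rightarrow> 'l \<Rightarrow> 'l) \<Rightarrow> ('l \<Rightarrow> 'l \<Rightarrow> 'f) \<Rightarrow> 'l set \<Rightarrow> bool" where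
  "class_T s b B H \<longleftrightarrow>
     \<comment> \<open>T1\<close>
     is_lie_algebra s b \<and> sym_bilinear_form s B \<and> invariant_form b B \<and> nondeg_on B UNIV \<and>
     \<comment> \<open>T2\<close>
     fin_dim s H \<and> toral s b H \<and> nondeg_on B H \<and>
     \<comment> \<open>T3\<close>
     (\<forall>\<delta>\<in>roots_0 s b B H. \<exists>x\<in>root_space s b H \<delta>. \<exists>y\<in>root_space s b H (\<lambda>v. - \<delta> v).
         b x y = tvec B H \<delta>) \<and>
     (\<forall>\<alpha>\<in>roots_x s b B H. \<forall>x\<in>root_space s b H \<alpha>. x \<noteq> 0 \<longrightarrow>
         (\<exists>y\<in>root_space s b H (\<lambda>v. - \<alpha> v). b x y = tvec B H \<alpha>)) \<and>
     \<comment> \<open>T4\<close>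
     (\<forall>\<alpha>\<in>roots_x s b B H. \<forall>x\<in>root_space s b H \<alpha>. \<forall>y. \<exists>n. (b x ^^ n) y = 0) \<and>
     \<comment> \<open>T5 (a)\<close>
     \<not> (\<exists>P Q. P \<noteq> {} \<and> Q \<noteq> {} \<and> P \<union> Q = roots_x s b B H \<and> P \<inter> Q = {} \<and>
            (\<forall>\<alpha>\<in>P. \<forall>\<beta>\<in>Q. rform B H \<alpha> \<beta> = 0)) \<and>
     \<comment> \<open>T5 (b)\<close>
     (\<forall>\<delta>\<in>roots_0 s b B H. \<exists>\<alpha>\<in>roots_x s b B H. (\<lambda>v. \<alpha> v + \<delta> v) \<in> roots s b H) \<and>
     \<comment> \<open>T6\<close>
     (\<exists>n. free_abelian_rank (int_span (roots_0 s b B H)) n)"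

definition nullity :: "('f::field \<Rightarrow> 'l::ab_group_add \<Rightarrow> 'l) \<Rightarrow> ('l \<Rightarrow> 'l \<Rightarrow> 'l) \<Rightarrow> ('l \<Rightarrow> 'l \<Rightarrow> 'f) \<Rightarrow> 'l set \<Rightarrow> nat" where
  "nullity s b B H = (THE n. free_abelian_rank (int_span (roots_0 s b B H)) n)"

definition gen_subalg :: "('f::field \<Rightarrow> 'l::ab_group_add \<Rightarrow> 'l) \<Rightarrow> ('l \<Rightarrow> 'l \<Rightarrow> 'l) \<Rightarrow> 'l set \<Rightarrow> 'l set" where
  "gen_subalg s b S = \<Inter> {A. subalgebra s b A \<and> S \<subseteq> A}"

definition core :: "('f::field \<Rightarrow> 'l::ab_group_add \<Rightarrow> 'l) \<Rightarrow> ('l \<Rightarrow> 'l \<Rightarrow> 'l) \<Rightarrow> ('l \<Rightarrow> 'l \<Rightarrow> 'f) \<Rightarrow> 'l set \<Rightarrow> 'l set" where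
  "core s b B H = gen_subalg s b (\<Union>\<alpha>\<in>roots_x s b B H. root_space s b H \<alpha>)"

definition centre_of :: "('l \<Rightarrow> 'l \<Rightarrow> 'l::zero) \<Rightarrow> 'l set \<Rightarrow> 'l set" where
  "centre_of b S = {z\<in>S. \<forall>x\<in>S. b z x = 0}"

definition centralizer :: "('l \<Rightarrow> 'l \<Rightarrow> 'l::zero) \<Rightarrow> 'l set \<Rightarrow> 'l set" where
  "centralizer b S = {z. \<forall>x\<in>S. b z x = 0}"

definition tame :: "('f::field \<Rightarrow> 'l::ab_group_add \<Rightarrow> 'l) \<Rightarrow> ('l \<Rightarrow> 'l \<Rightarrow> 'l) \<Rightarrow> ('l \<Rightarrow> 'l \<Rightarrow> 'f) \<Rightarrow> 'l set \<Rightarrow> bool" where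
  "tame s b B H \<longleftrightarrow> centralizer b (core s b B H) \<subseteq> core s b B H"

text \<open>L_cc = L_c / Z(L_c) is isomorphic (as a Lie algebra) to the Lie algebra (s', b'):
 by the first isomorphism theorem, expressed as the existence of a surjective Lie
 homomorphism from L_c onto the target whose kernel is Z(L_c).\<close>
definition cc_iso_to ::
  "('f::field \<Rightarrow> 'l::ab_group_add \<Rightarrow> 'l) \<Rightarrow> ('l \<Rightarrow> 'l \<Rightarrow> 'l) \<Rightarrow> ('l \<Rightarrow> 'l \<Rightarrow> 'f) \<Rightarrow> 'l set \<Rightarrow>
   ('f \<Rightarrow> 'g::ab_group_add \<Rightarrow> 'g) \<Rightarrow> ('g \<Rightarrow> 'g \<Rightarrow> 'g) \<Rightarrow> bool" where
  "cc_iso_to s b B H s' b' \<longleftrightarrow> (\<exists>\<phi>. let Lc = core s b B H in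
      (\<forall>x\<in>Lc. \<forall>y\<in>Lc. \<phi> (x + y) = \<phi> x + \<phi> y) \<and> (\<forall>c. \<forall>x\<in>Lc. \<phi> (s c x) = s' c (\<phi> x)) \<and>
      (\<forall>x\<in>Lc. \<forall>y\<in>Lc. \<phi> (b x y) = b' (\<phi> x) (\<phi> y)) \<and>
      \<phi> ` Lc = UNIV \<and> {x\<in>Lc. \<phi> x = 0} = centre_of b Lc)"

text \<open>A finite root system (Bourbaki, possibly non-reduced, with 0 adjoined) inside
 the Q-span of a set of functionals, with respect to a Q-valued positive
 definite form r (positivity is checked on the rational values), which is irreducible.\<close>
definition irred_finite_root_system :: "(('l \<Rightarrow> 'f) \<Rightarrow> ('l \<Rightarrow> 'f) \<Rightarrow> 'f) \<Rightarrow> ('l \<Rightarrow> 'f::field_char_0) set \<Rightarrow> bool" where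
  "irred_finite_root_system r R \<longleftrightarrow>
     (\<lambda>v. 0) \<in> R \<and> finite R \<and>
     (\<forall>x\<in>rat_span_fun R. \<forall>y\<in>rat_span_fun R. \<exists>q::rat. r x y = of_rat q) \<and>
     (\<forall>x\<in>rat_span_fun R. x \<noteq> (\<lambda>v. 0) \<longrightarrow> (\<exists>q::rat. q > 0 \<and> r x x = of_rat q)) \<and>
     (\<forall>\<alpha>\<in>R - {\<lambda>v. 0}. \<forall>\<beta>\<in>R. \<exists>k::int. 2 * r \<beta> \<alpha> / r \<alpha> \<alpha> = of_int k \<and>
         (\<lambda>v. \<beta> v - of_int k * \<alpha> v) \<in> R) \<and>
     \<not> (\<exists>P Q. P \<noteq> {} \<and> Q \<noteq> {} \<and> P \<union> Q = R - {\<lambda>v. 0} \<and> P \<inter> Q = {} \<and>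
            (\<forall>\<alpha>\<in>P. \<forall>\<beta>\<in>Q. r \<alpha> \<beta> = 0))"

text \<open>The root system R (with form r) has the same type as the finite root system R'
 (with form r'): the image of R in V/V^0 (V spanned by R over Q, V^0 the radical) is
 isomorphic to R', i.e. there is an additive (hence Q-linear) map on the Q-span of R,
 whose kernel is exactly the radical, mapping R onto R'.\<close>
definition same_type ::
  "(('l \<Rightarrow> 'f) \<Rightarrow> ('l \<Rightarrow> 'f) \<Rightarrow> 'f) \<Rightarrow> ('l \<Rightarrow> 'f::field_char_0) set \<Rightarrow> ('g \<Rightarrow> 'f) set \<Rightarrow> bool" where
  "same_type r R R' \<longleftrightarrow> (\<exists>\<phi> :: ('l \<Rightarrow> 'f) \<Rightarrow> ('g \<Rightarrow> 'f).
      (\<forall>x\<in>rat_span_fun R. \<forall>y\<in>rat_span_fun R. \<phi> (\<lambda>v. x v + y v) = (\<lambda>w. \<phi> x w + \<phi> y w)) \<and>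
      \<phi> ` R = R' \<and>
      (\<forall>x\<in>rat_span_fun R. \<phi> x = (\<lambda>w. 0) \<longleftrightarrow> (\<forall>y\<in>rat_span_fun R. r x y = 0)))"

definition class_D ::
  "('f::field_char_0 \<Rightarrow> 'g::ab_group_add \<Rightarrow> 'g) \<Rightarrow> ('g \<Rightarrow> 'g \<Rightarrow> 'g) \<Rightarrow> ('g \<Rightarrow> 'g \<Rightarrow> 'f) \<Rightarrow> 'g set \<Rightarrow>
   (('n::finite \<Rightarrow> int) \<Rightarrow> 'g set) \<Rightarrow> bool" where
  "class_D s b B h gr \<longleftrightarrow>
    (let R = roots s b h; Rx = R - {\<lambda>v. 0};
         Rred = {\<lambda>v. 0} \<union> {\<alpha>\<in>R. (\<lambda>v. \<alpha> v / 2) \<notin> R};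
         G = root_space s b h; supp = {\<sigma>. gr \<sigma> \<noteq> {0}}; z = (\<lambda>i. 0 :: int) in
    is_lie_algebra s b \<and> sym_bilinear_form s B \<and>
    \<comment> \<open>D1\<close>
    nondeg_on B UNIV \<and> invariant_form b B \<and>
    \<comment> \<open>D2\<close>
    fin_dim s h \<and> toral s b h \<and>
    \<comment> \<open>D3\<close>
    nondeg_on B h \<and>
    (\<forall>x\<in>rat_span s (tvec B h ` R). \<forall>y\<in>rat_span s (tvec B h ` R). \<exists>q::rat. B x y = of_rat q) \<and>
    \<comment> \<open>D4\<close>
    irred_finite_root_system (rform B h) R \<and>
    \<comment> \<open>D5\<close>
    (\<forall>\<sigma>. module.subspace s (gr \<sigma>)) \<and>
    (\<forall>x. \<exists>F xs. finite F \<and> (\<forall>\<sigma>\<in>F. xs \<sigma> \<in> gr \<sigma>) \<and> x = (\<Sum>\<sigma>\<in>F. xs \<sigma>)) \<and>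
    (\<forall>F xs. finite F \<and> (\<forall>\<sigma>\<in>F. xs \<sigma> \<in> gr \<sigma>) \<and> (\<Sum>\<sigma>\<in>F. xs \<sigma>) = 0 \<longrightarrow> (\<forall>\<sigma>\<in>F. xs \<sigma> = 0)) \<and>
    (\<forall>\<sigma> \<tau>. \<forall>x\<in>gr \<sigma>. \<forall>y\<in>gr \<tau>. b x y \<in> gr (\<lambda>i. \<sigma> i + \<tau> i)) \<and>
    \<comment> \<open>D6\<close>
    (\<forall>\<alpha>\<in>R. \<forall>x\<in>G \<alpha>. \<exists>F xs. finite F \<and> (\<forall>\<sigma>\<in>F. xs \<sigma> \<in> gr \<sigma> \<inter> G \<alpha>) \<and> x = (\<Sum>\<sigma>\<in>F. xs \<sigma>)) \<and>
    \<comment> \<open>D7\<close>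
    h \<subseteq> gr z \<inter> G (\<lambda>v. 0) \<and>
    \<comment> \<open>D8\<close>
    G (\<lambda>v. 0) = module.span s {b x y | x y \<alpha>. \<alpha> \<in> Rx \<and> x \<in> G \<alpha> \<and> y \<in> G (\<lambda>v. - \<alpha> v)} \<and>
    \<comment> \<open>D9: the subgroup generated by the support has rank nu (its Q-span is all of Q^nu)\<close>
    (\<forall>w::'n \<Rightarrow> int. (\<forall>\<sigma>\<in>supp. (\<Sum>i\<in>UNIV. w i * \<sigma> i) = 0) \<longrightarrow> w = z) \<and>
    \<comment> \<open>D10\<close>
    (\<forall>\<sigma>\<in>supp. \<forall>\<tau>\<in>supp. (\<lambda>i. \<sigma> i + \<tau> i) \<noteq> z \<longrightarrow> (\<forall>x\<in>gr \<sigma>. \<forall>y\<in>gr \<tau>. B x y = 0)) \<and>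
    \<comment> \<open>D11\<close>
    (\<forall>\<alpha>\<in>Rred - {\<lambda>v. 0}. gr z \<inter> G \<alpha> \<noteq> {0}) \<and>
    \<comment> \<open>D12 (a)\<close>
    (\<forall>\<alpha>\<in>Rx. \<forall>\<sigma>. \<forall>x\<in>gr \<sigma> \<inter> G \<alpha>. x \<noteq> 0 \<longrightarrow>
        (\<exists>y\<in>gr (\<lambda>i. - \<sigma> i) \<inter> G (\<lambda>v. - \<alpha> v). b x y = tvec B h \<alpha>)) \<and>
    \<comment> \<open>D12 (b)\<close>
    (\<forall>\<sigma>. gr \<sigma> \<inter> G (\<lambda>v. 0) \<noteq> {0} \<longrightarrow>
        (\<exists>x\<in>gr \<sigma> \<inter> G (\<lambda>v. 0). \<exists>y\<in>gr (\<lambda>i. - \<sigma> i) \<inter> G (\<lambda>v. 0). b x y = 0 \<and> B x y = 1)))"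

text \<open>An element (x, c, e) of 'g \<times> ('n => 'f) \<times> ('n => 'f) stands for
 x + sum_i c_i c_i + sum_i e_i d_i.\<close>

definition scaleL :: "('f::field \<Rightarrow> 'g \<Rightarrow> 'g) \<Rightarrow> 'f \<Rightarrow> 'g \<times> ('n \<Rightarrow> 'f) \<times> ('n \<Rightarrow> 'f) \<Rightarrow> 'g \<times> ('n \<Rightarrow> 'f) \<times> ('n \<Rightarrow> 'f)" where
  "scaleL s a = (\<lambda>(x, c, e). (s a x, \<lambda>i. a * c i, \<lambda>i. a * e i))"

definition bracketL ::
  "('f::field \<Rightarrow> 'g::ab_group_add \<Rightarrow> 'g) \<Rightarrow> ('g \<Rightarrow> 'g \<Rightarrow> 'g) \<Rightarrow> ('g \<Rightarrow> 'g \<Rightarrow> 'f) \<Rightarrow> ('n::finite \<Rightarrow> 'g \<Rightarrow> 'g) \<Rightarrow>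
   'g \<times> ('n \<Rightarrow> 'f) \<times> ('n \<Rightarrow> 'f) \<Rightarrow> 'g \<times> ('n \<Rightarrow> 'f) \<times> ('n \<Rightarrow> 'f) \<Rightarrow> 'g \<times> ('n \<Rightarrow> 'f) \<times> ('n \<Rightarrow> 'f)" where
  "bracketL s b B d = (\<lambda>(x, c, e) (y, c', e').
     (b x y + (\<Sum>i\<in>UNIV. s (e i) (d i y)) - (\<Sum>i\<in>UNIV. s (e' i) (d i x)),
      \<lambda>i. B (d i x) y, \<lambda>i. 0))"

definition formL ::
  "('g \<Rightarrow> 'g \<Rightarrow> 'f::field) \<Rightarrow> 'g \<times> ('n::finite \<Rightarrow> 'f) \<times> ('n \<Rightarrow> 'f) \<Rightarrow> 'g \<times> ('n \<Rightarrow> 'f) \<times> ('n \<Rightarrow> 'f) \<Rightarrow> 'f" where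
  "formL B = (\<lambda>(x, c, e) (y, c', e'). B x y + (\<Sum>i\<in>UNIV. c i * e' i + e i * c' i))"

definition HL :: "'g set \<Rightarrow> ('g \<times> ('n \<Rightarrow> 'f) \<times> ('n \<Rightarrow> 'f)) set" where
  "HL h = {(x, c, e). x \<in> h}"

end

theory Submission
  imports Defs
begin

text \<open>A functional on \<open>\<H>\<close> that has a nonzero root space vanishes on \<open>C\<close>, so it is \<open>\<alpha> + \<sigma>\<close> with
  \<open>\<alpha>\<close> a root of \<open>\<G>\<close> and \<open>\<sigma>\<close> a degree, and its root space is the homogeneous part of \<open>\<G>\<close> of
  that weight and degree (enlarged by \<open>C \<oplus> D\<close> for the zero root). Moreover
  \<open>t_(\<alpha> + \<sigma>) = t_\<alpha> + \<Sum> \<sigma>\<^sub>i c\<^sub>i\<close>, so the form on the roots forgets \<open>\<sigma>\<close>; this turns the axioms of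
  \<open>\<T>\<close> into those of \<open>\<D>\<close>. The remaining input is that every degree in the support of \<open>\<G>\<close>
  already occurs in weight zero: by \<open>sl\<^sub>2\<close>-theory, a degree zero root vector of a reduced root
  lowers any vector of weight \<open>\<alpha>\<close> or \<open>2\<alpha>\<close> without killing it. Hence the isotropic roots span a
  lattice of rank \<open>\<nu>\<close>, and, as \<open>\<G>\<close> is centreless, each isotropic \<open>\<sigma>\<close> is a difference of two
  non-isotropic roots with the same \<open>\<alpha>\<close>, which puts \<open>\<Sum> \<sigma>\<^sub>i c\<^sub>i\<close> into the core.\<close>

subsection \<open>Integral and rational spans of functions\<close>

text \<open>D9 concerns the whole support of the grading, while isotropic roots only see degrees
  occurring in weight zero. This gap forces the \<open>sl\<^sub>2\<close> argument, and D11 is what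
  makes it work: a lowering vector of degree zero changes the weight without moving the degree. As
  D11 speaks of reduced roots only, a root \<open_placeholder>

  The fragment above is void because it contains a stray symbol. The complete list follows.\<close>

text \<open>The coefficient map \<open>g\<close> is \<open>of_int\<close> or \<open>of_rat\<close>,
  so that integral and rational spans share their closure properties and one induction rule.\<close>

definition comb_span :: "('k::comm_ring_1 \<Rightarrow> 'f::field) \<Rightarrow> ('l \<Rightarrow> 'f) set \<Rightarrow> ('l \<Rightarrow> 'f) set" where
  "comb_span g A = {f. \<exists>F k. finite F \<and> F \<subseteq> A \<and> f = (\<lambda>v. \<Sum>a\<in>F. g (k a) * a v)}"

lemma int_span_eq: "int_span A = comb_span of_int A"
  by (simp add: int_span_def comb_span_def)

lemma rat_span_fun_eq: "rat_span_fun A = comb_span of_rat A"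
  by (simp add: rat_span_fun_def comb_span_def)

lemma comb_span_least:
  assumes "f \<in> comb_span g A" and "A \<subseteq> S" and "(\<lambda>v. 0) \<in> S"
    and "\<And>x y. x \<in> S \<Longrightarrow> y \<in> S \<Longrightarrow> (\<lambda>v. x v + y v) \<in> S"
    and "\<And>c x. x \<in> S \<Longrightarrow> (\<lambda>v. g c * x v) \<in> S"
  shows "f \<in> S"
proof -
  obtain F k where F: "finite F" "F \<subseteq> A" "f = (\<lambda>v. \<Sum>a\<in>F. g (k a) * a v)"
    using assms(1) by (auto simp: comb_span_def)
  have "(\<lambda>v. \<Sum>a\<in>F. g (k a) * a v) \<in> S" using F(1,2)
  proof (induction F rule: finite_induct)
    case empty
    then show ?case by (simp add: assms(3))
  next
    case (insert a F)
    have "(\<lambda>v. g (k a) * a v + (\<Sum>a\<in>F. g (k a) * a v)) \<in> S"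
      using insert assms(2) by (intro assms(4,5)) auto
    then show ?case using insert by simp
  qed
  then show ?thesis using F(3) by simp
qed

lemma comb_span_base:
  assumes "g 1 = 1" "a \<in> A"
  shows "a \<in> comb_span g A"
  unfolding comb_span_def using assms
  by (auto intro!: exI[of _ "{a}"] exI[of _ "\<lambda>_. 1"])

lemma comb_span_zero: "(\<lambda>v. 0) \<in> comb_span g A"
  unfolding comb_span_def by (auto intro!: exI[of _ "{}"])

lemma comb_span_add:
  assumes g: "g 0 = 0" "\<And>x y. g (x + y) = g x + g y"
    and "x \<in> comb_span g A" "y \<in> comb_span g A"
  shows "(\<lambda>v. x v + y v) \<in> comb_span g A"
proof -
  obtain F k where F: "finite F" "F \<subseteq> A" "x = (\<lambda>v. \<Sum>a\<in>F. g (k a) * a v)"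
    using assms(3) by (auto simp: comb_span_def)
  obtain F' k' where F': "finite F'" "F' \<subseteq> A" "y = (\<lambda>v. \<Sum>a\<in>F'. g (k' a) * a v)"
    using assms(4) by (auto simp: comb_span_def)
  \<comment> \<open>Both coefficient families are extended by zero, so that the two sums run over
    the same index set.\<close>
  let ?k = "\<lambda>a. (if a \<in> F then k a else 0) + (if a \<in> F' then k' a else 0)"
  have "x v + y v = (\<Sum>a\<in>F \<union> F'. g (?k a) * a v)" for v
  proof -
    have "x v = (\<Sum>a\<in>F \<union> F'. g (if a \<in> F then k a else 0) * a v)"
      unfolding F(3) using F(1) F'(1) g(1) by (intro sum.mono_neutral_cong_left) auto
    moreover have "y v = (\<Sum>a\<in>F \<union> F'. g (if a \<in> F' then k' a else 0) * a v)"
      unfolding F'(3) using F(1) F'(1) g(1) by (intro sum.mono_neutral_cong_left) auto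
    ultimately show ?thesis by (simp only: g(2) distrib_right sum.distrib)
  qed
  then show ?thesis unfolding comb_span_def using F F'
    by (auto intro!: exI[of _ "F \<union> F'"] exI[of _ ?k])
qed

lemma comb_span_scale:
  assumes "\<And>x y. g (x * y) = g x * g y" "x \<in> comb_span g A"
  shows "(\<lambda>v. g c * x v) \<in> comb_span g A"
proof -
  obtain F k where F: "finite F" "F \<subseteq> A" "x = (\<lambda>v. \<Sum>a\<in>F. g (k a) * a v)"
    using assms(2) by (auto simp: comb_span_def)
  have "(\<lambda>v. g c * x v) = (\<lambda>v. \<Sum>a\<in>F. g (c * k a) * a v)"
    by (simp add: F(3) assms(1) sum_distrib_left mult.assoc)
  then show ?thesis unfolding comb_span_def using F by auto
qed

lemma comb_span_sum:
  assumes g: "g 0 = 0" "\<And>x y. g (x + y) = g x + g y"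
    and "finite I" "\<And>i. i \<in> I \<Longrightarrow> x i \<in> comb_span g A"
  shows "(\<lambda>v. \<Sum>i\<in>I. x i v) \<in> comb_span g A"
  using assms(3,4)
proof (induction I rule: finite_induct)
  case empty
  then show ?case by (simp add: comb_span_zero)
next
  case (insert i I)
  then have "(\<lambda>v. x i v + (\<Sum>i\<in>I. x i v)) \<in> comb_span g A"
    by (intro comb_span_add g) auto
  then show ?case using insert by simp
qed

section \<open>Uniqueness of the rank of a free abelian group\<close>

lemma common_denominator:
  fixes q :: "'a \<Rightarrow> rat"
  assumes "finite I"
  shows "\<exists>N > (0::int). \<forall>i\<in>I. \<exists>k::int. of_int N * q i = of_int k"
  using assms
proof (induction I rule: finite_induct)
  case empty
  then show ?case by (auto intro: exI[of _ 1])
next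
  case (insert i I)
  then obtain N :: int where N: "N > 0" "\<forall>i\<in>I. \<exists>k::int. of_int N * q i = of_int k" by auto
  obtain n m :: int where nm: "m > 0" "q i = of_int n / of_int m"
    by (metis Rat_cases Fract_of_int_quotient)
  have "\<exists>k::int. of_int (N * m) * q j = of_int k" if "j \<in> insert i I" for j
  proof (cases "j = i")
    case True
    then show ?thesis using nm by (intro exI[of _ "N * n"]) simp
  next
    case False
    then have "j \<in> I" using that by simp
    then obtain k :: int where "of_int N * q j = of_int k" using N(2) by blast
    then have "of_int (N * m) * q j = of_int (m * k)"
      by (metis mult.assoc mult.commute of_int_mult)
    then show ?thesis by blast
  qed
  then show ?case using N nm by (intro exI[of _ "N * m"]) simp
qed

text \<open>A basis independent over the integers stays independent over the rationals, so the
  exchange lemma in the rational vector space of functions bounds its size by that of any other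
  generating family. Uniqueness is required because \<open>nullity\<close> is a definite
  description.\<close>

lemma free_abelian_rank_le:
  fixes \<Lambda> :: "('l \<Rightarrow> 'f::field_char_0) set"
  assumes "free_abelian_rank \<Lambda> n" "free_abelian_rank \<Lambda> m"
  shows "n \<le> m"
proof -
  define sc where "sc = (\<lambda>(q::rat) (f::'l \<Rightarrow> 'f) v. of_rat q * f v)"
  interpret Q: vector_space sc
    by unfold_locales (auto simp: sc_def fun_eq_iff algebra_simps of_rat_add of_rat_mult)
  obtain e where e: "\<Lambda> = int_span (e ` {..<n})"
      "\<And>k :: nat \<Rightarrow> int. (\<lambda>v. \<Sum>i<n. of_int (k i) * e i v) = (\<lambda>v. 0) \<Longrightarrow> \<forall>i<n. k i = 0"
    using assms(1) unfolding free_abelian_rank_def by blast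
  obtain e' where e': "\<Lambda> = int_span (e' ` {..<m})"
    using assms(2) unfolding free_abelian_rank_def by blast
  \<comment> \<open>Two equal basis members would satisfy the relation with coefficients 1 and
    -1.\<close>
  have inj: "inj_on e {..<n}"
  proof (rule inj_onI)
    fix i j assume ij: "i \<in> {..<n}" "j \<in> {..<n}" "e i = e j"
    show "i = j"
    proof (rule ccontr)
      assume "i \<noteq> j"
      define k :: "nat \<Rightarrow> int" where "k t = (if t = i then 1 else if t = j then -1 else 0)" for t
      have "(\<Sum>t<n. of_int (k t) * e t v) = (\<Sum>t\<in>{i,j}. of_int (k t) * e t v)" for v
        using ij by (intro sum.mono_neutral_right) (auto simp: k_def)
      then have "(\<lambda>v. \<Sum>t<n. of_int (k t) * e t v) = (\<lambda>v. 0)"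
        using \<open>i \<noteq> j\<close> ij(3) by (simp add: k_def)
      then have "k i = 0" using e(2) ij(1) by blast
      then show False by (simp add: k_def)
    qed
  qed
  have "Q.independent (e ` {..<n})"
  proof (rule Q.independent_if_scalars_zero)
    show "finite (e ` {..<n})" by simp
    fix u x assume u: "(\<Sum>x\<in>e ` {..<n}. sc (u x) x) = 0" and x: "x \<in> e ` {..<n}"
    \<comment> \<open>Clearing denominators turns the rational relation into an integral one, to
      which the independence of \<open>e\<close> applies.\<close>
    obtain N :: int where N: "N > 0" "\<forall>i\<in>{..<n}. \<exists>k::int. of_int N * u (e i) = of_int k"
      using common_denominator[of "{..<n}" "\<lambda>i. u (e i)"] by auto
    then obtain k :: "nat \<Rightarrow> int" where k: "\<And>i. i < n \<Longrightarrow> of_int N * u (e i) = of_int (k i)"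
      by (metis lessThan_iff)
    have "(\<Sum>i<n. of_int (k i) * e i v) = 0" for v
    proof -
      have "(\<Sum>i<n. of_int (k i) * e i v) = (\<Sum>i<n. of_int N * (of_rat (u (e i)) * e i v))"
      proof (rule sum.cong[OF refl])
        fix i assume "i \<in> {..<n}"
        then have "of_rat (of_int N * u (e i)) = (of_rat (of_int (k i)) :: 'f)" using k by simp
        then show "of_int (k i) * e i v = of_int N * (of_rat (u (e i)) * e i v)"
          by (simp add: of_rat_mult mult.assoc[symmetric])
      qed
      also have "\<dots> = of_int N * (\<Sum>x\<in>e ` {..<n}. sc (u x) x v)"
        by (simp add: sum.reindex[OF inj] sc_def sum_distrib_left)
      also have "(\<Sum>x\<in>e ` {..<n}. sc (u x) x v) = (\<Sum>x\<in>e ` {..<n}. sc (u x) x) v"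
        by (induction rule: infinite_finite_induct) auto
      finally show ?thesis using u by simp
    qed
    then have "\<forall>i<n. k i = 0" using e(2)[of k] by auto
    then show "u x = 0" using x k N(1) by force
  qed
  moreover have "e ` {..<n} \<subseteq> Q.span (e' ` {..<m})"
  proof
    fix x assume "x \<in> e ` {..<n}"
    then have "x \<in> comb_span of_int (e' ` {..<m})"
      using e(1) e' comb_span_base[of of_int x "e ` {..<n}"] by (simp add: int_span_eq)
    then show "x \<in> Q.span (e' ` {..<m})"
    proof (rule comb_span_least)
      show "e' ` {..<m} \<subseteq> Q.span (e' ` {..<m})" by (rule Q.span_superset)
      show "(\<lambda>v. 0) \<in> Q.span (e' ` {..<m})" using Q.span_zero by (simp add: zero_fun_def)
      show "(\<lambda>v. x v + y v) \<in> Q.span (e' ` {..<m})"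
        if "x \<in> Q.span (e' ` {..<m})" "y \<in> Q.span (e' ` {..<m})" for x y
        using Q.span_add[OF that] by (simp add: plus_fun_def)
      show "(\<lambda>v. of_int c * x v) \<in> Q.span (e' ` {..<m})"
        if "x \<in> Q.span (e' ` {..<m})" for c x
        using Q.span_scale[OF that, of "of_int c"] by (simp add: sc_def)
    qed
  qed
  ultimately have "card (e ` {..<n}) \<le> card (e' ` {..<m})"
    using Q.independent_span_bound by blast
  also have "\<dots> \<le> m" using card_image_le[of "{..<m}" e'] by simp
  finally show ?thesis using card_image[OF inj] by simp
qed

lemma free_abelian_rank_unique:
  fixes \<Lambda> :: "('l \<Rightarrow> 'f::field_char_0) set"
  assumes "free_abelian_rank \<Lambda> n" "free_abelian_rank \<Lambda> m"
  shows "n = m"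
  using free_abelian_rank_le assms by (metis order_antisym)

subsection \<open>Lattices of full rank\<close>

text \<open>Gaussian elimination over the integers: the elements of \<open>\<Lambda>\<close> with minimal positive
  \<open>i\<close>-th coordinate split off one basis vector, and the orthogonality hypothesis passes on to
  the sublattice of elements whose \<open>i\<close>-th coordinate vanishes.\<close>

lemma full_lattice_basis:
  fixes \<Lambda> :: "('n \<Rightarrow> int) set"
  assumes "finite I"
    and "0 \<in> \<Lambda>" and "\<And>x y. x \<in> \<Lambda> \<Longrightarrow> y \<in> \<Lambda> \<Longrightarrow> x + y \<in> \<Lambda>"
    and "\<And>k x. x \<in> \<Lambda> \<Longrightarrow> (\<lambda>j. k * x j) \<in> \<Lambda>"
    and "\<And>x i. x \<in> \<Lambda> \<Longrightarrow> i \<notin> I \<Longrightarrow> x i = 0"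
    and "\<And>w i. (\<And>x. x \<in> \<Lambda> \<Longrightarrow> (\<Sum>i\<in>I. w i * x i) = 0) \<Longrightarrow> i \<in> I \<Longrightarrow> w i = 0"
  shows "(\<exists>N>0. \<forall>i\<in>I. (\<lambda>j. if j = i then N else 0) \<in> \<Lambda>) \<and>
    (\<exists>e. (\<forall>t<card I. e t \<in> \<Lambda>) \<and> (\<forall>x\<in>\<Lambda>. \<exists>k. x = (\<lambda>j. \<Sum>t<card I. k t * e t j)) \<and>
       (\<forall>k. (\<forall>j. (\<Sum>t<card I. k t * e t j) = 0) \<longrightarrow> (\<forall>t<card I. k t = 0)))"
  using assms
proof (induction I arbitrary: \<Lambda> rule: finite_induct)
  case empty
  then have "\<And>x. x \<in> \<Lambda> \<Longrightarrow> x = (\<lambda>j. 0)" by auto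
  then show ?case by (auto intro: exI[of _ 1])
next
  case (insert i I)
  note zero = insert.prems(1) and add = insert.prems(2) and scl = insert.prems(3)
    and supp = insert.prems(4) and orth = insert.prems(5)
  have "\<exists>x\<in>\<Lambda>. x i \<noteq> 0"
  proof (rule ccontr)
    assume none: "\<not> ?thesis"
    \<comment> \<open>Otherwise the unit vector at \<open>i\<close> would be orthogonal to all of
      \<open>\<Lambda>\<close>.\<close>
    then have "(\<Sum>j\<in>insert i I. (if j = i then 1 else 0) * x j) = 0" if "x \<in> \<Lambda>" for x
    proof -
      have "(\<Sum>j\<in>I. (if j = i then 1 else 0) * x j) = 0"
        using insert.hyps by (intro sum.neutral) auto
      then show ?thesis using none that insert.hyps by simp
    qed
    from orth[OF this, of i] show False by simp
  qed
  then obtain x0 where x0: "x0 \<in> \<Lambda>" "x0 i \<noteq> 0" by blast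
  have "\<exists>x\<in>\<Lambda>. x i > 0"
  proof (cases "x0 i > 0")
    case True
    then show ?thesis using x0 by blast
  next
    case False
    then show ?thesis using x0 scl[OF x0(1), of "-1"] by (intro bexI[of _ "\<lambda>j. -1 * x0 j"]) auto
  qed
  then have ex: "\<exists>m. m > 0 \<and> (\<exists>x\<in>\<Lambda>. x i = int m)"
    by (metis of_nat_0_less_iff pos_int_cases)
  define m where "m = (LEAST m. m > 0 \<and> (\<exists>x\<in>\<Lambda>. x i = int m))"
  have "m > 0 \<and> (\<exists>x\<in>\<Lambda>. x i = int m)"
    unfolding m_def by (rule LeastI_ex) (rule ex)
  then obtain v where m: "m > 0" and v: "v \<in> \<Lambda>" "v i = int m" by blast
  have min: "m \<le> m'" if "m' > 0" "x \<in> \<Lambda>" "x i = int m'" for m' x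
    unfolding m_def using that by (intro Least_le) blast
  define \<Lambda>' where "\<Lambda>' = {x\<in>\<Lambda>. x i = 0}"
  have red: "(\<lambda>j. x j - (x i div int m) * v j) \<in> \<Lambda>'" if x: "x \<in> \<Lambda>" for x
  proof -
    \<comment> \<open>Division with remainder by \<open>v\<close>: the new \<open>i\<close>-th
      coordinate is \<open>x i mod int m\<close>, hence zero by minimality of
      \<open>m\<close>.\<close>
    let ?y = "x + (\<lambda>j. - (x i div int m) * v j)"
    have y: "?y \<in> \<Lambda>" using x v scl add by blast
    have yi: "?y i = x i mod int m" using v(2) by (simp add: minus_div_mult_eq_mod[symmetric])
    then have "?y i \<ge> 0" "?y i < int m" using m by simp_all
    then have "?y i = 0" using min[of "nat (?y i)" ?y] y by force
    moreover have "?y = (\<lambda>j. x j - (x i div int m) * v j)" by (simp add: fun_eq_iff)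
    ultimately show ?thesis using y by (simp add: \<Lambda>'_def)
  qed
  have IH: "(\<exists>N>0. \<forall>i\<in>I. (\<lambda>j. if j = i then N else 0) \<in> \<Lambda>') \<and>
    (\<exists>e. (\<forall>t<card I. e t \<in> \<Lambda>') \<and> (\<forall>x\<in>\<Lambda>'. \<exists>k. x = (\<lambda>j. \<Sum>t<card I. k t * e t j)) \<and>
       (\<forall>k. (\<forall>j. (\<Sum>t<card I. k t * e t j) = 0) \<longrightarrow> (\<forall>t<card I. k t = 0)))"
  proof (rule insert.IH)
    show "0 \<in> \<Lambda>'" using zero unfolding \<Lambda>'_def zero_fun_def by simp
    show "x + y \<in> \<Lambda>'" if "x \<in> \<Lambda>'" "y \<in> \<Lambda>'" for x y
      using that add[of x y] unfolding \<Lambda>'_def plus_fun_def by simp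
    show "(\<lambda>j. k * x j) \<in> \<Lambda>'" if "x \<in> \<Lambda>'" for k x using that scl by (simp add: \<Lambda>'_def)
    show "x j = 0" if "x \<in> \<Lambda>'" "j \<notin> I" for x j
      using that supp by (cases "j = i") (auto simp: \<Lambda>'_def)
    fix w j assume w: "\<And>x. x \<in> \<Lambda>' \<Longrightarrow> (\<Sum>i\<in>I. w i * x i) = 0" and j: "j \<in> I"
    let ?p = "\<Sum>i\<in>I. w i * v i"
    \<comment> \<open>The entry at \<open>i\<close> is chosen to make \<open>?w\<close> orthogonal
      to \<open>v\<close>. On \<open>\<Lambda>'\<close> the pairing with \<open>?w\<close> is
      \<open>m\<close> times the pairing with \<open>w\<close>, so \<open>?w\<close> is orthogonal
      to all of \<open>\<Lambda>\<close>.\<close>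
    let ?w = "\<lambda>j. if j = i then - ?p else int m * w j"
    have sum_w: "(\<Sum>j\<in>insert i I. ?w j * x j) = int m * (\<Sum>j\<in>I. w j * x j) - ?p * x i" for x
    proof -
      have "(\<Sum>j\<in>I. ?w j * x j) = (\<Sum>j\<in>I. int m * (w j * x j))"
        using insert.hyps by (intro sum.cong) auto
      then show ?thesis using insert.hyps by (simp add: sum_distrib_left)
    qed
    have "(\<Sum>j\<in>insert i I. ?w j * x j) = 0" if x: "x \<in> \<Lambda>" for x
    proof -
      let ?q = "x i div int m"
      have red0: "(\<Sum>j\<in>I. w j * (x j - ?q * v j)) = 0" using w[OF red[OF x]] .
      have "(\<Sum>j\<in>I. w j * x j) = ?q * ?p"
        using red0 by (simp add: algebra_simps sum_subtractf sum_distrib_left)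
      moreover have "x i = ?q * int m" using red[OF x] v(2) by (simp add: \<Lambda>'_def)
      ultimately show ?thesis unfolding sum_w by (simp add: algebra_simps)
    qed
    then have "?w j = 0" using orth[of ?w j] j by blast
    then show "w j = 0" using m j insert.hyps by (auto split: if_splits)
  qed
  then obtain N where N: "N > 0" "\<And>j. j \<in> I \<Longrightarrow> (\<lambda>t. if t = j then N else 0) \<in> \<Lambda>'" by blast
  obtain e where e: "\<And>t. t < card I \<Longrightarrow> e t \<in> \<Lambda>'"
      "\<And>x. x \<in> \<Lambda>' \<Longrightarrow> \<exists>k. x = (\<lambda>j. \<Sum>t<card I. k t * e t j)"
      "\<And>k. (\<And>j. (\<Sum>t<card I. k t * e t j) = 0) \<Longrightarrow> (\<forall>t<card I. k t = 0)"
    using IH by blast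
  let ?n = "card I"
  have card: "card (insert i I) = Suc ?n" using insert.hyps by simp
  let ?e = "\<lambda>t. if t = ?n then v else e t"
  have sum_e: "(\<Sum>t<Suc ?n. k t * ?e t j) = (\<Sum>t<?n. k t * e t j) + k ?n * v j" for k j
    by simp
  have "\<exists>e. (\<forall>t<Suc ?n. e t \<in> \<Lambda>) \<and> (\<forall>x\<in>\<Lambda>. \<exists>k. x = (\<lambda>j. \<Sum>t<Suc ?n. k t * e t j)) \<and>
       (\<forall>k. (\<forall>j. (\<Sum>t<Suc ?n. k t * e t j) = 0) \<longrightarrow> (\<forall>t<Suc ?n. k t = 0))"
  proof (rule exI[of _ ?e], intro conjI ballI allI impI)
    fix t assume "t < Suc ?n"
    then show "?e t \<in> \<Lambda>" using e(1)[of t] v by (auto simp: \<Lambda>'_def less_Suc_eq)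
  next
    fix x assume x: "x \<in> \<Lambda>"
    let ?q = "x i div int m"
    obtain k where k: "(\<lambda>j. x j - ?q * v j) = (\<lambda>j. \<Sum>t<?n. k t * e t j)"
      using e(2)[OF red[OF x]] by blast
    let ?k = "\<lambda>t. if t = ?n then ?q else k t"
    have "x j = (\<Sum>t<Suc ?n. ?k t * ?e t j)" for j
    proof -
      have "x j = (\<Sum>t<?n. k t * e t j) + ?q * v j"
        using fun_cong[OF k, of j] by (simp only: diff_eq_eq)
      also have "(\<Sum>t<?n. k t * e t j) = (\<Sum>t<?n. ?k t * e t j)"
        by (intro sum.cong) auto
      also have "\<dots> + ?q * v j = (\<Sum>t<Suc ?n. ?k t * ?e t j)"
        unfolding sum_e by (simp only: if_True simp_thms)
      finally show ?thesis .
    qed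
    then show "\<exists>k. x = (\<lambda>j. \<Sum>t<Suc ?n. k t * ?e t j)" by (intro exI[of _ ?k]) (rule ext)
  next
    fix k t assume k: "\<forall>j. (\<Sum>t<Suc ?n. k t * ?e t j) = 0" and t: "t < Suc ?n"
    have "(\<Sum>t<?n. k t * e t i) = 0" using e(1) by (intro sum.neutral) (auto simp: \<Lambda>'_def)
    moreover have "(\<Sum>t<?n. k t * e t i) + k ?n * v i = 0" using k sum_e[of k i] by metis
    ultimately have kn: "k ?n = 0" using v(2) m by simp
    have "(\<Sum>t<?n. k t * e t j) = 0" for j
    proof -
      have "(\<Sum>t<?n. k t * e t j) + k ?n * v j = 0" using k sum_e[of k j] by metis
      then show ?thesis using kn by simp
    qed
    then have "\<forall>t<?n. k t = 0" by (rule e(3))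
    then show "k t = 0" using kn t by (auto simp: less_Suc_eq)
  qed
  moreover have "\<exists>N>0. \<forall>i\<in>insert i I. (\<lambda>j. if j = i then N else 0) \<in> \<Lambda>"
  \<comment> \<open>The vector \<open>N * v\<close> has \<open>i\<close>-th entry
    \<open>N * m\<close>. Its other entries are multiples of \<open>N\<close> and can be cleared
    with the vectors supplied by the induction hypothesis.\<close>
  proof (intro exI[of _ "N * int m"] conjI ballI)
    show "N * int m > 0" using N m by simp
    fix i' assume i': "i' \<in> insert i I"
    have sumL: "(\<lambda>j. \<Sum>t\<in>J. c t * (if j = t then N else 0)) \<in> \<Lambda>" if "J \<subseteq> I" "finite J" for c J
      using that(2,1)
    proof (induction J rule: finite_induct)
      case empty
      then show ?case using zero by (simp add: zero_fun_def)
    next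
      case (insert t J)
      have "(\<lambda>j. c t * (if j = t then N else 0)) \<in> \<Lambda>"
        using N(2)[of t] insert scl by (simp add: \<Lambda>'_def)
      from add[OF this insert.IH] insert show ?case by (simp add: plus_fun_def)
    qed
    show "(\<lambda>j. if j = i' then N * int m else 0) \<in> \<Lambda>"
    proof (cases "i' = i")
      case False
      then have "(\<lambda>j. int m * (if j = i' then N else 0)) \<in> \<Lambda>"
        using N(2)[of i'] i' scl by (simp add: \<Lambda>'_def)
      moreover have "(\<lambda>j. int m * (if j = i' then N else 0)) = (\<lambda>j. if j = i' then N * int m else 0)"
        by auto
      ultimately show ?thesis by simp
    next
      case True
      have "(\<lambda>j. N * v j) + (\<lambda>j. \<Sum>t\<in>I. - v t * (if j = t then N else 0)) \<in> \<Lambda>"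
        using add scl v sumL[of I "\<lambda>t. - v t"] insert.hyps by blast
      moreover have "(\<lambda>j. N * v j) + (\<lambda>j. \<Sum>t\<in>I. - v t * (if j = t then N else 0))
          = (\<lambda>j. if j = i' then N * int m else 0)"
      proof
        fix j
        have eq: "(\<Sum>t\<in>I. - v t * (if j = t then N else 0)) = (if j \<in> I then - v j * N else 0)"
        proof -
          have "(\<Sum>t\<in>I. - v t * (if j = t then N else 0)) = (\<Sum>t\<in>I. if j = t then - v t * N else 0)"
            by (intro sum.cong) auto
          then show ?thesis using insert.hyps by (simp add: sum.delta')
        qed
        have "N * v j + (if j \<in> I then - v j * N else 0) = (if j = i' then N * int m else 0)"
          using True v insert.hyps supp[OF v(1), of j] by auto
        then show "((\<lambda>j. N * v j) + (\<lambda>j. \<Sum>t\<in>I. - v t * (if j = t then N else 0))) j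
          = (if j = i' then N * int m else 0)"
          unfolding plus_fun_def eq .
      qed
      ultimately show ?thesis by simp
    qed
  qed
  ultimately show ?case unfolding card by blast
qed

subsection \<open>Lie algebras with an invariant form\<close>

text \<open>The classical fact that a functional vanishing on the common kernel of finitely many
  functionals is a combination of them, applied to pairing with the elements of \<open>A\<close>. It
  produces the vectors \<open>t_\<alpha>\<close> without counting dimensions.\<close>

lemma (in vector_space) functional_vanishing_on_perp:
  assumes B: "sym_bilinear_form scale B"
    and H: "subspace H" and A: "finite A" "A \<subseteq> H"
    and f: "\<And>x y. x \<in> H \<Longrightarrow> y \<in> H \<Longrightarrow> f (x + y) = f x + f y"
      "\<And>c x. x \<in> H \<Longrightarrow> f (scale c x) = c * f x"
    and "\<And>v. v \<in> H \<Longrightarrow> (\<And>a. a \<in> A \<Longrightarrow> B v a = 0) \<Longrightarrow> f v = 0"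
  shows "\<exists>t\<in>span A. \<forall>v\<in>H. f v = B v t"
  using A f assms(7)
proof (induction A arbitrary: f rule: finite_induct)
  case empty
  have "B v 0 = 0" for v
    using B unfolding sym_bilinear_form_def by (metis add_cancel_right_right)
  then show ?case using empty.prems(4) by (auto simp: span_zero)
next
  case (insert a A)
  have B_add: "B (x + y) z = B x z + B y z" and B_scale: "B (scale c x) z = c * B x z"
    and B_add': "B z (x + y) = B z x + B z y" and B_scale': "B z (scale c x) = c * B z x"
    for x y z c
    using B unfolding sym_bilinear_form_def by metis+
  show ?case
  proof (cases "\<forall>v\<in>H. (\<forall>a'\<in>A. B v a' = 0) \<longrightarrow> B v a = 0")
    case True
    then have "\<exists>t\<in>span A. \<forall>v\<in>H. f v = B v t"
    proof (intro insert.IH)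
      show "f v = 0" if "v \<in> H" "\<And>a. a \<in> A \<Longrightarrow> B v a = 0" for v
        using that True by (intro insert.prems(4)) auto
    qed (use insert.prems in auto)
    then show ?thesis using span_mono[of A "insert a A"] by blast
  next
    case False
    then obtain v0 where v0: "v0 \<in> H" "\<And>a'. a' \<in> A \<Longrightarrow> B v0 a' = 0" "B v0 a \<noteq> 0" by blast
    \<comment> \<open>The coefficient of \<open>a\<close> is forced by evaluating at
      \<open>v0\<close>, which pairs to zero with all of \<open>A\<close> but not with
      \<open>a\<close>.\<close>
    let ?c = "f v0 / B v0 a"
    have "\<exists>t\<in>span A. \<forall>v\<in>H. f v - ?c * B v a = B v t"
    proof (rule insert.IH)
      show "A \<subseteq> H" using insert.prems by simp
      show "f (x + y) - ?c * B (x + y) a = f x - ?c * B x a + (f y - ?c * B y a)"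
        if "x \<in> H" "y \<in> H" for x y
        using insert.prems(2)[OF that] by (simp add: B_add algebra_simps add_divide_distrib)
      show "f (scale c x) - ?c * B (scale c x) a = c * (f x - ?c * B x a)" if "x \<in> H" for c x
        using insert.prems(3)[OF that] by (simp add: B_scale algebra_simps)
      fix v assume v: "v \<in> H" "\<And>a'. a' \<in> A \<Longrightarrow> B v a' = 0"
      \<comment> \<open>Correcting \<open>v\<close> by this multiple of \<open>v0\<close> makes it
        orthogonal to \<open>a\<close> as well, so that \<open>f\<close> vanishes on the
        result.\<close>
      let ?q = "- (B v a / B v0 a)"
      have "v + scale ?q v0 \<in> H" using v v0 by (intro subspace_add[OF H] subspace_scale[OF H])
      moreover have "B (v + scale ?q v0) a' = 0" if "a' \<in> insert a A" for a'
        using that v v0 unfolding B_add B_scale by auto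
      ultimately have "f (v + scale ?q v0) = 0" by (rule insert.prems(4))
      moreover have "f (v + scale ?q v0) = f v + ?q * f v0"
        unfolding insert.prems(2)[OF v(1) subspace_scale[OF H v0(1)]] insert.prems(3)[OF v0(1)] ..
      ultimately show "f v - ?c * B v a = 0" by (simp add: algebra_simps)
    qed
    then obtain t where t: "t \<in> span A" "\<And>v. v \<in> H \<Longrightarrow> f v - ?c * B v a = B v t" by blast
    have "t + scale ?c a \<in> span (insert a A)"
      using t(1) span_mono[of A "insert a A"] by (intro span_add span_scale) (auto intro: span_base)
    moreover have "f v = B v (t + scale ?c a)" if "v \<in> H" for v
      using t(2)[OF that] by (simp add: B_add' B_scale' algebra_simps)
    ultimately show ?thesis by blast
  qed
qed

text \<open>Interpreted for \<open>\<G>\<close> and again for \<open>\<L>\<close>, so that the facts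
  on root spaces and representing vectors are proved once.\<close>

locale lie_form =
  fixes s :: "'f::field \<Rightarrow> 'l::ab_group_add \<Rightarrow> 'l"
    and b :: "'l \<Rightarrow> 'l \<Rightarrow> 'l" and B :: "'l \<Rightarrow> 'l \<Rightarrow> 'f"
  assumes lie: "is_lie_algebra s b" and sbf: "sym_bilinear_form s B" and inv: "invariant_form b B"
begin

sublocale vector_space s
  using lie by (simp add: is_lie_algebra_def)

lemma b_add_left: "b (x + y) z = b x z + b y z"
  and b_add_right: "b x (y + z) = b x y + b x z"
  and b_scale_left: "b (s c x) y = s c (b x y)"
  and b_scale_right: "b x (s c y) = s c (b x y)"
  and b_self: "b x x = 0"
  using lie unfolding is_lie_algebra_def bilinear_map_def by blast+

lemma b_zero_right [simp]: "b x 0 = 0"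
  using b_add_right[of x 0 0] by simp

lemma b_zero_left [simp]: "b 0 x = 0"
  using b_add_left[of 0 0 x] by simp

lemma b_minus_right: "b x (- y) = - b x y"
  using b_add_right[of x y "- y"] by (simp add: eq_neg_iff_add_eq_0 add.commute)

lemma b_minus_left: "b (- x) y = - b x y"
  using b_add_left[of x "- x" y] by (simp add: eq_neg_iff_add_eq_0 add.commute)

lemma b_anti: "b x y = - b y x"
proof -
  have "0 = b (x + y) (x + y)" by (simp only: b_self)
  also have "\<dots> = b x y + b y x" unfolding b_add_left b_add_right by (simp add: b_self)
  finally show ?thesis by (metis eq_neg_iff_add_eq_0)
qed

lemma b_derivation: "b x (b y z) = b (b x y) z + b y (b x z)"
proof -
  have "b x (b y z) + b y (b z x) + b z (b x y) = 0"
    using lie by (simp add: is_lie_algebra_def)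
  moreover have "b y (b z x) = - b y (b x z)" using b_anti[of z x] by (simp add: b_minus_right)
  moreover have "b z (b x y) = - b (b x y) z" by (rule b_anti)
  ultimately show ?thesis by (simp add: algebra_simps)
qed

lemma b_sum_right: "b x (\<Sum>i\<in>I. f i) = (\<Sum>i\<in>I. b x (f i))"
  by (induction I rule: infinite_finite_induct) (simp_all add: b_add_right)

lemma B_sym: "B x y = B y x"
  and B_add_left: "B (x + y) z = B x z + B y z"
  and B_scale_left: "B (s c x) y = c * B x y"
  using sbf unfolding sym_bilinear_form_def by blast+

lemma B_add_right: "B z (x + y) = B z x + B z y"
  using B_add_left[of x y z] by (simp add: B_sym[of z])

lemma B_scale_right: "B y (s c x) = c * B y x"
  using B_scale_left[of c x y] by (simp add: B_sym[of y])

lemma B_zero_left [simp]: "B 0 x = 0"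
  using B_scale_left[of 0 0 x] by simp

lemma B_zero_right [simp]: "B x 0 = 0"
  by (simp add: B_sym[of x])

lemma B_minus_left: "B (- x) y = - B x y"
  using B_add_left[of x "- x" y] by (simp add: eq_neg_iff_add_eq_0 add.commute)

lemma B_minus_right: "B y (- x) = - B y x"
  by (simp add: B_sym[of y] B_minus_left)

lemma B_diff_left: "B (x - y) z = B x z - B y z"
  using B_add_left[of x "- y" z] by (simp add: B_minus_left)

lemma B_diff_right: "B z (x - y) = B z x - B z y"
  using B_add_right[of z x "- y"] by (simp add: B_minus_right)

lemma B_sum_left: "B (\<Sum>i\<in>I. f i) x = (\<Sum>i\<in>I. B (f i) x)"
  by (induction I rule: infinite_finite_induct) (simp_all add: B_add_left)

lemma B_inv: "B (b x y) z = B x (b y z)"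
  using inv by (simp add: invariant_form_def)

lemma subspace_root_space: "subspace (root_space s b H \<alpha>)"
  unfolding root_space_def
  by (rule subspaceI) (auto simp: b_add_right b_scale_right scale_right_distrib scale_left_commute)

lemma root_space_bracket:
  assumes "x \<in> root_space s b H \<alpha>" "y \<in> root_space s b H \<beta>"
  shows "b x y \<in> root_space s b H (\<lambda>v. \<alpha> v + \<beta> v)"
  using assms unfolding root_space_def
  by (auto simp: b_derivation[of _ x y] b_scale_left b_scale_right scale_left_distrib)

text \<open>The difference of two candidates lies in the radical of the form on \<open>H\<close>;
  this settles the definite description in \<open>tvec\<close>.\<close>

lemma tvec_eqI:
  assumes "nondeg_on B H" "subspace H" "t \<in> H" "\<And>v. v \<in> H \<Longrightarrow> B t v = \<alpha> v"
  shows "tvec B H \<alpha> = t"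
  unfolding tvec_def
proof (rule the_equality)
  show "t \<in> H \<and> (\<forall>v\<in>H. B t v = \<alpha> v)" using assms by blast
  fix t' assume t': "t' \<in> H \<and> (\<forall>v\<in>H. B t' v = \<alpha> v)"
  then have "t' - t \<in> H" using assms by (simp add: subspace_diff)
  moreover have "\<forall>v\<in>H. B (t' - t) v = 0" using assms t' by (simp add: B_diff_left)
  ultimately show "t' = t" using assms(1) unfolding nondeg_on_def by force
qed

text \<open>Since \<open>A\<close> spans \<open>H\<close>, a vector of \<open>H\<close> orthogonal
  to \<open>A\<close> is orthogonal to \<open>H\<close> and hence zero. Every functional therefore
  vanishes on the common kernel of the pairings with \<open>A\<close> and is represented by a vector
  of \<open>H\<close>.\<close>

lemma
  assumes "nondeg_on B H" "subspace H" "fin_dim s H" "\<alpha> \<in> dual_of s H"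
  shows tvec_in: "tvec B H \<alpha> \<in> H"
    and B_tvec: "\<And>v. v \<in> H \<Longrightarrow> B (tvec B H \<alpha>) v = \<alpha> v"
proof -
  obtain A where A: "finite A" "A \<subseteq> H" "span A = H"
    using assms(3) by (auto simp: fin_dim_def)
  have "\<exists>t\<in>span A. \<forall>v\<in>H. \<alpha> v = B v t"
  proof (rule functional_vanishing_on_perp[OF sbf assms(2) A(1,2)])
    show "\<alpha> (x + y) = \<alpha> x + \<alpha> y" if "x \<in> H" "y \<in> H" for x y
      using that assms(4) by (simp add: dual_of_def)
    show "\<alpha> (s c x) = c * \<alpha> x" if "x \<in> H" for x c
      using that assms(4) by (simp add: dual_of_def)
    fix v assume v: "v \<in> H" "\<And>a. a \<in> A \<Longrightarrow> B v a = 0"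
    have "span A \<subseteq> {y. B v y = 0}"
      using v(2) by (intro span_minimal subspaceI) (auto simp: B_add_right B_scale_right)
    then have "v = 0" using v(1) A(3) assms(1) unfolding nondeg_on_def by blast
    then show "\<alpha> v = 0" using \<open>\<And>c x. x \<in> H \<Longrightarrow> \<alpha> (s c x) = c * \<alpha> x\<close>[OF v(1), of 0] by simp
  qed
  then obtain t where t: "t \<in> H" "\<And>v. v \<in> H \<Longrightarrow> \<alpha> v = B v t" using A(3) by blast
  have "tvec B H \<alpha> = t" using assms t by (intro tvec_eqI) (auto simp: B_sym)
  then show "tvec B H \<alpha> \<in> H" "\<And>v. v \<in> H \<Longrightarrow> B (tvec B H \<alpha>) v = \<alpha> v"
    using t by (auto simp: B_sym)
qed

end

subsection \<open>The class D\<close>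

locale class_D_triple =
  fixes s :: "'f::field_char_0 \<Rightarrow> 'g::ab_group_add \<Rightarrow> 'g"
    and b :: "'g \<Rightarrow> 'g \<Rightarrow> 'g" and B :: "'g \<Rightarrow> 'g \<Rightarrow> 'f" and h :: "'g set"
    and gr :: "('n::finite \<Rightarrow> int) \<Rightarrow> 'g set"
  assumes inD: "class_D s b B h gr"
begin

abbreviation "R \<equiv> roots s b h"
abbreviation "G \<equiv> root_space s b h"
abbreviation "T \<equiv> tvec B h"

lemma
  shows D_lie: "is_lie_algebra s b" and D_sbf: "sym_bilinear_form s B"
    and D_nondeg: "nondeg_on B UNIV" and D_inv: "invariant_form b B"
    and D_fin: "fin_dim s h" and D_toral: "toral s b h" and D_nondeg_h: "nondeg_on B h"
    and D_irred: "irred_finite_root_system (rform B h) R"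
    and D_gr_subspace: "\<forall>\<sigma>. module.subspace s (gr \<sigma>)"
    and D_gr_sum: "\<forall>x. \<exists>F xs. finite F \<and> (\<forall>\<sigma>\<in>F. xs \<sigma> \<in> gr \<sigma>) \<and> x = (\<Sum>\<sigma>\<in>F. xs \<sigma>)"
    and D_gr_direct: "\<forall>F xs. finite F \<and> (\<forall>\<sigma>\<in>F. xs \<sigma> \<in> gr \<sigma>) \<and> (\<Sum>\<sigma>\<in>F. xs \<sigma>) = 0 \<longrightarrow>
      (\<forall>\<sigma>\<in>F. xs \<sigma> = 0)"
    and D_gr_bracket: "\<forall>\<sigma> \<tau>. \<forall>x\<in>gr \<sigma>. \<forall>y\<in>gr \<tau>. b x y \<in> gr (\<lambda>i. \<sigma> i + \<tau> i)"
    and D_root_graded: "\<forall>\<alpha>\<in>R. \<forall>x\<in>G \<alpha>. \<exists>F xs. finite F \<and> (\<forall>\<sigma>\<in>F. xs \<sigma> \<in> gr \<sigma> \<inter> G \<alpha>) \<and>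
      x = (\<Sum>\<sigma>\<in>F. xs \<sigma>)"
    and D_h: "h \<subseteq> gr (\<lambda>i. 0) \<inter> G (\<lambda>v. 0)"
    and D_G0: "G (\<lambda>v. 0) = module.span s {b x y | x y \<alpha>. \<alpha> \<in> R - {\<lambda>v. 0} \<and> x \<in> G \<alpha> \<and> y \<in> G (\<lambda>v. - \<alpha> v)}"
    and D_rank: "\<forall>w::'n \<Rightarrow> int. (\<forall>\<sigma>\<in>{\<sigma>. gr \<sigma> \<noteq> {0}}. (\<Sum>i\<in>UNIV. w i * \<sigma> i) = 0) \<longrightarrow> w = (\<lambda>i. 0)"
    and D_gr_orth: "\<forall>\<sigma>\<in>{\<sigma>. gr \<sigma> \<noteq> {0}}. \<forall>\<tau>\<in>{\<sigma>. gr \<sigma> \<noteq> {0}}. (\<lambda>i. \<sigma> i + \<tau> i) \<noteq> (\<lambda>i. 0) \<longrightarrow>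
      (\<forall>x\<in>gr \<sigma>. \<forall>y\<in>gr \<tau>. B x y = 0)"
    and D_red: "\<forall>\<alpha>\<in>({\<lambda>v. 0} \<union> {\<alpha>\<in>R. (\<lambda>v. \<alpha> v / 2) \<notin> R}) - {\<lambda>v. 0}. gr (\<lambda>i. 0) \<inter> G \<alpha> \<noteq> {0}"
    and D_div: "\<forall>\<alpha>\<in>R - {\<lambda>v. 0}. \<forall>\<sigma>. \<forall>x\<in>gr \<sigma> \<inter> G \<alpha>. x \<noteq> 0 \<longrightarrow>
        (\<exists>y\<in>gr (\<lambda>i. - \<sigma> i) \<inter> G (\<lambda>v. - \<alpha> v). b x y = T \<alpha>)"
    and D_iso: "\<forall>\<sigma>. gr \<sigma> \<inter> G (\<lambda>v. 0) \<noteq> {0} \<longrightarrow>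
        (\<exists>x\<in>gr \<sigma> \<inter> G (\<lambda>v. 0). \<exists>y\<in>gr (\<lambda>i. - \<sigma> i) \<inter> G (\<lambda>v. 0). b x y = 0 \<and> B x y = 1)"
  using inD[unfolded class_D_def Let_def] by - (elim conjE, assumption)+

sublocale lie_form s b B
  using D_lie D_sbf D_inv by unfold_locales

lemma R_dual: "\<alpha> \<in> R \<Longrightarrow> \<alpha> \<in> dual_of s h"
  by (simp add: roots_def)

lemma subspace_h: "subspace h"
  using D_toral by (simp add: toral_def subalgebra_def)

lemma subspace_gr: "subspace (gr \<sigma>)"
  using D_gr_subspace by blast

lemma T_in: "\<alpha> \<in> dual_of s h \<Longrightarrow> T \<alpha> \<in> h"
  by (rule tvec_in[OF D_nondeg_h subspace_h D_fin])

lemma B_T: "\<alpha> \<in> dual_of s h \<Longrightarrow> v \<in> h \<Longrightarrow> B (T \<alpha>) v = \<alpha> v"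
  by (rule B_tvec[OF D_nondeg_h subspace_h D_fin])

lemma T_eqI: "t \<in> h \<Longrightarrow> (\<And>v. v \<in> h \<Longrightarrow> B t v = \<alpha> v) \<Longrightarrow> T \<alpha> = t"
  by (rule tvec_eqI[OF D_nondeg_h subspace_h])

lemma rform_eval: "\<alpha> \<in> dual_of s h \<Longrightarrow> \<beta> \<in> dual_of s h \<Longrightarrow> rform B h \<alpha> \<beta> = \<alpha> (T \<beta>)"
  by (simp add: rform_def B_T T_in)

lemma rform_sym: "rform B h \<alpha> \<beta> = rform B h \<beta> \<alpha>"
  by (simp add: rform_def B_sym)

lemma zero_R: "(\<lambda>v. 0) \<in> R" and finite_R: "finite R"
  using D_irred by (simp_all add: irred_finite_root_system_def)

text \<open>Anisotropy on the rational span: it identifies the isotropic roots of the extension as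
  those lying over weight zero, and later the radical as the kernel of restriction to
  \<open>h\<close>.\<close>

lemma rform_rat_span_nz:
  assumes "\<alpha> \<in> rat_span_fun R" "\<alpha> \<noteq> (\<lambda>v. 0)"
  shows "rform B h \<alpha> \<alpha> \<noteq> 0"
proof -
  have "\<forall>x\<in>rat_span_fun R. x \<noteq> (\<lambda>v. 0) \<longrightarrow> (\<exists>q::rat. q > 0 \<and> rform B h x x = of_rat q)"
    using D_irred by (simp add: irred_finite_root_system_def)
  then show ?thesis using assms by fastforce
qed

lemma R_rat_span: "\<alpha> \<in> R \<Longrightarrow> \<alpha> \<in> rat_span_fun R"
  by (simp add: rat_span_fun_eq comb_span_base)

lemma rform_R_nz: "\<alpha> \<in> R \<Longrightarrow> \<alpha> \<noteq> (\<lambda>v. 0) \<Longrightarrow> rform B h \<alpha> \<alpha> \<noteq> 0"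
  by (simp add: rform_rat_span_nz R_rat_span)

lemma T_nz: "\<alpha> \<in> R \<Longrightarrow> \<alpha> \<noteq> (\<lambda>v. 0) \<Longrightarrow> T \<alpha> \<noteq> 0"
  using rform_R_nz[of \<alpha>] by (auto simp: rform_def)

lemma dual_scale: "\<alpha> \<in> dual_of s h \<Longrightarrow> (\<lambda>v. c * \<alpha> v) \<in> dual_of s h"
  by (simp add: dual_of_def algebra_simps)

lemma dual_add: "\<alpha> \<in> dual_of s h \<Longrightarrow> \<beta> \<in> dual_of s h \<Longrightarrow> (\<lambda>v. \<alpha> v + \<beta> v) \<in> dual_of s h"
  by (simp add: dual_of_def algebra_simps)

lemma dual_zero: "(\<lambda>v. 0) \<in> dual_of s h"
  by (simp add: dual_of_def)

lemma dual_minus: "\<alpha> \<in> dual_of s h \<Longrightarrow> (\<lambda>v. - \<alpha> v) \<in> dual_of s h"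
  using dual_scale[of \<alpha> "-1"] by simp

lemma T_scale: "\<alpha> \<in> dual_of s h \<Longrightarrow> T (\<lambda>v. c * \<alpha> v) = s c (T \<alpha>)"
  by (rule T_eqI) (auto simp: T_in B_T B_scale_left intro: subspace_scale[OF subspace_h])

lemma root_spaceD: "x \<in> G \<alpha> \<Longrightarrow> k \<in> h \<Longrightarrow> b k x = s (\<alpha> k) x"
  by (simp add: root_space_def)

lemma zero_in_root_space: "0 \<in> G \<alpha>"
  by (simp add: root_space_def)

lemma zero_in_gr: "0 \<in> gr \<sigma>"
  by (rule subspace_0[OF subspace_gr])

lemma in_RI: "\<alpha> \<in> dual_of s h \<Longrightarrow> x \<in> G \<alpha> \<Longrightarrow> x \<noteq> 0 \<Longrightarrow> \<alpha> \<in> R"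
  by (auto simp: roots_def)

lemma gr_bracket: "x \<in> gr \<sigma> \<Longrightarrow> y \<in> gr \<tau> \<Longrightarrow> b x y \<in> gr (\<lambda>i. \<sigma> i + \<tau> i)"
  using D_gr_bracket by blast

text \<open>Used as an induction rule: a property closed under linear combinations holds everywhere
  once it holds for homogeneous elements. The next three lemmas are the analogues for a single root
  space, for the root decomposition and for the joint decomposition.\<close>

lemma gr_span:
  assumes "subspace S" "\<And>\<sigma>. gr \<sigma> \<subseteq> S"
  shows "x \<in> S"
proof -
  obtain F xs where "\<forall>\<sigma>\<in>F. xs \<sigma> \<in> gr \<sigma>" "x = (\<Sum>\<sigma>\<in>F. xs \<sigma>)" using D_gr_sum by metis
  then show ?thesis using assms by (auto intro!: subspace_sum)
qed

lemma root_space_subset: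
  assumes "subspace S" "\<alpha> \<in> R" "\<And>\<sigma>. gr \<sigma> \<inter> G \<alpha> \<subseteq> S"
  shows "G \<alpha> \<subseteq> S"
proof
  fix x assume "x \<in> G \<alpha>"
  then obtain F xs where "\<forall>\<sigma>\<in>F. xs \<sigma> \<in> gr \<sigma> \<inter> G \<alpha>" "x = (\<Sum>\<sigma>\<in>F. xs \<sigma>)"
    using D_root_graded assms(2) by metis
  then show "x \<in> S" using assms(1,3) by (auto intro!: subspace_sum)
qed

lemma root_space_span:
  assumes S: "subspace S" and "\<And>\<alpha>. \<alpha> \<in> R \<Longrightarrow> G \<alpha> \<subseteq> S"
  shows "x \<in> S"
proof -
  have "(\<Union>\<alpha>\<in>dual_of s h. G \<alpha>) \<subseteq> S"
  proof clarify
    fix \<alpha> x assume "\<alpha> \<in> dual_of s h" "x \<in> G \<alpha>"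
    then show "x \<in> S" using assms(2)[of \<alpha>] subspace_0[OF S] in_RI[of \<alpha> x] by (cases "x = 0") auto
  qed
  from span_minimal[OF this S] show ?thesis using D_toral by (auto simp: toral_def)
qed

lemma homogeneous_span:
  assumes "subspace S" and "\<And>\<alpha> \<sigma>. \<alpha> \<in> R \<Longrightarrow> gr \<sigma> \<inter> G \<alpha> \<subseteq> S"
  shows "x \<in> S"
  using assms by (intro root_space_span root_space_subset) auto

lemma B_gr_orth:
  assumes "x \<in> gr \<sigma>" "y \<in> gr \<tau>" "B x y \<noteq> 0"
  shows "\<tau> = (\<lambda>i. - \<sigma> i)"
proof -
  have "x \<noteq> 0" "y \<noteq> 0" using assms(3) by auto
  then have "(\<lambda>i. \<sigma> i + \<tau> i) = (\<lambda>i. 0)" using D_gr_orth assms by blast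
  then show ?thesis by (auto simp: fun_eq_iff eq_neg_iff_add_eq_0 add.commute)
qed

lemma root_nonvanishing:
  assumes "\<alpha> \<in> dual_of s h" "\<alpha> \<noteq> (\<lambda>v. 0)"
  obtains k where "k \<in> h" "\<alpha> k \<noteq> 0"
  using assms unfolding dual_of_def by blast

text \<open>By invariance a central \<open>x\<close> is orthogonal to every bracket. Weight zero is
  spanned by brackets because of D8, and a vector \<open>y\<close> of nonzero weight \<alpha> is a
  bracket up to a scalar, since \<open>b k y = s (\<alpha> k) y\<close> with
  \<open>\<alpha> k\<close> nonzero for some \<open>k\<close>. Nondegeneracy then gives
  \<open>x = 0\<close>.\<close>

lemma centre_trivial:
  assumes "\<And>y. b x y = 0"
  shows "x = 0"
proof -
  have sub: "subspace {y. B x y = 0}"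
    by (rule subspaceI) (auto simp: B_add_right B_scale_right)
  have br: "B x (b y z) = 0" for y z
    using B_inv[of x y z] assms by simp
  have "y \<in> {y. B x y = 0}" for y
  proof (rule root_space_span[OF sub])
    fix \<alpha> assume \<alpha>: "\<alpha> \<in> R"
    show "G \<alpha> \<subseteq> {y. B x y = 0}"
    proof (cases "\<alpha> = (\<lambda>v. 0)")
      case True
      show ?thesis unfolding True D_G0 by (rule span_minimal[OF _ sub]) (auto simp: br)
    next
      case False
      then obtain k where k: "k \<in> h" "\<alpha> k \<noteq> 0" using root_nonvanishing R_dual \<alpha> by blast
      show ?thesis
      proof clarify
        fix y assume "y \<in> G \<alpha>"
        then have "B x (s (\<alpha> k) y) = 0" using br[of k y] root_spaceD k(1) by metis
        then show "B x y = 0" using k(2) by (simp add: B_scale_right)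
      qed
    qed
  qed
  then show ?thesis using D_nondeg by (auto simp: nondeg_on_def)
qed

section \<open>Homogeneous root vectors and their partners\<close>

lemma homogeneous_root_vector:
  assumes "\<alpha> \<in> R"
  obtains \<sigma> where "gr \<sigma> \<inter> G \<alpha> \<noteq> {0}"
proof (rule ccontr)
  assume "\<not> thesis"
  then have "\<And>\<sigma>. gr \<sigma> \<inter> G \<alpha> \<subseteq> {0}" using that by blast
  then have "G \<alpha> \<subseteq> {0}" using assms by (intro root_space_subset) auto
  then show False using assms zero_in_root_space[of \<alpha>] by (auto simp: roots_def)
qed

text \<open>Pairing \<open>b x y = T \<alpha>\<close> with \<open>T \<alpha>\<close> and moving
  \<open>x\<close> across by invariance multiplies (\<alpha>, \<alpha>) by \<open>B x y\<close>, so
  D12(a) already forces \<open>B x y = 1\<close>. This value makes the central part of the bracket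
  in the extension exactly the degree of \<open>x\<close>.\<close>

lemma root_partner:
  assumes "\<alpha> \<in> R" "\<alpha> \<noteq> (\<lambda>v. 0)" "x \<in> gr \<sigma>" "x \<in> G \<alpha>" "x \<noteq> 0"
  obtains y where "y \<in> gr (\<lambda>i. - \<sigma> i)" "y \<in> G (\<lambda>v. - \<alpha> v)" "b x y = T \<alpha>" "B x y = 1"
proof -
  obtain y where y: "y \<in> gr (\<lambda>i. - \<sigma> i)" "y \<in> G (\<lambda>v. - \<alpha> v)" "b x y = T \<alpha>"
    using D_div assms by blast
  have T: "T \<alpha> \<in> h" using assms by (simp add: T_in R_dual)
  have "\<alpha> (T \<alpha>) = B (T \<alpha>) (T \<alpha>)" using assms by (simp add: B_T R_dual T_in)
  also have "\<dots> = B x (b y (T \<alpha>))" by (simp only: y(3)[symmetric] B_inv)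
  also have "b y (T \<alpha>) = s (\<alpha> (T \<alpha>)) y"
    using root_spaceD[OF y(2) T] b_anti[of y "T \<alpha>"] by simp
  finally have "\<alpha> (T \<alpha>) = \<alpha> (T \<alpha>) * B x y" by (simp add: B_scale_right)
  moreover have "\<alpha> (T \<alpha>) \<noteq> 0" using rform_R_nz assms by (metis rform_eval R_dual)
  ultimately have "B x y = 1" by simp
  then show ?thesis using that y by blast
qed

section \<open>Reduced roots and root strings\<close>

lemma reduced_root_vector:
  assumes "\<alpha> \<in> R" "(\<lambda>v. \<alpha> v / 2) \<notin> R"
  obtains x where "x \<in> gr (\<lambda>i. 0)" "x \<in> G \<alpha>" "x \<noteq> 0"
proof -
  have "\<alpha> \<noteq> (\<lambda>v. 0)" using assms zero_R by auto
  then have "gr (\<lambda>i. 0) \<inter> G \<alpha> \<noteq> {0}" using D_red assms by simp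
  then show ?thesis using that zero_in_gr zero_in_root_space by blast
qed

text \<open>If \<alpha>/2 is a root, then \<alpha>/4 is not, because its Cartan number with respect
  to \<alpha> would be 1/2. Thus \<alpha>/2 is reduced, and D11 applies to it.\<close>

lemma reduced_or_double:
  assumes "\<alpha> \<in> R" "\<alpha> \<noteq> (\<lambda>v. 0)"
  obtains \<beta> where "\<beta> \<in> R" "\<beta> \<noteq> (\<lambda>v. 0)" "(\<lambda>v. \<beta> v / 2) \<notin> R" "\<alpha> = \<beta> \<or> \<alpha> = (\<lambda>v. 2 * \<beta> v)"
proof (cases "(\<lambda>v. \<alpha> v / 2) \<in> R")
  case False
  then show ?thesis using that assms by blast
next
  case True
  let ?\<beta> = "\<lambda>v. \<alpha> v / 2"
  have "(\<lambda>v. ?\<beta> v / 2) \<notin> R"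
  proof
    let ?\<gamma> = "\<lambda>v. ?\<beta> v / 2"
    assume \<gamma>: "?\<gamma> \<in> R"
    let ?r = "rform B h"
    have r1: "?r ?\<gamma> \<alpha> = \<alpha> (T ?\<gamma>)" using rform_eval R_dual \<gamma> assms rform_sym by metis
    have r2: "?r \<alpha> \<alpha> = 4 * \<alpha> (T ?\<gamma>)"
    proof -
      have "T \<alpha> = s 4 (T ?\<gamma>)" using T_scale[OF R_dual[OF \<gamma>], of 4] by simp
      moreover have "\<alpha> (s 4 (T ?\<gamma>)) = 4 * \<alpha> (T ?\<gamma>)"
        using R_dual[OF assms(1)] T_in[OF R_dual[OF \<gamma>]] by (simp add: dual_of_def)
      ultimately show ?thesis using rform_eval[OF R_dual R_dual, OF assms(1) assms(1)] by simp
    qed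
    have "\<forall>\<alpha>\<in>R - {\<lambda>v. 0}. \<forall>\<beta>\<in>R. \<exists>k::int. 2 * ?r \<beta> \<alpha> / ?r \<alpha> \<alpha> = of_int k \<and>
         (\<lambda>v. \<beta> v - of_int k * \<alpha> v) \<in> R"
      using D_irred unfolding irred_finite_root_system_def by - (elim conjE, assumption)
    then obtain k :: int where "2 * ?r ?\<gamma> \<alpha> / ?r \<alpha> \<alpha> = of_int k" using assms \<gamma> by blast
    moreover have "\<alpha> (T ?\<gamma>) \<noteq> 0" using rform_R_nz[OF assms] r2 by simp
    ultimately have "(1::'f) = of_int (2 * k)" using r1 r2 by (simp add: field_simps)
    then have "1 = 2 * k" by (metis of_int_eq_iff of_int_1)
    then show False by presburger
  qed
  moreover have "?\<beta> \<noteq> (\<lambda>v. 0)" using assms(2) by (auto simp: fun_eq_iff)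
  ultimately show ?thesis using that[of ?\<beta>] True by simp
qed

text \<open>In characteristic zero the translates are pairwise distinct, so a finite
  \<open>R\<close> cannot contain all of them. Both the \<open>sl\<^sub>2\<close> argument and local
  nilpotency use the finiteness of \<open>R\<close> in this form.\<close>

lemma root_line_leaves:
  assumes "\<alpha> \<noteq> (\<lambda>v. 0)"
  obtains n where "(\<lambda>v. \<beta> v + of_nat n * \<alpha> v) \<notin> R"
proof (rule ccontr)
  let ?f = "\<lambda>n v. \<beta> v + of_nat n * \<alpha> v"
  assume "\<not> thesis"
  then have "range ?f \<subseteq> R" using that by blast
  then have "finite (range ?f)" by (rule finite_subset) (rule finite_R)
  moreover have "inj ?f"
  proof (rule injI)
    fix m n assume e: "?f m = ?f n"
    obtain v where "\<alpha> v \<noteq> 0" using assms by blast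
    then show "m = n" using fun_cong[OF e, of v] by simp
  qed
  ultimately have "finite (UNIV :: nat set)" by (rule finite_imageD)
  then show False by simp
qed

text \<open>If \<open>y\<close> killed \<open>x\<close>, then \<open>x\<close> would be a lowest weight vector of positive weight for the
  \<open>sl\<^sub>2\<close>-triple of \<open>x'\<close> and \<open>y\<close>, so no power of \<open>ad x'\<close> could kill it; but there are only
  finitely many roots.\<close>

lemma lowering_nonzero:
  assumes \<alpha>: "\<alpha> \<in> R" "\<alpha> \<noteq> (\<lambda>v. 0)"
    and x': "x' \<in> G \<alpha>" and y: "b x' y = T \<alpha>"
    and x: "x \<in> G (\<lambda>v. of_nat k * \<alpha> v)" "x \<noteq> 0" and k: "k \<ge> 1"
  shows "b y x \<noteq> 0"
proof
  assume yx: "b y x = 0"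
  define X where "X n = (b x' ^^ n) x" for n
  define \<rho> where "\<rho> = \<alpha> (T \<alpha>)"
  \<comment> \<open>The scalar with \<open>b y (X (Suc n)) = c (Suc n) X n\<close>: moving
    \<open>y\<close> past each factor \<open>x'\<close> contributes minus the eigenvalue of
    \<open>T \<alpha>\<close> on some \<open>X i\<close>, which is \<open>(k + i) * \<rho>\<close>.
    The triple is left unnormalised, so \<rho> stands where the standard triple has 2. For
    \<open>k \<ge> 1\<close> the scalar is nonzero in characteristic zero.\<close>
  define c :: "nat \<Rightarrow> 'f" where "c n = - of_nat (\<Sum>i<n. k + i) * \<rho>" for n
  have \<rho>: "\<rho> \<noteq> 0" unfolding \<rho>_def using rform_R_nz[OF \<alpha>] rform_eval R_dual \<alpha> by metis
  have X_Suc: "X (Suc n) = b x' (X n)" for n by (simp add: X_def)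
  have XG: "X n \<in> G (\<lambda>v. of_nat (k + n) * \<alpha> v)" for n
  proof (induction n)
    case 0
    then show ?case using x by (simp add: X_def)
  next
    case (Suc n)
    have "(\<lambda>v. \<alpha> v + of_nat (k + n) * \<alpha> v) = (\<lambda>v. of_nat (k + Suc n) * \<alpha> v)"
      by (simp add: algebra_simps)
    then show ?case using root_space_bracket[OF x' Suc] by (simp add: X_Suc)
  qed
  have TX: "b (T \<alpha>) (X n) = s (of_nat (k + n) * \<rho>) (X n)" for n
    using root_spaceD[OF XG T_in] R_dual \<alpha> by (simp add: \<rho>_def)
  have yx': "b y x' = - T \<alpha>" using b_anti[of y x'] y by simp
  have step: "b y (X (Suc n)) = - s (of_nat (k + n) * \<rho>) (X n) + b x' (b y (X n))" for n
    unfolding X_Suc b_derivation[of y x'] yx' by (simp only: b_minus_left TX)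
  have low: "b y (X (Suc n)) = s (c (Suc n)) (X n)" for n
  proof (induction n)
    case 0
    have "b y (X 0) = 0" using yx by (simp add: X_def)
    then show ?case using step[of 0] by (simp add: c_def)
  next
    case (Suc n)
    have "b y (X (Suc (Suc n))) = s (- (of_nat (k + Suc n) * \<rho>) + c (Suc n)) (X (Suc n))"
      unfolding step[of "Suc n"] Suc
      by (simp only: b_scale_right X_Suc scale_left_distrib scale_minus_left)
    also have "- (of_nat (k + Suc n) * \<rho>) + c (Suc n) = c (Suc (Suc n))"
      by (simp add: c_def algebra_simps)
    finally show ?case .
  qed
  have "X n \<noteq> 0" for n
  proof (induction n)
    case 0
    then show ?case using x by (simp add: X_def)
  next
    case (Suc n)
    have "(\<Sum>i<Suc n. k + i) \<noteq> 0" using k by (auto simp: lessThan_Suc)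
    then have "c (Suc n) \<noteq> 0" using \<rho> unfolding c_def by (simp only: mult_eq_0_iff neg_equal_0_iff_equal of_nat_eq_0_iff simp_thms not_False_eq_True)
    then show ?case using low[of n] Suc by auto
  qed
  then have "(\<lambda>v. of_nat (k + n) * \<alpha> v) \<in> R" for n
    by (rule in_RI[OF dual_scale[OF R_dual[OF \<alpha>(1)]] XG])
  then have "(\<lambda>v. of_nat k * \<alpha> v + of_nat n * \<alpha> v) \<in> R" for n
    by (simp add: distrib_right)
  then show False using root_line_leaves[OF \<alpha>(2)] by metis
qed

section \<open>Weights occurring in a degree of the support\<close>

lemma support_root:
  assumes "gr \<sigma> \<noteq> {0}"
  obtains \<alpha> where "\<alpha> \<in> R" "gr \<sigma> \<inter> G \<alpha> \<noteq> {0}"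
proof -
  obtain x where x: "x \<in> gr \<sigma>" "x \<noteq> 0" using assms zero_in_gr by blast
  \<comment> \<open>D6 splits root spaces into homogeneous parts, not homogeneous parts into root
    spaces. Nondegeneracy therefore supplies a homogeneous root vector \<open>y\<close> pairing with
    \<open>x\<close>; it has degree \<open>- \<sigma>\<close>, and a D12 partner of it (in weight
    zero, one of the pair given by D12(b)) has degree \<sigma> again.\<close>
  have "\<exists>\<alpha>\<in>R. \<exists>\<tau>. \<exists>y\<in>gr \<tau> \<inter> G \<alpha>. B x y \<noteq> 0"
  proof (rule ccontr)
    assume none: "\<not> ?thesis"
    have "y \<in> {y. B x y = 0}" for y
    proof (rule homogeneous_span)
      show "subspace {y. B x y = 0}"
        by (rule subspaceI) (auto simp: B_add_right B_scale_right)
      show "gr \<tau> \<inter> G \<alpha> \<subseteq> {y. B x y = 0}" if "\<alpha> \<in> R" for \<alpha> \<tau> using none that by blast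
    qed
    then show False using D_nondeg x by (auto simp: nondeg_on_def)
  qed
  then obtain \<alpha> \<tau> y where y: "\<alpha> \<in> R" "y \<in> gr \<tau>" "y \<in> G \<alpha>" "B x y \<noteq> 0" by blast
  have y0: "y \<noteq> 0" using y by auto
  have \<tau>: "(\<lambda>i. - \<tau> i) = \<sigma>" using B_gr_orth[OF x(1) y(2,4)] by simp
  show ?thesis
  proof (cases "\<alpha> = (\<lambda>v. 0)")
    case True
    then obtain x' y' where "x' \<in> gr (\<lambda>i. - \<tau> i) \<inter> G (\<lambda>v. 0)" "y' \<in> gr \<tau> \<inter> G (\<lambda>v. 0)" "B y' x' = 1"
      using D_iso[rule_format, of \<tau>] y y0 by blast
    then have "x' \<in> gr \<sigma> \<inter> G (\<lambda>v. 0)" "x' \<noteq> 0" using \<tau> by auto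
    then have "gr \<sigma> \<inter> G (\<lambda>v. 0) \<noteq> {0}" by blast
    then show ?thesis using that zero_R by blast
  next
    case False
    then obtain y' where y': "y' \<in> gr (\<lambda>i. - \<tau> i)" "y' \<in> G (\<lambda>v. - \<alpha> v)" "b y y' = T \<alpha>"
      using root_partner y y0 by metis
    then have "y' \<noteq> 0" using T_nz[OF y(1) False] by auto
    moreover have "(\<lambda>v. - \<alpha> v) \<in> R" by (rule in_RI[OF dual_minus[OF R_dual[OF y(1)]] y'(2) calculation])
    ultimately show ?thesis using that y' \<tau> by blast
  qed
qed

lemma support_zero_root:
  assumes "gr \<sigma> \<noteq> {0}"
  shows "gr \<sigma> \<inter> G (\<lambda>v. 0) \<noteq> {0}"
proof -
  obtain \<alpha> where \<alpha>: "\<alpha> \<in> R" "gr \<sigma> \<inter> G \<alpha> \<noteq> {0}" using support_root[OF assms] .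
  obtain x where x: "x \<in> gr \<sigma>" "x \<in> G \<alpha>" "x \<noteq> 0"
    using \<alpha>(2) zero_in_gr[of \<sigma>] zero_in_root_space[of \<alpha>] by blast
  show ?thesis
  proof (cases "\<alpha> = (\<lambda>v. 0)")
    case True
    then show ?thesis using x by blast
  next
    case False
    obtain \<beta> where \<beta>: "\<beta> \<in> R" "\<beta> \<noteq> (\<lambda>v. 0)" "(\<lambda>v. \<beta> v / 2) \<notin> R" "\<alpha> = \<beta> \<or> \<alpha> = (\<lambda>v. 2 * \<beta> v)"
      using reduced_or_double[OF \<alpha>(1) False] by blast
    obtain x' where x': "x' \<in> gr (\<lambda>i. 0)" "x' \<in> G \<beta>" "x' \<noteq> 0"
      using reduced_root_vector[OF \<beta>(1,3)] by blast
    \<comment> \<open>As \<open>x'\<close> has degree zero, so has \<open>y\<close>: lowering by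
      \<open>y\<close> stays inside \<open>gr \<sigma>\<close>.\<close>
    obtain y where y: "y \<in> gr (\<lambda>i. - 0)" "y \<in> G (\<lambda>v. - \<beta> v)" "b x' y = T \<beta>"
      using root_partner[OF \<beta>(1,2) x'] by blast
    have lower: "b y w \<in> gr \<sigma> \<and> b y w \<in> G (\<lambda>v. of_nat k * \<beta> v) \<and> b y w \<noteq> 0"
      if w: "w \<in> gr \<sigma>" "w \<in> G (\<lambda>v. of_nat (Suc k) * \<beta> v)" "w \<noteq> 0" for w k
    proof -
      have "b y w \<in> gr \<sigma>" using gr_bracket[OF y(1) w(1)] by simp
      moreover have "b y w \<in> G (\<lambda>v. of_nat k * \<beta> v)"
        using root_space_bracket[OF y(2) w(2)] by (simp add: algebra_simps)
      ultimately show ?thesis using lowering_nonzero[OF \<beta>(1,2) x'(2) y(3) w(2,3)] by simp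
    qed
    \<comment> \<open>A vector of weight \<open>2\<beta>\<close> is lowered once here, so that both
      cases continue from weight \<beta>.\<close>
    from \<beta>(4) have "\<exists>w. w \<in> gr \<sigma> \<and> w \<in> G (\<lambda>v. of_nat 1 * \<beta> v) \<and> w \<noteq> 0"
    proof
      assume "\<alpha> = \<beta>"
      then show ?thesis using x by auto
    next
      assume "\<alpha> = (\<lambda>v. 2 * \<beta> v)"
      then show ?thesis using lower[of x 1] x by auto
    qed
    then show ?thesis using lower[of _ 0] by auto
  qed
qed

text \<open>Otherwise a nonzero element of \<open>gr \<sigma> \<inter> G 0\<close> would be central.\<close>

lemma isotropic_shift:
  assumes "gr \<sigma> \<inter> G (\<lambda>v. 0) \<noteq> {0}"
  obtains \<alpha> \<tau> where "\<alpha> \<in> R" "\<alpha> \<noteq> (\<lambda>v. 0)" "gr \<tau> \<inter> G \<alpha> \<noteq> {0}" "gr (\<lambda>i. \<sigma> i + \<tau> i) \<inter> G \<alpha> \<noteq> {0}"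
proof (rule ccontr)
  assume no: "\<not> thesis"
  obtain x where x: "x \<in> gr \<sigma>" "x \<in> G (\<lambda>v. 0)" "x \<noteq> 0"
    using assms zero_in_gr zero_in_root_space by blast
  note shift = that
  have sub: "subspace {y. b x y = 0}"
    by (rule subspaceI) (auto simp: b_add_right b_scale_right)
  have nz: "G \<alpha> \<subseteq> {y. b x y = 0}" if \<alpha>: "\<alpha> \<in> R" "\<alpha> \<noteq> (\<lambda>v. 0)" for \<alpha>
  proof (rule root_space_subset[OF sub \<alpha>(1)], rule subsetI)
    fix \<tau> y assume y: "y \<in> gr \<tau> \<inter> G \<alpha>"
    have "b x y \<in> gr (\<lambda>i. \<sigma> i + \<tau> i) \<inter> G \<alpha>"
      using gr_bracket[OF x(1)] root_space_bracket[OF x(2)] y by fastforce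
    then show "y \<in> {y. b x y = 0}"
      using no shift[OF \<alpha>, of \<tau>] y by (cases "y = 0") auto
  qed
  have "y \<in> {y. b x y = 0}" for y
  proof (rule root_space_span[OF sub])
    fix \<alpha> assume \<alpha>: "\<alpha> \<in> R"
    show "G \<alpha> \<subseteq> {y. b x y = 0}"
    proof (cases "\<alpha> = (\<lambda>v. 0)")
      case False
      then show ?thesis using nz \<alpha> by blast
    next
      case True
      show ?thesis unfolding True D_G0
      proof (rule span_minimal[OF _ sub], rule subsetI)
        fix w assume "w \<in> {b x y | x y \<alpha>. \<alpha> \<in> R - {\<lambda>v. 0} \<and> x \<in> G \<alpha> \<and> y \<in> G (\<lambda>v. - \<alpha> v)}"
        then obtain y z \<beta> where w: "w = b y z"
          and \<beta>: "\<beta> \<in> R" "\<beta> \<noteq> (\<lambda>v. 0)" "y \<in> G \<beta>" "z \<in> G (\<lambda>v. - \<beta> v)" by blast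
        have "b x y = 0" using nz[OF \<beta>(1,2)] \<beta>(3) by blast
        moreover have "b x z = 0"
        proof (cases "z = 0")
          case False
          then have "(\<lambda>v. - \<beta> v) \<in> R"
            using in_RI[OF dual_minus[OF R_dual[OF \<beta>(1)]] \<beta>(4)] by simp
          moreover have "(\<lambda>v. - \<beta> v) \<noteq> (\<lambda>v. 0)" using \<beta>(2) by (auto simp: fun_eq_iff)
          ultimately have "G (\<lambda>v. - \<beta> v) \<subseteq> {y. b x y = 0}" by (rule nz)
          then show ?thesis using \<beta>(4) by blast
        qed simp
        \<comment> \<open>The map \<open>b x\<close> is a derivation that kills both factors of the
          bracket \<open>w\<close>.\<close>
        ultimately show "w \<in> {y. b x y = 0}" by (simp add: w b_derivation[of x y z])
      qed
    qed
  qed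
  then have "\<And>y. b x y = 0" by (simp only: mem_Collect_eq)
  then have "x = 0" by (rule centre_trivial)
  then show False using x by simp
qed

text \<open>\<open>T\<close> is homogeneous and every nonzero root is a reduced root or twice one,
  so D11 reduces the claim to roots with a root vector of degree zero. It is applied to subalgebras
  containing the core generators and to the orthogonal complement of a given vector.\<close>

lemma coroot_in_subspace:
  assumes \<alpha>: "\<alpha> \<in> R" "\<alpha> \<noteq> (\<lambda>v. 0)" and S: "subspace S"
    and T: "\<And>\<beta>. \<beta> \<in> R \<Longrightarrow> \<beta> \<noteq> (\<lambda>v. 0) \<Longrightarrow> gr (\<lambda>i. 0) \<inter> G \<beta> \<noteq> {0} \<Longrightarrow> T \<beta> \<in> S"
  shows "T \<alpha> \<in> S"
proof -
  obtain \<beta> where \<beta>: "\<beta> \<in> R" "\<beta> \<noteq> (\<lambda>v. 0)" "(\<lambda>v. \<beta> v / 2) \<notin> R" "\<alpha> = \<beta> \<or> \<alpha> = (\<lambda>v. 2 * \<beta> v)"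
    using reduced_or_double[OF \<alpha>] by blast
  have "T \<beta> \<in> S" using T[OF \<beta>(1,2)] reduced_root_vector[OF \<beta>(1,3)] by blast
  then show ?thesis using \<beta>(4) T_scale[OF R_dual[OF \<beta>(1)], of 2] subspace_scale[OF S] by auto
qed

section \<open>Lattices and subspaces containing the support\<close>

lemma support_lattice:
  fixes \<Lambda> :: "('n \<Rightarrow> int) set"
  assumes "\<And>\<sigma>. gr \<sigma> \<noteq> {0} \<Longrightarrow> \<sigma> \<in> \<Lambda>" and "0 \<in> \<Lambda>"
    and "\<And>x y. x \<in> \<Lambda> \<Longrightarrow> y \<in> \<Lambda> \<Longrightarrow> x + y \<in> \<Lambda>"
    and "\<And>k x. x \<in> \<Lambda> \<Longrightarrow> (\<lambda>j. k * x j) \<in> \<Lambda>"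
  shows "(\<exists>N>0. \<forall>i. (\<lambda>j. if j = i then N else 0) \<in> \<Lambda>) \<and>
    (\<exists>e. (\<forall>t<card (UNIV :: 'n set). e t \<in> \<Lambda>) \<and>
       (\<forall>x\<in>\<Lambda>. \<exists>k. x = (\<lambda>j. \<Sum>t<card (UNIV :: 'n set). k t * e t j)) \<and>
       (\<forall>k. (\<forall>j. (\<Sum>t<card (UNIV :: 'n set). k t * e t j) = 0) \<longrightarrow>
          (\<forall>t<card (UNIV :: 'n set). k t = 0)))"
proof -
  \<comment> \<open>D9 states that only the zero vector is orthogonal to the support, which is the
    orthogonality hypothesis of \<open>full_lattice_basis\<close> for every lattice containing the
    support.\<close>
  have orth: "w i = 0" if "\<And>x. x \<in> \<Lambda> \<Longrightarrow> (\<Sum>i\<in>UNIV. w i * x i) = 0" for w i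
  proof -
    have "w = (\<lambda>i. 0)" using D_rank that assms(1) by simp
    then show ?thesis by simp
  qed
  show ?thesis
    using full_lattice_basis[of UNIV \<Lambda>, OF finite assms(2-4)] orth by simp
qed

text \<open>The integer vectors lying in \<open>V\<close> form a lattice containing a positive
  multiple of every unit vector. Characteristic zero allows division by that multiple.\<close>

lemma support_spans:
  fixes V :: "('n \<Rightarrow> 'f) set"
  assumes supp: "\<And>\<sigma>. gr \<sigma> \<noteq> {0} \<Longrightarrow> (\<lambda>i. of_int (\<sigma> i)) \<in> V" and zero: "(\<lambda>i. 0) \<in> V"
    and add: "\<And>x y. x \<in> V \<Longrightarrow> y \<in> V \<Longrightarrow> (\<lambda>i. x i + y i) \<in> V"
    and scl: "\<And>k x. x \<in> V \<Longrightarrow> (\<lambda>i. k * x i) \<in> V"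
  shows "c \<in> V"
proof -
  let ?\<Lambda> = "{\<sigma>. (\<lambda>i. of_int (\<sigma> i)) \<in> V}"
  obtain N :: int where N: "N > 0" "\<And>i. (\<lambda>j. if j = i then N else 0) \<in> ?\<Lambda>"
  proof -
    have "x + y \<in> ?\<Lambda>" if "x \<in> ?\<Lambda>" "y \<in> ?\<Lambda>" for x y
      using add that by simp
    moreover have "(\<lambda>j. k * x j) \<in> ?\<Lambda>" if "x \<in> ?\<Lambda>" for k x
      using scl[of _ "of_int k"] that by simp
    ultimately show thesis
      using support_lattice[of ?\<Lambda>] supp zero that by auto
  qed
  have unit: "(\<lambda>j. a * (if j = i then 1 else 0)) \<in> V" for a i
  proof -
    have "(\<lambda>j. (a / of_int N) * of_int (if j = i then N else 0)) \<in> V"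
      using scl N(2) by blast
    moreover have "(\<lambda>j. (a / of_int N) * of_int (if j = i then N else 0)) = (\<lambda>j. a * (if j = i then 1 else 0))"
      using N(1) by auto
    ultimately show ?thesis by simp
  qed
  have "(\<lambda>j. \<Sum>i\<in>I. c i * (if j = i then 1 else 0)) \<in> V" if "finite I" for I
    using that
  proof (induction I rule: finite_induct)
    case empty
    then show ?case using zero by simp
  next
    case (insert i I)
    have "(\<lambda>j. c i * (if j = i then 1 else 0) + (\<Sum>i\<in>I. c i * (if j = i then 1 else 0))) \<in> V"
      by (rule add[OF unit insert.IH])
    then show ?case using insert by simp
  qed
  from this[of UNIV] show ?thesis by (simp add: if_distrib cong: if_cong)
qed

text \<open>The vectors whose pairing with \<open>e\<close> vanishes form a subspace containing the
  support, hence they include every unit vector.\<close>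

lemma support_orth:
  fixes e :: "'n \<Rightarrow> 'f"
  assumes "\<And>\<sigma>. gr \<sigma> \<noteq> {0} \<Longrightarrow> (\<Sum>i\<in>UNIV. e i * of_int (\<sigma> i)) = 0"
  shows "e = (\<lambda>i. 0)"
proof
  fix j
  have "(\<lambda>i. if i = j then 1 else 0) \<in> {c. (\<Sum>i\<in>UNIV. e i * c i) = 0}"
  proof (rule support_spans)
    show "(\<lambda>i. of_int (\<sigma> i)) \<in> {c. (\<Sum>i\<in>UNIV. e i * c i) = 0}" if "gr \<sigma> \<noteq> {0}" for \<sigma>
      using assms[OF that] by simp
    show "(\<lambda>i. x i + y i) \<in> {c. (\<Sum>i\<in>UNIV. e i * c i) = 0}"
      if "x \<in> {c. (\<Sum>i\<in>UNIV. e i * c i) = 0}" "y \<in> {c. (\<Sum>i\<in>UNIV. e i * c i) = 0}" for x y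
      using that by (simp add: distrib_left sum.distrib)
    show "(\<lambda>i. k * x i) \<in> {c. (\<Sum>i\<in>UNIV. e i * c i) = 0}"
      if "x \<in> {c. (\<Sum>i\<in>UNIV. e i * c i) = 0}" for k x
      using that by (simp add: mult.left_commute[of _ k] sum_distrib_left[symmetric])
  qed simp
  then show "e j = 0" by (simp add: if_distrib cong: if_cong)
qed

end

subsection \<open>The extension by centre and degree derivations\<close>

text \<open>Linearity and the values on homogeneous elements determine each \<open>d i\<close>,
  because these elements span. That the \<open>d i\<close> are derivations, skew for the form and
  commuting, is proved below.\<close>

locale class_D_extension = class_D_triple s b B h gr
  for s :: "'f::field_char_0 \<Rightarrow> 'g::ab_group_add \<Rightarrow> 'g"
    and b :: "'g \<Rightarrow> 'g \<Rightarrow> 'g" and B :: "'g \<Rightarrow> 'g \<Rightarrow> 'f" and h :: "'g set"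
    and gr :: "('n::finite \<Rightarrow> int) \<Rightarrow> 'g set" +
  fixes d :: "'n \<Rightarrow> 'g \<Rightarrow> 'g"
  assumes d_add: "\<And>i x y. d i (x + y) = d i x + d i y"
    and d_scale: "\<And>i a x. d i (s a x) = s a (d i x)"
    and d_deg: "\<And>i \<sigma> x. x \<in> gr \<sigma> \<Longrightarrow> d i x = s (of_int (\<sigma> i)) x"
begin

abbreviation sL :: "'f \<Rightarrow> 'g \<times> ('n \<Rightarrow> 'f) \<times> ('n \<Rightarrow> 'f) \<Rightarrow> 'g \<times> ('n \<Rightarrow> 'f) \<times> ('n \<Rightarrow> 'f)"
  where "sL \<equiv> scaleL s"
abbreviation "bL \<equiv> bracketL s b B d"
abbreviation BL :: "'g \<times> ('n \<Rightarrow> 'f) \<times> ('n \<Rightarrow> 'f) \<Rightarrow> 'g \<times> ('n \<Rightarrow> 'f) \<times> ('n \<Rightarrow> 'f) \<Rightarrow> 'f"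
  where "BL \<equiv> formL B"
abbreviation H :: "('g \<times> ('n \<Rightarrow> 'f) \<times> ('n \<Rightarrow> 'f)) set" where "H \<equiv> HL h"

text \<open>The action on \<open>\<G>\<close> of the element of \<open>D\<close> with coordinates
  \<open>e\<close>.\<close>

definition der :: "('n \<Rightarrow> 'f) \<Rightarrow> 'g \<Rightarrow> 'g" where
  "der e x = (\<Sum>i\<in>UNIV. s (e i) (d i x))"

lemma d_zero [simp]: "d i 0 = 0"
  using d_scale[of i 0 0] by simp

lemma d_sum: "d i (\<Sum>j\<in>J. f j) = (\<Sum>j\<in>J. d i (f j))"
  by (induction J rule: infinite_finite_induct) (simp_all add: d_add)

lemma d_h: "k \<in> h \<Longrightarrow> d i k = 0"
  using D_h d_deg[of k "\<lambda>i. 0" i] by auto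

text \<open>The grading is direct, so every component of a joint eigenvector is an eigenvector for
  the same scalars, and distinct integer degrees stay distinct in characteristic zero. Hence only
  one component survives and the eigenvalues are integers; this is why roots of the extension carry
  integer degrees.\<close>

lemma homogeneous_unique:
  assumes y: "y \<noteq> 0"
    and dy: "\<And>i. d i y = s (m i) y"
  obtains \<sigma> where "y \<in> gr \<sigma>" "m = (\<lambda>i. of_int (\<sigma> i))"
proof -
  obtain F xs where F: "finite F" "\<forall>\<sigma>\<in>F. xs \<sigma> \<in> gr \<sigma>" "y = (\<Sum>\<sigma>\<in>F. xs \<sigma>)"
    using D_gr_sum by metis
  have eig: "s (of_int (\<sigma> i) - m i) (xs \<sigma>) = 0" if "\<sigma> \<in> F" for i \<sigma>
  proof -
    have "d i (\<Sum>\<sigma>\<in>F. xs \<sigma>) = (\<Sum>\<sigma>\<in>F. s (of_int (\<sigma> i)) (xs \<sigma>))"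
      unfolding d_sum using F(2) by (intro sum.cong) (auto simp: d_deg)
    then have "(\<Sum>\<sigma>\<in>F. s (of_int (\<sigma> i) - m i) (xs \<sigma>)) = 0"
      using dy[of i] F(3) by (simp add: scale_left_diff_distrib sum_subtractf scale_sum_right)
    moreover have "\<forall>\<sigma>\<in>F. s (of_int (\<sigma> i) - m i) (xs \<sigma>) \<in> gr \<sigma>"
      using F(2) by (simp add: subspace_scale[OF subspace_gr])
    ultimately show ?thesis
      using D_gr_direct[rule_format, of F "\<lambda>\<sigma>. s (of_int (\<sigma> i) - m i) (xs \<sigma>)"] F(1) that by blast
  qed
  obtain \<sigma> where \<sigma>: "\<sigma> \<in> F" "xs \<sigma> \<noteq> 0"
    using y F(3) by (metis sum.not_neutral_contains_not_neutral)
  have m: "m = (\<lambda>i. of_int (\<sigma> i))" using eig[OF \<sigma>(1)] \<sigma>(2) by (simp add: fun_eq_iff)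
  have "xs \<tau> = 0" if "\<tau> \<in> F - {\<sigma>}" for \<tau>
  proof -
    obtain i where "\<tau> i \<noteq> \<sigma> i" using \<open>\<tau> \<in> F - {\<sigma>}\<close> by (auto simp: fun_eq_iff)
    then show ?thesis using eig[of \<tau> i] that m by auto
  qed
  then have "y = xs \<sigma>" using F(1,3) \<sigma> by (simp add: sum.remove)
  then show ?thesis using that m F(2) \<sigma> by blast
qed

lemma der_deg: "x \<in> gr \<sigma> \<Longrightarrow> der e x = s (\<Sum>i\<in>UNIV. e i * of_int (\<sigma> i)) x"
  by (simp add: der_def d_deg scale_sum_left)

lemma der_add: "der e (x + y) = der e x + der e y"
  by (simp add: der_def d_add scale_right_distrib sum.distrib)

lemma der_scale: "der e (s a x) = s a (der e x)"
  by (simp add: der_def d_scale scale_sum_right mult.commute)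

lemma der_add_coeff: "der (\<lambda>i. e i + e' i) x = der e x + der e' x"
  by (simp add: der_def scale_left_distrib sum.distrib)

lemma der_scale_coeff: "der (\<lambda>i. a * e i) x = s a (der e x)"
  by (simp add: der_def scale_sum_right)

lemma der_zero_coeff [simp]: "der (\<lambda>i. 0) x = 0"
  by (simp add: der_def)

lemma der_zero [simp]: "der e 0 = 0"
  by (simp add: der_def)

lemma der_h: "k \<in> h \<Longrightarrow> der e k = 0"
  by (simp add: der_def d_h)

lemma der_minus: "der e (- x) = - der e x"
  using der_scale[of e "-1" x] by simp

lemma der_diff: "der e (x - y) = der e x - der e y"
  using der_add[of e x "- y"] by (simp add: der_minus)

lemma der_unit: "der (\<lambda>j. if j = i then 1 else 0) x = d i x"
proof -
  have "der (\<lambda>j. if j = i then 1 else 0) x = (\<Sum>j\<in>UNIV. if j = i then d j x else 0)"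
    unfolding der_def by (intro sum.cong) auto
  then show ?thesis by simp
qed

section \<open>The degree maps as commuting skew derivations\<close>

lemma d_bracket: "d i (b x y) = b (d i x) y + b x (d i y)"
proof -
  have hom: "d i (b x y) = b (d i x) y + b x (d i y)" if "x \<in> gr \<sigma>" "y \<in> gr \<tau>" for x y \<sigma> \<tau>
    using that by (simp add: d_deg d_deg[OF gr_bracket] b_scale_left b_scale_right scale_left_distrib)
  have right: "y \<in> {y. d i (b x y) = b (d i x) y + b x (d i y)}" if "x \<in> gr \<sigma>" for x y \<sigma>
  proof (rule gr_span)
    show "subspace {y. d i (b x y) = b (d i x) y + b x (d i y)}"
      by (rule subspaceI)
        (auto simp: d_add d_scale b_add_right b_scale_right scale_right_distrib)
  qed (use hom that in auto)
  have "x \<in> {x. d i (b x y) = b (d i x) y + b x (d i y)}"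
  proof (rule gr_span)
    show "subspace {x. d i (b x y) = b (d i x) y + b x (d i y)}"
      by (rule subspaceI)
        (auto simp: d_add d_scale b_add_left b_scale_left scale_right_distrib)
  qed (use right in auto)
  then show ?thesis by simp
qed

text \<open>On homogeneous elements either the pairing vanishes or the degrees are opposite.
  Skewness makes \<open>B (d i x) y\<close> alternating, and it enters the cocycle identity and the
  invariance of the extended form.\<close>

lemma d_skew: "B (d i x) y = - B x (d i y)"
proof -
  have hom: "B (d i x) y = - B x (d i y)" if "x \<in> gr \<sigma>" "y \<in> gr \<tau>" for x y \<sigma> \<tau>
  proof (cases "B x y = 0")
    case True
    then show ?thesis using that by (simp add: d_deg B_scale_left B_scale_right)
  next
    case False
    then show ?thesis using that B_gr_orth[OF that]
      by (simp add: d_deg B_scale_left B_scale_right B_minus_right)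
  qed
  have right: "y \<in> {y. B (d i x) y = - B x (d i y)}" if "x \<in> gr \<sigma>" for x y \<sigma>
  proof (rule gr_span)
    show "subspace {y. B (d i x) y = - B x (d i y)}"
      by (rule subspaceI) (auto simp: d_add d_scale B_add_right B_scale_right)
  qed (use hom that in auto)
  have "x \<in> {x. B (d i x) y = - B x (d i y)}"
  proof (rule gr_span)
    show "subspace {x. B (d i x) y = - B x (d i y)}"
      by (rule subspaceI) (auto simp: d_add d_scale B_add_left B_scale_left)
  qed (use right in auto)
  then show ?thesis by simp
qed

lemma d_commute: "d i (d j x) = d j (d i x)"
proof -
  have "x \<in> {x. d i (d j x) = d j (d i x)}"
  proof (rule gr_span)
    show "subspace {x. d i (d j x) = d j (d i x)}"
      by (rule subspaceI) (auto simp: d_add d_scale)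
    show "gr \<sigma> \<subseteq> {x. d i (d j x) = d j (d i x)}" for \<sigma>
      by (auto simp: d_deg d_scale mult.commute)
  qed
  then show ?thesis by simp
qed

lemma der_bracket: "der e (b x y) = b (der e x) y + b x (der e y)"
proof -
  have left: "b (\<Sum>i\<in>I. f i) y = (\<Sum>i\<in>I. b (f i) y)" for f :: "'n \<Rightarrow> 'g" and I
    by (induction I rule: infinite_finite_induct) (simp_all add: b_add_left)
  show ?thesis
    by (simp add: der_def d_bracket left b_sum_right b_scale_left b_scale_right
        scale_right_distrib sum.distrib)
qed

lemma B_der_left: "B (der e x) y = (\<Sum>i\<in>UNIV. e i * B (d i x) y)"
  by (simp add: der_def B_sum_left B_scale_left)

lemma der_skew: "B (der e x) y = - B x (der e y)"
proof -
  have "B (der e x) y = (\<Sum>i\<in>UNIV. - (e i * B (d i y) x))"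
    unfolding B_der_left by (simp add: d_skew[of _ x] B_sym[of x])
  also have "\<dots> = - B (der e y) x" by (simp add: B_der_left sum_negf)
  finally show ?thesis by (simp add: B_sym[of x])
qed

lemma d_der: "d i (der e x) = der e (d i x)"
  by (simp add: der_def d_sum d_scale d_commute[of i])

lemma der_commute: "der e (der e' x) = der e' (der e x)"
proof -
  have "der e (\<Sum>i\<in>I. f i) = (\<Sum>i\<in>I. der e (f i))" for f :: "'n \<Rightarrow> 'g" and I
    by (induction I rule: infinite_finite_induct) (simp_all add: der_add)
  then show ?thesis unfolding der_def[of e'] by (simp add: der_scale d_der)
qed

subsection \<open>Lie algebra and form\<close>

lemma bL_eq: "bL (x, c, e) (y, c', e') =
    (b x y + der e y - der e' x, \<lambda>i. B (d i x) y, \<lambda>i. 0)"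
  by (simp add: bracketL_def der_def)

lemma sL_eq: "sL a (x, c, e) = (s a x, \<lambda>i. a * c i, \<lambda>i. a * e i)"
  by (simp add: scaleL_def)

lemma BL_eq: "BL (x, c, e) (y, c', e') = B x y + (\<Sum>i\<in>UNIV. c i * e' i + e i * c' i)"
  by (simp add: formL_def)

lemma zero_eq: "(0 :: 'g \<times> ('n \<Rightarrow> 'f) \<times> ('n \<Rightarrow> 'f)) = (0, \<lambda>i. 0, \<lambda>i. 0)"
  by (simp add: zero_prod_def zero_fun_def)

lemma in_H: "(x, c, e) \<in> H \<longleftrightarrow> x \<in> h"
  by (simp add: HL_def)

lemma vector_space_L: "vector_space sL"
  by unfold_locales
    (auto simp: sL_eq plus_fun_def scale_right_distrib scale_left_distrib algebra_simps)

text \<open>The component in \<open>\<G>\<close> is the Jacobi identity of the semidirect product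
  with commuting derivations. The component along each \<open>c_i\<close> is the cocycle identity
  for a skew derivation.\<close>

lemma bL_jacobi: "bL X (bL Y Z) + bL Y (bL Z X) + bL Z (bL X Y) = 0"
proof -
  obtain x c e y c' e' z c'' e'' where X: "X = (x, c, e)" "Y = (y, c', e')" "Z = (z, c'', e'')"
    by (metis prod_cases3)
  have G: "b x (b y z + der e' z - der e'' y) + der e (b y z + der e' z - der e'' y)
      + (b y (b z x + der e'' x - der e z) + der e' (b z x + der e'' x - der e z))
      + (b z (b x y + der e y - der e' x) + der e'' (b x y + der e y - der e' x)) = 0"
  proof -
    have "b x (b y z) + b y (b z x) + b z (b x y) = 0"
      using lie by (simp add: is_lie_algebra_def)
    then have J: "b x (b y z) = - b y (b z x) - b z (b x y)"
      by (metis add.assoc add_eq_0_iff minus_add_distrib uminus_add_conv_diff add.commute)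
    have diff: "b u (v - w) = b u v - b u w" for u v w
      using b_add_right[of u v "- w"] by (simp add: b_minus_right)
    show ?thesis
      by (simp add: der_add der_diff der_bracket b_add_right diff J der_commute[of e e']
          der_commute[of e e''] der_commute[of e' e'']
          b_anti[of "der e' z" x] b_anti[of "der e'' x" y] b_anti[of "der e y" z])
  qed
  have C: "B (d i x) (b y z + der e' z - der e'' y) + B (d i y) (b z x + der e'' x - der e z)
      + B (d i z) (b x y + der e y - der e' x) = 0" for i
  proof -
    \<comment> \<open>This symmetry in \<open>u\<close> and \<open>v\<close> cancels in pairs the
      six terms that contain some \<open>der\<close>.\<close>
    have cross: "B (d i u) (der f v) = B (d i v) (der f u)" for u v f
    proof -
      have "B (d i u) (der f v) = - B u (d i (der f v))" by (rule d_skew)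
      also have "\<dots> = B (der f u) (d i v)" by (simp add: d_der der_skew)
      finally show ?thesis by (simp add: B_sym)
    qed
    have "B (d i z) (b x y) = - B z (d i (b x y))" by (rule d_skew)
    also have "\<dots> = - B z (b (d i x) y) - B z (b x (d i y))"
      by (simp add: d_bracket B_add_right)
    also have "B z (b (d i x) y) = B (d i x) (b y z)" by (simp only: B_sym[of z] B_inv)
    also have "B z (b x (d i y)) = B (d i y) (b z x)"
      by (metis B_inv B_sym)
    finally show ?thesis
      by (simp add: B_add_right B_diff_right cross[where u = x and v = z and f = e']
          cross[where u = x and v = y and f = e''] cross[where u = y and v = z and f = e])
  qed
  show ?thesis using G C by (simp add: X bL_eq zero_eq plus_fun_def zero_fun_def)
qed

lemma lie_L: "is_lie_algebra sL bL"
proof -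
  have "bL X X = 0" for X
  proof (cases X)
    case (fields x c e)
    have "B (d i x) x = - B (d i x) x" for i using d_skew[of i x x] B_sym[of x] by simp
    then have "B (d i x) x = 0" for i by (metis add.right_inverse mult_2 mult_eq_0_iff zero_neq_numeral)
    then show ?thesis by (simp add: fields bL_eq b_self zero_eq)
  qed
  moreover have "bilinear_map sL bL"
    unfolding bilinear_map_def
  proof (intro conjI allI)
    fix X Y Z and a :: 'f
    show "bL (X + Y) Z = bL X Z + bL Y Z"
      by (cases X; cases Y; cases Z)
        (simp add: bL_eq plus_fun_def zero_fun_def b_add_left der_add der_add_coeff d_add B_add_left)
    show "bL X (Y + Z) = bL X Y + bL X Z"
      by (cases X; cases Y; cases Z)
        (simp add: bL_eq plus_fun_def zero_fun_def b_add_right der_add der_add_coeff d_add B_add_right)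
    show "bL (sL a X) Y = sL a (bL X Y)"
      by (cases X; cases Y)
        (simp add: bL_eq sL_eq b_scale_left der_scale der_scale_coeff d_scale B_scale_left
          scale_right_distrib scale_right_diff_distrib)
    show "bL X (sL a Y) = sL a (bL X Y)"
      by (cases X; cases Y)
        (simp add: bL_eq sL_eq b_scale_right der_scale der_scale_coeff d_scale B_scale_right
          scale_right_distrib scale_right_diff_distrib)
  qed
  ultimately show ?thesis using vector_space_L bL_jacobi by (simp add: is_lie_algebra_def)
qed

lemma sbf_L: "sym_bilinear_form sL BL"
  unfolding sym_bilinear_form_def
proof (intro conjI allI)
  fix X Y Z and a :: 'f
  show "BL X Y = BL Y X"
    by (cases X; cases Y) (simp add: BL_eq B_sym add.commute mult.commute)
  show "BL (X + Y) Z = BL X Z + BL Y Z"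
    by (cases X; cases Y; cases Z)
      (simp add: BL_eq plus_fun_def B_add_left distrib_right sum.distrib algebra_simps)
  show "BL (sL a X) Y = a * BL X Y"
    by (cases X; cases Y)
      (simp add: BL_eq sL_eq B_scale_left distrib_left sum_distrib_left mult.assoc)
qed

text \<open>Through the pairing of \<open>C\<close> with \<open>D\<close>, the cocycle term of
  \<open>bL X Y\<close> meets the \<open>D\<close>-part of \<open>Z\<close>. By skewness of
  \<open>der\<close> this equals the contribution of that part acting on \<open>Y\<close>.\<close>

lemma inv_L: "invariant_form bL BL"
  unfolding invariant_form_def
proof (intro allI)
  fix X Y Z :: "'g \<times> ('n \<Rightarrow> 'f) \<times> ('n \<Rightarrow> 'f)"
  obtain x c e y c' e' z c'' e'' where X: "X = (x, c, e)" "Y = (y, c', e')" "Z = (z, c'', e'')"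
    by (metis prod_cases3)
  have "BL (bL X Y) Z = B (b x y) z + B (der e y) z - B (der e' x) z + B (der e'' x) y"
    by (simp add: X bL_eq BL_eq B_add_left B_diff_left B_der_left mult.commute)
  also have "\<dots> = B x (b y z) + B x (der e' z) - B x (der e'' y) + B (der e y) z"
    by (simp add: B_inv der_skew[of e' x] der_skew[of e'' x])
  also have "\<dots> = BL X (bL Y Z)"
    by (simp add: X bL_eq BL_eq B_add_right B_diff_right B_der_left)
  finally show "BL (bL X Y) Z = BL X (bL Y Z)" .
qed

sublocale L: lie_form sL bL BL
  using lie_L sbf_L inv_L by unfold_locales

subsection \<open>Roots of the extension\<close>

text \<open>The functional with restriction \<alpha> to \<open>h\<close>, zero on \<open>C\<close>
  and value \<open>m i\<close> on the \<open>i\<close>-th degree derivation; outside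
  \<open>H\<close> it is zero as \<open>dual_of\<close> demands. The coordinates \<open>m\<close>
  range over the field, since rational combinations of roots have this shape too.\<close>

definition lam :: "('g \<Rightarrow> 'f) \<Rightarrow> ('n \<Rightarrow> 'f) \<Rightarrow> 'g \<times> ('n \<Rightarrow> 'f) \<times> ('n \<Rightarrow> 'f) \<Rightarrow> 'f" where
  "lam \<alpha> m = (\<lambda>(x, c, e). if x \<in> h then \<alpha> x + (\<Sum>i\<in>UNIV. m i * e i) else 0)"

abbreviation "lz \<alpha> \<sigma> \<equiv> lam \<alpha> (\<lambda>i. of_int (\<sigma> i))"

lemma lam_eq: "lam \<alpha> m (x, c, e) = (if x \<in> h then \<alpha> x + (\<Sum>i\<in>UNIV. m i * e i) else 0)"
  by (simp add: lam_def)

lemma h_add: "x \<in> h \<Longrightarrow> y \<in> h \<Longrightarrow> x + y \<in> h"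
  by (rule subspace_add[OF subspace_h])

lemma h_scale: "x \<in> h \<Longrightarrow> s a x \<in> h"
  by (rule subspace_scale[OF subspace_h])

lemma h_zero: "0 \<in> h"
  by (rule subspace_0[OF subspace_h])

lemma lam_dual:
  assumes "\<alpha> \<in> dual_of s h"
  shows "lam \<alpha> m \<in> dual_of sL H"
  using assms
  by (auto simp: dual_of_def lam_eq HL_def sL_eq plus_fun_def h_add h_scale algebra_simps
      sum.distrib sum_distrib_left)

lemma lam_zero: "lam (\<lambda>v. 0) (\<lambda>i. 0) = (\<lambda>v. 0)"
  by (auto simp: lam_def)

lemma lam_add: "(\<lambda>v. lam \<alpha> m v + lam \<beta> m' v) = lam (\<lambda>v. \<alpha> v + \<beta> v) (\<lambda>i. m i + m' i)"
  by (auto simp: lam_def fun_eq_iff sum.distrib algebra_simps)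

lemma lam_scale: "(\<lambda>v. a * lam \<alpha> m v) = lam (\<lambda>v. a * \<alpha> v) (\<lambda>i. a * m i)"
  by (auto simp: lam_def fun_eq_iff sum_distrib_left algebra_simps)

lemma lam_minus: "(\<lambda>v. - lam \<alpha> m v) = lam (\<lambda>v. - \<alpha> v) (\<lambda>i. - m i)"
  using lam_scale[of "-1"] by simp

lemma lam_root: "\<alpha> \<in> dual_of s h \<Longrightarrow> (\<lambda>x. if x \<in> h then lam \<alpha> m (x, \<lambda>i. 0, \<lambda>i. 0) else 0) = \<alpha>"
  by (auto simp: lam_eq dual_of_def)

lemma lam_inj:
  assumes "\<alpha> \<in> dual_of s h" "\<beta> \<in> dual_of s h" "lam \<alpha> m = lam \<beta> m'"
  shows "\<alpha> = \<beta>" "m = m'"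
proof -
  show "\<alpha> = \<beta>"
    using lam_root[OF assms(1), of m] lam_root[OF assms(2), of m'] unfolding assms(3) by (rule trans[OF sym])
  have at_zero: "\<gamma> 0 = 0" if "\<gamma> \<in> dual_of s h" for \<gamma>
  proof -
    have "\<gamma> (s 0 0) = 0 * \<gamma> 0" using that h_zero unfolding dual_of_def by blast
    then show ?thesis by simp
  qed
  then have "m j = m' j" for j
    using fun_cong[OF assms(3), of "(0, \<lambda>i. 0, \<lambda>i. if i = j then 1 else 0)"]
    by (simp add: lam_eq h_zero at_zero assms(1,2) if_distrib cong: if_cong)
  then show "m = m'" by blast
qed

lemma lz_inj:
  assumes "\<alpha> \<in> dual_of s h" "\<beta> \<in> dual_of s h" "lz \<alpha> \<sigma> = lz \<beta> \<tau>"
  shows "\<alpha> = \<beta>" "\<sigma> = \<tau>"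
  using lam_inj[OF assms] by (auto simp: fun_eq_iff)

lemma root_space_L_iff:
  "(y, c, e) \<in> root_space sL bL H \<chi> \<longleftrightarrow> (\<forall>k\<in>h. \<forall>c' e'. b k y + der e' y = s (\<chi> (k, c', e')) y \<and>
     (\<forall>i. \<chi> (k, c', e') * c i = 0) \<and> (\<forall>i. \<chi> (k, c', e') * e i = 0))"
  unfolding root_space_def HL_def by (simp add: bL_eq sL_eq d_h der_h fun_eq_iff) metis

lemma root_space_L_I:
  assumes "y \<in> gr \<sigma>" "y \<in> G \<alpha>"
  shows "(y, \<lambda>i. 0, \<lambda>i. 0) \<in> root_space sL bL H (lz \<alpha> \<sigma>)"
  using assms unfolding root_space_L_iff
  by (auto simp: lam_eq der_deg root_spaceD scale_left_distrib mult.commute)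

lemma root_space_L_zero_I:
  assumes "y \<in> gr (\<lambda>i. 0)" "y \<in> G (\<lambda>v. 0)"
  shows "(y, c, e) \<in> root_space sL bL H (\<lambda>v. 0)"
  using assms unfolding root_space_L_iff by (auto simp: der_deg root_spaceD)

text \<open>A bracket with an element of \<open>H\<close> has no component in \<open>C\<close> or
  \<open>D\<close>, so a vector of nonzero weight lies in \<open>\<G>\<close> and is a joint
  eigenvector of \<open>h\<close> and of all \<open>d i\<close>. Its degree then comes from
  \<open>homogeneous_unique\<close>.\<close>

lemma root_space_L_E:
  assumes \<chi>: "\<chi> \<in> dual_of sL H" and X: "X \<in> root_space sL bL H \<chi>" "X \<noteq> 0"
  obtains \<alpha> \<sigma> where "\<alpha> \<in> R" "\<chi> = lz \<alpha> \<sigma>" "fst X \<in> gr \<sigma>" "fst X \<in> G \<alpha>" "gr \<sigma> \<inter> G \<alpha> \<noteq> {0}"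
    "\<chi> \<noteq> (\<lambda>v. 0) \<Longrightarrow> X = (fst X, \<lambda>i. 0, \<lambda>i. 0)"
proof -
  obtain y c e where Xe: "X = (y, c, e)" by (cases X) auto
  have A: "b k y + der e' y = s (\<chi> (k, c', e')) y" "\<chi> (k, c', e') * c i = 0" "\<chi> (k, c', e') * e i = 0"
    if "k \<in> h" for k c' e' i
    using X(1) that unfolding Xe root_space_L_iff by blast+
  have dy0: "d i y = s (\<chi> (0, \<lambda>i. 0, \<lambda>j. if j = i then 1 else 0)) y" for i
    using A(1)[OF h_zero, of "\<lambda>j. if j = i then 1 else 0" "\<lambda>i. 0"] by (simp add: der_unit)
  show ?thesis
  proof (cases "\<chi> = (\<lambda>v. 0)")
    case True
    have "b k y = 0" if "k \<in> h" for k using A(1)[OF that, of "\<lambda>i. 0" "\<lambda>i. 0"] True by simp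
    then have yG: "y \<in> G (\<lambda>v. 0)" by (simp add: root_space_def)
    have dy: "d i y = s ((\<lambda>i. 0) i) y" for i using dy0 True by simp
    have yg: "y \<in> gr (\<lambda>i. 0)"
    proof (cases "y = 0")
      case False
      obtain \<sigma> where "y \<in> gr \<sigma>" "(\<lambda>i. 0 :: 'f) = (\<lambda>i. of_int (\<sigma> i))"
        using homogeneous_unique[OF False dy] by blast
      moreover from this have "\<sigma> = (\<lambda>i. 0)" by (simp add: fun_eq_iff)
      ultimately show ?thesis by simp
    qed (simp add: zero_in_gr)
    \<comment> \<open>\<open>X\<close> may lie in \<open>C \<oplus> D\<close>, with \<open>y\<close>
      zero; a nonzero vector of weight and degree zero is then found in \<open>h\<close>.\<close>
    have "h \<noteq> {0}"
      using D_toral by (simp add: toral_def)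
    then have "gr (\<lambda>i. 0) \<inter> G (\<lambda>v. 0) \<noteq> {0}" using D_h h_zero by blast
    then show ?thesis
      using that[of "\<lambda>v. 0" "\<lambda>i. 0"] zero_R yG yg True by (simp add: lam_zero Xe)
  next
    case False
    then obtain k0 c0 e0 where k0: "\<chi> (k0, c0, e0) \<noteq> 0" by (metis prod_cases3)
    then have "k0 \<in> h" using \<chi> by (auto simp: dual_of_def HL_def)
    then have "c i = 0" "e i = 0" for i using A(2,3)[OF \<open>k0 \<in> h\<close>, of c0 e0 i] k0 by auto
    then have ce: "c = (\<lambda>i. 0)" "e = (\<lambda>i. 0)" by auto
    then have y: "y \<noteq> 0" using X(2) by (simp add: Xe zero_eq)
    define \<alpha> where "\<alpha> = (\<lambda>k. if k \<in> h then \<chi> (k, \<lambda>i. 0, \<lambda>i. 0) else 0)"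
    define m where "m i = \<chi> (0, \<lambda>i. 0, \<lambda>j. if j = i then 1 else 0)" for i
    have dy: "d i y = s (m i) y" for i using dy0 by (simp add: m_def)
    have by': "b k y = s (\<alpha> k) y" if "k \<in> h" for k
      using A(1)[OF that, of "\<lambda>i. 0" "\<lambda>i. 0"] that by (simp add: \<alpha>_def)
    have \<chi>_eq: "\<chi> (k, c', e') = \<alpha> k + (\<Sum>i\<in>UNIV. m i * e' i)" if "k \<in> h" for k c' e'
    proof -
      have "der e' y = s (\<Sum>i\<in>UNIV. m i * e' i) y"
        by (simp add: der_def dy scale_sum_left mult.commute)
      then have "s (\<alpha> k + (\<Sum>i\<in>UNIV. m i * e' i)) y = s (\<chi> (k, c', e')) y"
        using A(1)[OF that, of e' c'] by'[OF that] by (simp add: scale_left_distrib)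
      then show ?thesis using y by simp
    qed
    have \<chi>_lam: "\<chi> = lam \<alpha> m"
    proof
      fix v :: "'g \<times> ('n \<Rightarrow> 'f) \<times> ('n \<Rightarrow> 'f)"
      obtain k c' e' where v: "v = (k, c', e')" by (cases v) auto
      have "\<chi> v = 0" if "k \<notin> h" using \<chi> that by (simp add: v dual_of_def HL_def)
      then show "\<chi> v = lam \<alpha> m v" using \<chi>_eq by (auto simp: v lam_eq)
    qed
    have "\<alpha> \<in> dual_of s h"
    proof -
      have lin: "\<chi> (X + Y) = \<chi> X + \<chi> Y" "\<chi> (sL a X) = a * \<chi> X" if "X \<in> H" "Y \<in> H" for X Y a
        using \<chi> that unfolding dual_of_def by blast+
      have "\<alpha> (x + y) = \<alpha> x + \<alpha> y" if "x \<in> h" "y \<in> h" for x y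
        using lin(1)[of "(x, \<lambda>i. 0, \<lambda>i. 0)" "(y, \<lambda>i. 0, \<lambda>i. 0)"] that
        by (simp add: \<alpha>_def h_add in_H plus_fun_def)
      moreover have "\<alpha> (s a x) = a * \<alpha> x" if "x \<in> h" for x a
        using lin(2)[of "(x, \<lambda>i. 0, \<lambda>i. 0)" "(x, \<lambda>i. 0, \<lambda>i. 0)" a] that
        by (simp add: \<alpha>_def h_scale in_H sL_eq)
      ultimately show ?thesis by (simp add: dual_of_def \<alpha>_def)
    qed
    moreover have yG: "y \<in> G \<alpha>" using by' by (simp add: root_space_def)
    ultimately have "\<alpha> \<in> R" using y by (rule in_RI)
    moreover obtain \<sigma> where "y \<in> gr \<sigma>" "m = (\<lambda>i. of_int (\<sigma> i))"
      using homogeneous_unique[OF y dy] by blast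
    ultimately show ?thesis using that[of \<alpha> \<sigma>] yG \<chi>_lam y by (auto simp: Xe ce)
  qed
qed

lemma roots_L: "roots sL bL H = {lz \<alpha> \<sigma> | \<alpha> \<sigma>. \<alpha> \<in> R \<and> gr \<sigma> \<inter> G \<alpha> \<noteq> {0}}"
proof (intro equalityI subsetI)
  fix \<chi> assume \<chi>: "\<chi> \<in> roots sL bL H"
  have "0 \<in> root_space sL bL H \<chi>" by (rule L.subspace_0[OF L.subspace_root_space])
  then obtain X where "X \<in> root_space sL bL H \<chi>" "X \<noteq> 0" using \<chi> by (auto simp: roots_def)
  moreover have "\<chi> \<in> dual_of sL H" using \<chi> by (simp add: roots_def)
  ultimately show "\<chi> \<in> {lz \<alpha> \<sigma> | \<alpha> \<sigma>. \<alpha> \<in> R \<and> gr \<sigma> \<inter> G \<alpha> \<noteq> {0}}"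
    using root_space_L_E[of \<chi> X] by blast
next
  fix \<chi> assume "\<chi> \<in> {lz \<alpha> \<sigma> | \<alpha> \<sigma>. \<alpha> \<in> R \<and> gr \<sigma> \<inter> G \<alpha> \<noteq> {0}}"
  then obtain \<alpha> \<sigma> where \<chi>: "\<chi> = lz \<alpha> \<sigma>" "\<alpha> \<in> R" "gr \<sigma> \<inter> G \<alpha> \<noteq> {0}" by blast
  then obtain x where x: "x \<in> gr \<sigma>" "x \<in> G \<alpha>" "x \<noteq> 0"
    using zero_in_gr[of \<sigma>] zero_in_root_space[of \<alpha>] by blast
  have "(x, \<lambda>i. 0, \<lambda>i. 0) \<in> root_space sL bL H \<chi>" "(x, \<lambda>i::'n. 0 :: 'f, \<lambda>i::'n. 0 :: 'f) \<noteq> 0"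
    using root_space_L_I[OF x(1,2)] \<chi>(1) x(3) unfolding zero_eq by simp_all
  then show "\<chi> \<in> roots sL bL H" using lam_dual[OF R_dual] \<chi> by (auto simp: roots_def)
qed

section \<open>Nondegeneracy, representing vectors and isotropy in the extension\<close>

lemma nondeg_L: "nondeg_on BL UNIV" and nondeg_H: "nondeg_on BL H"
proof -
  have *: "nondeg_on BL {X. fst X \<in> S}" if S: "nondeg_on B S" "0 \<in> S" for S
    unfolding nondeg_on_def
  proof (intro ballI impI)
    fix X assume XS: "X \<in> {X. fst X \<in> S}" and X0: "\<forall>Y\<in>{X. fst X \<in> S}. BL X Y = 0"
    obtain x c e where X: "X = (x, c, e)" by (cases X) auto
    have "B x y = 0" if "y \<in> S" for y
      using X0[rule_format, of "(y, \<lambda>i. 0, \<lambda>i. 0)"] that by (simp add: X BL_eq)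
    then have "x = 0" using S XS by (auto simp: nondeg_on_def X)
    moreover have "c i = 0" for i
      using X0[rule_format, of "(0, \<lambda>i. 0, \<lambda>j. if j = i then 1 else 0)"] S(2)
      by (simp add: X BL_eq sum.distrib if_distrib[of "(*) _"] cong: if_cong)
    moreover have "e i = 0" for i
      using X0[rule_format, of "(0, \<lambda>j. if j = i then 1 else 0, \<lambda>i. 0)"] S(2)
      by (simp add: X BL_eq sum.distrib if_distrib[of "(*) _"] cong: if_cong)
    ultimately show "X = 0" by (auto simp: X zero_eq)
  qed
  show "nondeg_on BL UNIV" using *[OF D_nondeg] by simp
  have "H = {X. fst X \<in> h}" by (auto simp: HL_def)
  then show "nondeg_on BL H" using *[OF D_nondeg_h h_zero] by simp
qed

lemma subspace_H: "L.subspace H"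
  by (rule L.subspaceI) (auto simp: HL_def sL_eq zero_eq h_add h_scale h_zero)

lemma tvec_lam:
  assumes "\<alpha> \<in> dual_of s h"
  shows "tvec BL H (lam \<alpha> m) = (T \<alpha>, m, \<lambda>i. 0)"
proof (rule L.tvec_eqI[OF nondeg_H subspace_H])
  show "(T \<alpha>, m, \<lambda>i. 0) \<in> H" using T_in[OF assms] by (simp add: in_H)
  show "BL (T \<alpha>, m, \<lambda>i. 0) v = lam \<alpha> m v" if "v \<in> H" for v
    using that B_T[OF assms] by (cases v) (simp add: BL_eq lam_eq in_H)
qed

lemma rform_lam:
  assumes "\<alpha> \<in> dual_of s h" "\<beta> \<in> dual_of s h"
  shows "rform BL H (lam \<alpha> m) (lam \<beta> m') = rform B h \<alpha> \<beta>"
  by (simp add: rform_def tvec_lam assms BL_eq)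

lemma T_zero: "T (\<lambda>v. 0) = 0"
  by (rule T_eqI) (simp_all add: h_zero)

lemma rform_zero: "rform B h (\<lambda>v. 0) \<beta> = 0"
  by (simp add: rform_def T_zero)

lemma rform_lz_R: "\<alpha> \<in> R \<Longrightarrow> rform BL H (lz \<alpha> \<sigma>) (lz \<alpha> \<sigma>) = 0 \<longleftrightarrow> \<alpha> = (\<lambda>v. 0)"
  using rform_R_nz by (auto simp: rform_lam R_dual rform_zero)

lemma roots_x_L: "roots_x sL bL BL H = {lz \<alpha> \<sigma> | \<alpha> \<sigma>. \<alpha> \<in> R \<and> \<alpha> \<noteq> (\<lambda>v. 0) \<and> gr \<sigma> \<inter> G \<alpha> \<noteq> {0}}"
  unfolding roots_x_def roots_L using rform_lz_R by blast

lemma roots_0_L: "roots_0 sL bL BL H = {lz (\<lambda>v. 0) \<sigma> | \<sigma>. gr \<sigma> \<inter> G (\<lambda>v. 0) \<noteq> {0}}"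
  unfolding roots_0_def roots_L using rform_lz_R zero_R by blast

lemma root_space_lz:
  assumes "\<alpha> \<in> R" "\<alpha> \<noteq> (\<lambda>v. 0)" "X \<in> root_space sL bL H (lz \<alpha> \<sigma>)"
  obtains x where "X = (x, \<lambda>i. 0, \<lambda>i. 0)" "x \<in> gr \<sigma>" "x \<in> G \<alpha>"
proof (cases "X = 0")
  case True
  then show ?thesis using that[of 0] zero_in_gr zero_in_root_space by (simp add: zero_eq)
next
  case False
  obtain \<beta> \<tau> where \<beta>: "\<beta> \<in> R" "lz \<alpha> \<sigma> = lz \<beta> \<tau>" "fst X \<in> gr \<tau>" "fst X \<in> G \<beta>"
      "lz \<alpha> \<sigma> \<noteq> (\<lambda>v. 0) \<Longrightarrow> X = (fst X, \<lambda>i. 0, \<lambda>i. 0)"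
    using root_space_L_E[OF lam_dual[OF R_dual[OF assms(1)]] assms(3) False] by metis
  have "\<beta> = \<alpha>" "\<tau> = \<sigma>" using lz_inj \<beta>(1,2) assms(1) R_dual by metis+
  moreover have "lz \<alpha> \<sigma> \<noteq> (\<lambda>v. 0)"
    using lam_inj(1)[OF R_dual[OF assms(1)] dual_zero, of _ "\<lambda>i. 0"] assms(2)
    unfolding lam_zero by blast
  ultimately show ?thesis using that \<beta> by blast
qed

subsection \<open>Axioms of the class T\<close>

text \<open>Pulls a subspace of \<open>\<L>\<close> back to \<open>\<G>\<close>, where the span
  arguments for the grading and the root decomposition apply.\<close>

lemma subspace_emb:
  assumes "L.subspace S"
  shows "subspace {x. (x, \<lambda>i. 0, \<lambda>i. 0) \<in> S}"
proof (rule subspaceI)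
  show "0 \<in> {x. (x, \<lambda>i. 0, \<lambda>i. 0) \<in> S}" using L.subspace_0[OF assms] by (simp add: zero_eq)
  show "x + y \<in> {x. (x, \<lambda>i. 0, \<lambda>i. 0) \<in> S}"
    if "x \<in> {x. (x, \<lambda>i. 0, \<lambda>i. 0) \<in> S}" "y \<in> {x. (x, \<lambda>i. 0, \<lambda>i. 0) \<in> S}" for x y
    using L.subspace_add[OF assms, of "(x, \<lambda>i. 0, \<lambda>i. 0)" "(y, \<lambda>i. 0, \<lambda>i. 0)"] that
    by (simp add: plus_fun_def)
  show "s a x \<in> {x. (x, \<lambda>i. 0, \<lambda>i. 0) \<in> S}" if "x \<in> {x. (x, \<lambda>i. 0, \<lambda>i. 0) \<in> S}" for a x
    using L.subspace_scale[OF assms, of "(x, \<lambda>i. 0, \<lambda>i. 0)" a] that by (simp add: sL_eq)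
qed

lemma subspace_L_decompose:
  assumes S: "L.subspace S" and "(x, \<lambda>i. 0, \<lambda>i. 0) \<in> S" "(0, c, e) \<in> S"
  shows "(x, c, e) \<in> S"
  using L.subspace_add[OF assms] by (simp add: plus_fun_def)

lemma fin_dim_H: "fin_dim sL H"
proof -
  obtain A where A: "finite A" "A \<subseteq> h" "span A = h" using D_fin by (auto simp: fin_dim_def)
  let ?u = "\<lambda>i j. if j = i then 1 else 0 :: 'f"
  let ?E = "(\<lambda>x. (x, \<lambda>i. 0, \<lambda>i. 0)) ` A \<union> range (\<lambda>i::'n. (0, ?u i, \<lambda>i. 0)) \<union> range (\<lambda>i::'n. (0, \<lambda>i. 0, ?u i))"
  note sub = L.subspace_span[of ?E]
  have E: "X \<in> L.span ?E" if "X \<in> ?E" for X using that by (rule L.span_base)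
  have "(x, c, e) \<in> L.span ?E" if "x \<in> h" for x c e
  proof -
    have "span A \<subseteq> {x. (x, \<lambda>i. 0, \<lambda>i. 0) \<in> L.span ?E}"
      by (rule span_minimal[OF _ subspace_emb[OF sub]]) (use E in auto)
    then have "(x, \<lambda>i. 0, \<lambda>i. 0) \<in> L.span ?E" using that A(3) by blast
    moreover have "(0, c, e) \<in> L.span ?E"
    proof -
      have "(\<Sum>i\<in>UNIV. sL (c i) (0, ?u i, \<lambda>i. 0) + sL (e i) (0, \<lambda>i. 0, ?u i)) \<in> L.span ?E"
        using E by (intro L.span_sum L.span_add L.span_scale) auto
      moreover have "(\<Sum>i\<in>I. sL (c i) (0, ?u i, \<lambda>i. 0) + sL (e i) (0, \<lambda>i. 0, ?u i)) =
          (0, \<lambda>j. \<Sum>i\<in>I. c i * ?u i j, \<lambda>j. \<Sum>i\<in>I. e i * ?u i j)" if "finite I" for I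
        using that by (induction I rule: finite_induct) (simp_all add: sL_eq plus_fun_def zero_eq)
      ultimately show ?thesis by (simp add: if_distrib[of "(*) _"] cong: if_cong)
    qed
    ultimately show ?thesis by (rule subspace_L_decompose[OF sub])
  qed
  then have "H \<subseteq> L.span ?E" by (auto simp: HL_def)
  moreover have EH: "?E \<subseteq> H" using A(2) h_zero by (auto simp: HL_def)
  then have "L.span ?E \<subseteq> H" by (rule L.span_minimal[OF _ subspace_H])
  ultimately have "L.span ?E = H" by blast
  moreover have "finite ?E" using A(1) by simp
  ultimately have "finite ?E \<and> ?E \<subseteq> H \<and> L.span ?E = H" using EH by (intro conjI)
  then show ?thesis unfolding fin_dim_def by (rule exI[of _ ?E])
qed

lemma h_bracket: "k \<in> h \<Longrightarrow> k' \<in> h \<Longrightarrow> b k k' = 0"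
  using D_h root_spaceD[of k' "\<lambda>v. 0" k] by auto

lemma toral_L: "toral sL bL H"
  unfolding toral_def
proof (intro conjI)
  show "subalgebra sL bL H"
    unfolding subalgebra_def using subspace_H
    by (auto simp: HL_def bL_eq h_bracket der_h h_zero)
  show "H \<noteq> {0}"
  proof -
    obtain k where "k \<in> h" "k \<noteq> 0" using D_toral h_zero unfolding toral_def by blast
    then have "(k, \<lambda>i. 0, \<lambda>i. 0) \<in> H" "(k, \<lambda>i::'n. 0 :: 'f, \<lambda>i::'n. 0 :: 'f) \<noteq> 0"
      by (simp_all add: in_H zero_eq)
    then show ?thesis by blast
  qed
  let ?S = "L.span (\<Union>\<chi>\<in>dual_of sL H. root_space sL bL H \<chi>)"
  have base: "X \<in> ?S" if "\<chi> \<in> dual_of sL H" "X \<in> root_space sL bL H \<chi>" for X \<chi>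
    using that by (intro L.span_base) blast
  note sub = L.subspace_span[of "\<Union>\<chi>\<in>dual_of sL H. root_space sL bL H \<chi>"]
  have "(x, c, e) \<in> ?S" for x c e
  proof (rule subspace_L_decompose[OF sub])
    have "x \<in> {x. (x, \<lambda>i. 0, \<lambda>i. 0) \<in> ?S}"
    proof (rule homogeneous_span[OF subspace_emb[OF sub]], rule subsetI)
      fix \<alpha> \<sigma> y assume "\<alpha> \<in> R" "y \<in> gr \<sigma> \<inter> G \<alpha>"
      then show "y \<in> {x. (x, \<lambda>i. 0, \<lambda>i. 0) \<in> ?S}"
        using base[OF lam_dual[OF R_dual] root_space_L_I] by blast
    qed
    then show "(x, \<lambda>i. 0, \<lambda>i. 0) \<in> ?S" by blast
    show "(0, c, e) \<in> ?S"
      using lam_dual[OF dual_zero, of "\<lambda>i. 0"] root_space_L_zero_I[OF zero_in_gr zero_in_root_space]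
      unfolding lam_zero by (rule base)
  qed
  then show "?S = UNIV" by auto
qed

text \<open>The pair from D12(b) commutes in \<open>\<G>\<close>, so its bracket in
  \<open>\<L>\<close> is the cocycle term alone. With \<open>B x y = 1\<close> that term is the
  central vector with coordinates \<sigma>, which represents \<delta>.\<close>

lemma T3_isotropic:
  assumes "\<delta> \<in> roots_0 sL bL BL H"
  shows "\<exists>x\<in>root_space sL bL H \<delta>. \<exists>y\<in>root_space sL bL H (\<lambda>v. - \<delta> v). bL x y = tvec BL H \<delta>"
proof -
  obtain \<sigma> where \<delta>: "\<delta> = lz (\<lambda>v. 0) \<sigma>" "gr \<sigma> \<inter> G (\<lambda>v. 0) \<noteq> {0}" using assms roots_0_L by blast
  obtain x y where xy: "x \<in> gr \<sigma>" "x \<in> G (\<lambda>v. 0)" "y \<in> gr (\<lambda>i. - \<sigma> i)" "y \<in> G (\<lambda>v. 0)"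
      "b x y = 0" "B x y = 1"
    using D_iso[rule_format, OF \<delta>(2)] by blast
  have "(y, \<lambda>i. 0, \<lambda>i. 0) \<in> root_space sL bL H (\<lambda>v. - \<delta> v)"
    using root_space_L_I[OF xy(3,4)] by (simp add: \<delta>(1) lam_minus)
  moreover have "bL (x, \<lambda>i. 0, \<lambda>i. 0) (y, \<lambda>i. 0, \<lambda>i. 0) = tvec BL H \<delta>"
    using xy by (simp add: bL_eq \<delta>(1) tvec_lam[OF dual_zero] T_zero d_deg B_scale_left)
  ultimately show ?thesis using root_space_L_I[OF xy(1,2)] \<delta>(1) by blast
qed

lemma bL_partner:
  assumes "\<alpha> \<in> R" "x \<in> gr \<sigma>" "b x y = T \<alpha>" "B x y = 1"
  shows "bL (x, \<lambda>i. 0, \<lambda>i. 0) (y, \<lambda>i. 0, \<lambda>i. 0) = (T \<alpha>, \<lambda>i. of_int (\<sigma> i), \<lambda>i. 0)"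
  using assms by (simp add: bL_eq d_deg B_scale_left)

lemma T3_nonisotropic:
  assumes "\<chi> \<in> roots_x sL bL BL H" "X \<in> root_space sL bL H \<chi>" "X \<noteq> 0"
  shows "\<exists>Y\<in>root_space sL bL H (\<lambda>v. - \<chi> v). bL X Y = tvec BL H \<chi>"
proof -
  obtain \<alpha> \<sigma> where \<alpha>: "\<chi> = lz \<alpha> \<sigma>" "\<alpha> \<in> R" "\<alpha> \<noteq> (\<lambda>v. 0)" using assms(1) roots_x_L by blast
  obtain x where x: "X = (x, \<lambda>i. 0, \<lambda>i. 0)" "x \<in> gr \<sigma>" "x \<in> G \<alpha>"
    using root_space_lz[OF \<alpha>(2,3)] assms(2) \<alpha>(1) by metis
  then have "x \<noteq> 0" using assms(3) by (auto simp: zero_eq)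
  then obtain y where y: "y \<in> gr (\<lambda>i. - \<sigma> i)" "y \<in> G (\<lambda>v. - \<alpha> v)" "b x y = T \<alpha>" "B x y = 1"
    using root_partner[OF \<alpha>(2,3) x(2,3)] by blast
  have "(y, \<lambda>i. 0, \<lambda>i. 0) \<in> root_space sL bL H (\<lambda>v. - \<chi> v)"
    using root_space_L_I[OF y(1,2)] by (simp add: \<alpha>(1) lam_minus)
  moreover have "bL X (y, \<lambda>i. 0, \<lambda>i. 0) = tvec BL H \<chi>"
    using bL_partner[OF \<alpha>(2) x(2) y(3,4)] by (simp add: x(1) \<alpha>(1) tvec_lam R_dual \<alpha>(2))
  ultimately show ?thesis by blast
qed

lemma root_space_L_R:
  assumes "\<alpha> \<in> dual_of s h" "X \<in> root_space sL bL H (lam \<alpha> m)" "X \<noteq> 0"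
  shows "\<alpha> \<in> R"
proof -
  obtain \<beta> \<sigma> where "\<beta> \<in> R" "lam \<alpha> m = lz \<beta> \<sigma>"
    using root_space_L_E[OF lam_dual[OF assms(1)] assms(2,3)] by blast
  then show ?thesis using lam_inj(1)[OF assms(1) R_dual] by blast
qed

text \<open>The vectors killed by some power of \<open>ad X\<close> form a subspace, so weight
  vectors suffice. On weight \<beta> the powers move along \<open>\<beta> + n\<alpha>\<close>, which
  leaves the finite set \<open>R\<close>.\<close>

lemma T4:
  assumes \<chi>: "\<chi> \<in> roots_x sL bL BL H" and X: "X \<in> root_space sL bL H \<chi>"
  shows "\<exists>n. (bL X ^^ n) Y = 0"
proof -
  obtain \<alpha> \<sigma> where \<alpha>: "\<chi> = lz \<alpha> \<sigma>" "\<alpha> \<in> R" "\<alpha> \<noteq> (\<lambda>v. 0)" using \<chi> roots_x_L by blast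
  let ?N = "{Y. \<exists>n. (bL X ^^ n) Y = 0}"
  have pow_add: "(bL X ^^ n) (Y + Z) = (bL X ^^ n) Y + (bL X ^^ n) Z" for n Y Z
    by (induction n) (simp_all add: L.b_add_right)
  have pow_scale: "(bL X ^^ n) (sL a Y) = sL a ((bL X ^^ n) Y)" for n a Y
    by (induction n) (simp_all add: L.b_scale_right)
  have pow_zero: "(bL X ^^ n) 0 = 0" for n
    by (induction n) simp_all
  have "L.subspace ?N"
  proof (rule L.subspaceI)
    show "0 \<in> ?N" using pow_zero by blast
    show "sL a Y \<in> ?N" if "Y \<in> ?N" for a Y
      using that by (auto simp: pow_scale intro!: L.scale_zero_right)
    fix Y Z assume "Y \<in> ?N" "Z \<in> ?N"
    then obtain m n where "(bL X ^^ m) Y = 0" "(bL X ^^ n) Z = 0" by blast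
    then have "(bL X ^^ (n + m)) Y = 0" "(bL X ^^ (m + n)) Z = 0"
      by (simp_all only: funpow_add o_apply pow_zero)
    then have "(bL X ^^ (m + n)) (Y + Z) = 0" by (simp add: pow_add add.commute)
    then show "Y + Z \<in> ?N" by blast
  qed
  moreover have "root_space sL bL H \<psi> \<subseteq> ?N" if \<psi>: "\<psi> \<in> dual_of sL H" for \<psi>
  proof
    fix Y assume Y: "Y \<in> root_space sL bL H \<psi>"
    show "Y \<in> ?N"
    proof (rule ccontr)
      assume no: "Y \<notin> ?N"
      then have "(bL X ^^ 0) Y \<noteq> 0" by blast
      then have Y0: "Y \<noteq> 0" by simp
      obtain \<beta> \<tau> where \<beta>: "\<beta> \<in> R" "\<psi> = lz \<beta> \<tau>"
        by (rule root_space_L_E[OF \<psi> Y Y0]) (erule (1) that)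
      have pow: "(bL X ^^ n) Y \<in> root_space sL bL H (lam (\<lambda>v. \<beta> v + of_nat n * \<alpha> v)
          (\<lambda>i. of_int (\<tau> i) + of_nat n * of_int (\<sigma> i)))" for n
      proof (induction n)
        case 0
        then show ?case using Y \<beta> by simp
      next
        case (Suc n)
        then show ?case
          using L.root_space_bracket[OF X Suc] by (simp add: \<alpha>(1) lam_add algebra_simps)
      qed
      have "(\<lambda>v. \<beta> v + of_nat n * \<alpha> v) \<in> R" for n
        using root_space_L_R[OF dual_add[OF R_dual[OF \<beta>(1)] dual_scale[OF R_dual[OF \<alpha>(2)]]] pow] no
        by blast
      then show False using root_line_leaves[OF \<alpha>(3)] by metis
    qed
  qed
  ultimately have "L.span (\<Union>\<psi>\<in>dual_of sL H. root_space sL bL H \<psi>) \<subseteq> ?N"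
    by (intro L.span_minimal) auto
  then show ?thesis using toral_L by (auto simp: toral_def)
qed

text \<open>An orthogonal splitting of the non-isotropic roots projects to one of the nonzero roots
  of \<open>\<G>\<close>. The two projections are disjoint because a common root would be orthogonal
  to itself.\<close>

lemma T5a:
  assumes "P \<noteq> {}" "Q \<noteq> {}" "P \<union> Q = roots_x sL bL BL H" "P \<inter> Q = {}"
    and orth: "\<forall>\<alpha>\<in>P. \<forall>\<beta>\<in>Q. rform BL H \<alpha> \<beta> = 0"
  shows False
proof -
  let ?p = "\<lambda>S. {\<alpha>. \<alpha> \<in> R \<and> \<alpha> \<noteq> (\<lambda>v. 0) \<and> (\<exists>\<sigma>. lz \<alpha> \<sigma> \<in> S)}"
  have ne: "?p S \<noteq> {}" if "S \<noteq> {}" "S \<subseteq> roots_x sL bL BL H" for S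
    using that unfolding roots_x_L by blast
  have o: "rform B h \<alpha> \<beta> = 0" if "\<alpha> \<in> ?p P" "\<beta> \<in> ?p Q" for \<alpha> \<beta>
    using that orth rform_lam[OF R_dual R_dual, of \<alpha> \<beta>] by force
  have "?p P \<union> ?p Q = R - {\<lambda>v. 0}"
  proof (intro equalityI subsetI)
    fix \<alpha> assume \<alpha>: "\<alpha> \<in> R - {\<lambda>v. 0}"
    then obtain \<sigma> where "gr \<sigma> \<inter> G \<alpha> \<noteq> {0}" using homogeneous_root_vector by blast
    then have "lz \<alpha> \<sigma> \<in> P \<union> Q" unfolding assms(3) roots_x_L using \<alpha> by blast
    then show "\<alpha> \<in> ?p P \<union> ?p Q" using \<alpha> by blast
  qed blast
  moreover have "?p P \<inter> ?p Q = {}"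
  proof (rule ccontr)
    assume "\<not> ?thesis"
    then obtain \<alpha> where \<alpha>: "\<alpha> \<in> ?p P" "\<alpha> \<in> ?p Q" by blast
    then show False using o[OF \<alpha>] rform_R_nz[of \<alpha>] by simp
  qed
  moreover have "?p P \<noteq> {}" "?p Q \<noteq> {}" using ne assms(1-3) by blast+
  moreover have "\<forall>\<alpha>\<in>?p P. \<forall>\<beta>\<in>?p Q. rform B h \<alpha> \<beta> = 0" by (intro ballI o)
  ultimately have "?p P \<noteq> {} \<and> ?p Q \<noteq> {} \<and> ?p P \<union> ?p Q = R - {\<lambda>v. 0} \<and> ?p P \<inter> ?p Q = {} \<and>
            (\<forall>\<alpha>\<in>?p P. \<forall>\<beta>\<in>?p Q. rform B h \<alpha> \<beta> = 0)" by (intro conjI)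
  then have "\<exists>P Q. P \<noteq> {} \<and> Q \<noteq> {} \<and> P \<union> Q = R - {\<lambda>v. 0} \<and> P \<inter> Q = {} \<and>
            (\<forall>\<alpha>\<in>P. \<forall>\<beta>\<in>Q. rform B h \<alpha> \<beta> = 0)" by (intro exI)
  moreover have "\<not> (\<exists>P Q. P \<noteq> {} \<and> Q \<noteq> {} \<and> P \<union> Q = R - {\<lambda>v. 0} \<and> P \<inter> Q = {} \<and>
            (\<forall>\<alpha>\<in>P. \<forall>\<beta>\<in>Q. rform B h \<alpha> \<beta> = 0))"
    using D_irred unfolding irred_finite_root_system_def by - (elim conjE, assumption)
  ultimately show False by (rule notE[rotated])
qed

lemma T5b:
  assumes "\<delta> \<in> roots_0 sL bL BL H"
  shows "\<exists>\<alpha>\<in>roots_x sL bL BL H. (\<lambda>v. \<alpha> v + \<delta> v) \<in> roots sL bL H"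
proof -
  obtain \<sigma> where \<delta>: "\<delta> = lz (\<lambda>v. 0) \<sigma>" "gr \<sigma> \<inter> G (\<lambda>v. 0) \<noteq> {0}" using assms roots_0_L by blast
  obtain \<alpha> \<tau> where \<alpha>: "\<alpha> \<in> R" "\<alpha> \<noteq> (\<lambda>v. 0)" "gr \<tau> \<inter> G \<alpha> \<noteq> {0}" "gr (\<lambda>i. \<sigma> i + \<tau> i) \<inter> G \<alpha> \<noteq> {0}"
    using isotropic_shift[OF \<delta>(2)] by blast
  have "(\<lambda>v. lz \<alpha> \<tau> v + \<delta> v) = lz \<alpha> (\<lambda>i. \<sigma> i + \<tau> i)" by (simp add: \<delta>(1) lam_add add.commute)
  also have "\<dots> \<in> roots sL bL H" unfolding roots_L using \<alpha>(1,4)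
    by (intro CollectI exI[of _ \<alpha>] exI[of _ "\<lambda>i. \<sigma> i + \<tau> i"] conjI refl)
  finally have "(\<lambda>v. lz \<alpha> \<tau> v + \<delta> v) \<in> roots sL bL H" .
  moreover have "lz \<alpha> \<tau> \<in> roots_x sL bL BL H" unfolding roots_x_L using \<alpha> by blast
  ultimately show ?thesis by (rule bexI)
qed

text \<open>The map \<open>\<psi>\<close> is an injective homomorphism from integer vectors to
  functionals whose image contains the isotropic roots. It identifies their integral span with a
  lattice that contains the support, to which \<open>support_lattice\<close> applies.\<close>

lemma free_rank_L: "free_abelian_rank (int_span (roots_0 sL bL BL H)) (card (UNIV :: 'n set))"
proof -
  let ?Z = "int_span (roots_0 sL bL BL H)" and ?n = "card (UNIV :: 'n set)"
  define \<psi> where "\<psi> \<sigma> = lz (\<lambda>v. 0) \<sigma>" for \<sigma> :: "'n \<Rightarrow> int"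
  define \<Lambda> where "\<Lambda> = {\<sigma>. \<psi> \<sigma> \<in> ?Z}"
  have \<psi>_add: "\<psi> (\<lambda>i. \<sigma> i + \<tau> i) = (\<lambda>v. \<psi> \<sigma> v + \<psi> \<tau> v)" for \<sigma> \<tau>
    by (simp add: \<psi>_def lam_add)
  have \<psi>_scale: "\<psi> (\<lambda>i. k * \<sigma> i) = (\<lambda>v. of_int k * \<psi> \<sigma> v)" for k \<sigma>
    by (simp add: \<psi>_def lam_scale)
  have \<psi>_zero: "\<psi> (\<lambda>i. 0) = (\<lambda>v. 0)" by (simp add: \<psi>_def lam_zero)
  have \<psi>_sum: "\<psi> (\<lambda>i. \<Sum>t<m. k t * e t i) = (\<lambda>v. \<Sum>t<m. of_int (k t) * \<psi> (e t) v)" for k e and m :: nat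
    by (induction m) (simp_all add: \<psi>_zero \<psi>_add \<psi>_scale)
  have \<psi>_inj: "\<sigma> = \<tau>" if "\<psi> \<sigma> = \<psi> \<tau>" for \<sigma> \<tau>
    using lz_inj(2)[OF dual_zero dual_zero] that by (simp add: \<psi>_def)
  have Z_add: "(\<lambda>v. x v + y v) \<in> ?Z" if "x \<in> ?Z" "y \<in> ?Z" for x y
    using that unfolding int_span_eq by (intro comb_span_add) auto
  have Z_scale: "(\<lambda>v. of_int k * x v) \<in> ?Z" if "x \<in> ?Z" for x k
    using that unfolding int_span_eq by (intro comb_span_scale) auto
  have Z_zero: "(\<lambda>v. 0) \<in> ?Z" unfolding int_span_eq by (rule comb_span_zero)
  have Z_range: "?Z \<subseteq> range \<psi>"
  proof
    fix f assume "f \<in> ?Z"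
    then show "f \<in> range \<psi>" unfolding int_span_eq
    proof (rule comb_span_least)
      show "roots_0 sL bL BL H \<subseteq> range \<psi>" unfolding roots_0_L \<psi>_def by blast
      show "(\<lambda>v. 0) \<in> range \<psi>" using \<psi>_zero by (metis rangeI)
      show "(\<lambda>v. x v + y v) \<in> range \<psi>" if "x \<in> range \<psi>" "y \<in> range \<psi>" for x y
        using that by (auto simp: \<psi>_add[symmetric])
      show "(\<lambda>v. of_int c * x v) \<in> range \<psi>" if "x \<in> range \<psi>" for c x
        using that by (auto simp: \<psi>_scale[symmetric])
    qed
  qed
  have S: "\<sigma> \<in> \<Lambda>" if "gr \<sigma> \<noteq> {0}" for \<sigma>
  proof -
    have "\<psi> \<sigma> \<in> roots_0 sL bL BL H"
      unfolding roots_0_L \<psi>_def using support_zero_root[OF that] by blast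
    then show ?thesis by (simp add: \<Lambda>_def int_span_eq comb_span_base)
  qed
  have \<Lambda>0: "0 \<in> \<Lambda>" using \<psi>_zero Z_zero by (simp add: \<Lambda>_def zero_fun_def)
  have \<Lambda>_add: "x + y \<in> \<Lambda>" if "x \<in> \<Lambda>" "y \<in> \<Lambda>" for x y
    using that Z_add \<psi>_add[of x y] by (simp add: \<Lambda>_def plus_fun_def)
  have \<Lambda>_scale: "(\<lambda>j. k * x j) \<in> \<Lambda>" if "x \<in> \<Lambda>" for k x
    using that Z_scale \<psi>_scale[of k x] by (simp add: \<Lambda>_def)
  obtain e where e: "\<And>t. t < ?n \<Longrightarrow> e t \<in> \<Lambda>"
      "\<And>x. x \<in> \<Lambda> \<Longrightarrow> \<exists>k. x = (\<lambda>j. \<Sum>t<?n. k t * e t j)"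
      "\<And>k. (\<And>j. (\<Sum>t<?n. k t * e t j) = 0) \<Longrightarrow> \<forall>t<?n. k t = 0"
    using support_lattice[OF S \<Lambda>0 \<Lambda>_add \<Lambda>_scale] by blast
  show ?thesis unfolding free_abelian_rank_def
  proof (intro exI[of _ "\<lambda>t. \<psi> (e t)"] conjI allI impI)
    let ?I = "int_span ((\<lambda>t. \<psi> (e t)) ` {..<?n})"
    show "?Z = ?I"
    proof (intro equalityI subsetI)
      fix f assume f: "f \<in> ?Z"
      then obtain x where x: "f = \<psi> x" "x \<in> \<Lambda>" using Z_range by (auto simp: \<Lambda>_def)
      then obtain k where "x = (\<lambda>j. \<Sum>t<?n. k t * e t j)" using e(2) by blast
      then have "f = (\<lambda>v. \<Sum>t<?n. of_int (k t) * \<psi> (e t) v)" using x(1) \<psi>_sum by simp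
      also have "\<dots> \<in> ?I" unfolding int_span_eq
        by (intro comb_span_sum comb_span_scale comb_span_base) auto
      finally show "f \<in> ?I" .
    next
      fix f assume "f \<in> ?I"
      then show "f \<in> ?Z" unfolding int_span_eq[of "(\<lambda>t. \<psi> (e t)) ` {..<?n}"]
        by (rule comb_span_least) (use e(1) Z_zero Z_add Z_scale in \<open>auto simp: \<Lambda>_def\<close>)
    qed
    fix k :: "nat \<Rightarrow> int" and i
    assume k: "(\<lambda>v. \<Sum>i<?n. of_int (k i) * \<psi> (e i) v) = (\<lambda>v. 0)" and i: "i < ?n"
    have "\<psi> (\<lambda>j. \<Sum>t<?n. k t * e t j) = \<psi> (\<lambda>i. 0)" unfolding \<psi>_sum k \<psi>_zero ..
    then have "(\<lambda>j. \<Sum>t<?n. k t * e t j) = (\<lambda>i. 0)" by (rule \<psi>_inj)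
    then have "\<forall>t<?n. k t = 0" by (intro e(3)) (simp add: fun_eq_iff)
    then show "k i = 0" using i by blast
  qed
qed

lemma nullity_L: "nullity sL bL BL H = card (UNIV :: 'n set)"
  unfolding nullity_def using free_rank_L free_abelian_rank_unique by blast

lemma class_T_L: "class_T sL bL BL H"
  unfolding class_T_def
  using lie_L sbf_L inv_L nondeg_L fin_dim_H toral_L nondeg_H T3_isotropic T3_nonisotropic T4
    T5a T5b free_rank_L by (intro conjI) blast+

subsection \<open>Core, centre and type\<close>

text \<open>\<open>C\<close> has to be obtained before weight zero: a bracket of two elements of
  \<open>\<G>\<close> carries a cocycle term, and only once \<open>C\<close> lies in
  \<open>A\<close> can this term be removed and D8 be used.\<close>

lemma core_generators_span:
  assumes A: "subalgebra sL bL A" and gens: "(\<Union>\<alpha>\<in>roots_x sL bL BL H. root_space sL bL H \<alpha>) \<subseteq> A"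
  shows "(x, c, \<lambda>i. 0) \<in> A"
proof -
  have sub: "L.subspace A" and br: "\<And>X Y. X \<in> A \<Longrightarrow> Y \<in> A \<Longrightarrow> bL X Y \<in> A"
    using A by (auto simp: subalgebra_def)
  have A_diff: "(y - y', \<lambda>i. c i - c' i, \<lambda>i. 0) \<in> A"
    if "(y, c, \<lambda>i. 0) \<in> A" "(y', c', \<lambda>i. 0) \<in> A" for y y' c c'
    using L.subspace_diff[OF sub that] by (simp add: minus_prod_def fun_diff_def zero_fun_def)
  have root: "(y, \<lambda>i. 0, \<lambda>i. 0) \<in> A"
    if "\<alpha> \<in> R" "\<alpha> \<noteq> (\<lambda>v. 0)" "y \<in> gr \<sigma>" "y \<in> G \<alpha>" for y \<alpha> \<sigma>
  proof (cases "y = 0")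
    case True
    then show ?thesis using L.subspace_0[OF sub] by (simp add: zero_eq)
  next
    case False
    then have "lz \<alpha> \<sigma> \<in> roots_x sL bL BL H" unfolding roots_x_L using that by blast
    then show ?thesis using root_space_L_I[OF that(3,4)] gens by blast
  qed
  have neg: "(\<lambda>v. - \<alpha> v) \<in> R" "(\<lambda>v. - \<alpha> v) \<noteq> (\<lambda>v. 0)"
    if "\<alpha> \<in> R" "\<alpha> \<noteq> (\<lambda>v. 0)" "y \<in> G (\<lambda>v. - \<alpha> v)" "y \<noteq> 0" for \<alpha> y
  proof -
    show "(\<lambda>v. - \<alpha> v) \<in> R" by (rule in_RI[OF dual_minus[OF R_dual[OF that(1)]] that(3,4)])
    show "(\<lambda>v. - \<alpha> v) \<noteq> (\<lambda>v. 0)" using that(2) by (auto simp: fun_eq_iff)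
  qed
  have coroot: "(T \<alpha>, \<lambda>i. of_int (\<sigma> i), \<lambda>i. 0) \<in> A"
    if \<alpha>: "\<alpha> \<in> R" "\<alpha> \<noteq> (\<lambda>v. 0)" "gr \<sigma> \<inter> G \<alpha> \<noteq> {0}" for \<alpha> \<sigma>
  proof -
    obtain y where y: "y \<in> gr \<sigma>" "y \<in> G \<alpha>" "y \<noteq> 0"
      using \<alpha>(3) zero_in_gr[of \<sigma>] zero_in_root_space[of \<alpha>] by blast
    obtain y' where y': "y' \<in> gr (\<lambda>i. - \<sigma> i)" "y' \<in> G (\<lambda>v. - \<alpha> v)" "b y y' = T \<alpha>" "B y y' = 1"
      using root_partner[OF \<alpha>(1,2) y] by blast
    then have "y' \<noteq> 0" by auto
    then have "(y', \<lambda>i. 0, \<lambda>i. 0) \<in> A" using root[OF neg[OF \<alpha>(1,2) y'(2)] y'(1,2)] by blast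
    from br[OF root[OF \<alpha>(1,2) y(1,2)] this] show ?thesis
      unfolding bL_partner[OF \<alpha>(1) y(1) y'(3,4)] .
  qed
  \<comment> \<open>Where a root vector of degree zero exists, the bracket has no central part; the
    other coroots are scalar multiples of such ones.\<close>
  have coroot0: "(T \<alpha>, \<lambda>i. 0, \<lambda>i. 0) \<in> A" if \<alpha>: "\<alpha> \<in> R" "\<alpha> \<noteq> (\<lambda>v. 0)" for \<alpha>
  proof -
    have "T \<alpha> \<in> {x. (x, \<lambda>i. 0, \<lambda>i. 0) \<in> A}"
      using coroot[of _ "\<lambda>i. 0"]
      by (intro coroot_in_subspace[OF \<alpha> subspace_emb[OF sub]]) simp
    then show ?thesis by blast
  qed
  have shift: "(0, \<lambda>i. of_int (\<sigma> i), \<lambda>i. 0) \<in> A"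
    if "\<alpha> \<in> R" "\<alpha> \<noteq> (\<lambda>v. 0)" "gr \<sigma> \<inter> G \<alpha> \<noteq> {0}" for \<alpha> \<sigma>
    using A_diff[OF coroot[OF that] coroot0[OF that(1,2)]] by simp
  have central: "(0, c, \<lambda>i. 0) \<in> A" for c
  proof -
    have "c \<in> {c. (0, c, \<lambda>i. 0) \<in> A}"
    proof (rule support_spans)
      fix \<sigma> assume "gr \<sigma> \<noteq> {0}"
      from isotropic_shift[OF support_zero_root[OF this]] obtain \<alpha> \<tau>
        where \<alpha>: "\<alpha> \<in> R" "\<alpha> \<noteq> (\<lambda>v. 0)" "gr \<tau> \<inter> G \<alpha> \<noteq> {0}" "gr (\<lambda>i. \<sigma> i + \<tau> i) \<inter> G \<alpha> \<noteq> {0}"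
        by blast
      show "(\<lambda>i. of_int (\<sigma> i)) \<in> {c. (0, c, \<lambda>i. 0) \<in> A}"
        using A_diff[OF shift[OF \<alpha>(1,2,4)] shift[OF \<alpha>(1,2,3)]] by simp
    next
      show "(\<lambda>i. 0) \<in> {c. (0, c, \<lambda>i. 0) \<in> A}" using L.subspace_0[OF sub] by (simp add: zero_eq)
      show "(\<lambda>i. x i + y i) \<in> {c. (0, c, \<lambda>i. 0) \<in> A}"
        if "x \<in> {c. (0, c, \<lambda>i. 0) \<in> A}" "y \<in> {c. (0, c, \<lambda>i. 0) \<in> A}" for x y
        using L.subspace_add[OF sub, of "(0, x, \<lambda>i. 0)" "(0, y, \<lambda>i. 0)"] that by (simp add: plus_fun_def)
      show "(\<lambda>i. k * x i) \<in> {c. (0, c, \<lambda>i. 0) \<in> A}" if "x \<in> {c. (0, c, \<lambda>i. 0) \<in> A}" for k x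
        using L.subspace_scale[OF sub, of "(0, x, \<lambda>i. 0)" k] that by (simp add: sL_eq)
    qed
    then show ?thesis by blast
  qed
  let ?A = "{x. (x, \<lambda>i. 0, \<lambda>i. 0) \<in> A}"
  note subA = subspace_emb[OF sub]
  have Gx: "G \<alpha> \<subseteq> ?A" if "\<alpha> \<in> R" "\<alpha> \<noteq> (\<lambda>v. 0)" for \<alpha>
    using root[OF that] by (intro root_space_subset[OF subA that(1)]) blast
  have "x \<in> ?A"
  proof (rule root_space_span[OF subA])
    fix \<alpha> assume \<alpha>: "\<alpha> \<in> R"
    show "G \<alpha> \<subseteq> ?A"
    proof (cases "\<alpha> = (\<lambda>v. 0)")
      case False
      then show ?thesis using Gx \<alpha> by blast
    next
      case True
      show ?thesis unfolding True D_G0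
      proof (rule span_minimal[OF _ subA], rule subsetI)
        fix w assume "w \<in> {b x y | x y \<alpha>. \<alpha> \<in> R - {\<lambda>v. 0} \<and> x \<in> G \<alpha> \<and> y \<in> G (\<lambda>v. - \<alpha> v)}"
        then obtain y z \<beta> where w: "w = b y z"
          and \<beta>: "\<beta> \<in> R" "\<beta> \<noteq> (\<lambda>v. 0)" "y \<in> G \<beta>" "z \<in> G (\<lambda>v. - \<beta> v)" by blast
        have "z \<in> ?A"
        proof (cases "z = 0")
          case True
          then show ?thesis using subspace_0[OF subA] by simp
        next
          case False
          then show ?thesis using Gx[OF neg[OF \<beta>(1,2,4)]] \<beta>(4) by blast
        qed
        moreover have "y \<in> ?A" using Gx[OF \<beta>(1,2)] \<beta>(3) by blast
        ultimately have "bL (y, \<lambda>i. 0, \<lambda>i. 0) (z, \<lambda>i. 0, \<lambda>i. 0) \<in> A" using br by blast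
        then have "(b y z, \<lambda>i. B (d i y) z, \<lambda>i. 0) \<in> A" by (simp add: bL_eq)
        from A_diff[OF this central[of "\<lambda>i. B (d i y) z"]] show "w \<in> ?A" by (simp add: w)
      qed
    qed
  qed
  then have "(x, \<lambda>i. 0, \<lambda>i. 0) \<in> A" by blast
  then show ?thesis using central by (rule subspace_L_decompose[OF sub])
qed

lemma core_L: "core sL bL BL H = {(x, c, e). e = (\<lambda>i. 0)}"
proof (intro equalityI subsetI)
  fix X assume X: "X \<in> core sL bL BL H"
  let ?K = "{(x, c, e). e = (\<lambda>i. 0)} :: ('g \<times> ('n \<Rightarrow> 'f) \<times> ('n \<Rightarrow> 'f)) set"
  have "subalgebra sL bL ?K"
    unfolding subalgebra_def
    by (intro conjI L.subspaceI) (auto simp: zero_eq plus_fun_def sL_eq bL_eq)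
  moreover have "root_space sL bL H \<chi> \<subseteq> ?K" if \<chi>: "\<chi> \<in> roots_x sL bL BL H" for \<chi>
  proof
    fix Y assume Y: "Y \<in> root_space sL bL H \<chi>"
    obtain \<alpha> \<sigma> where \<alpha>: "\<chi> = lz \<alpha> \<sigma>" "\<alpha> \<in> R" "\<alpha> \<noteq> (\<lambda>v. 0)"
      using \<chi>[unfolded roots_x_L] by blast
    obtain x where "Y = (x, \<lambda>i. 0, \<lambda>i. 0)" using root_space_lz[OF \<alpha>(2,3) Y[unfolded \<alpha>(1)]] .
    then show "Y \<in> ?K" by simp
  qed
  ultimately have "?K \<in> {A. subalgebra sL bL A \<and> (\<Union>\<alpha>\<in>roots_x sL bL BL H. root_space sL bL H \<alpha>) \<subseteq> A}"
    by (intro CollectI conjI UN_least)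
  then show "X \<in> ?K" by (rule InterD[OF X[unfolded core_def gen_subalg_def]])
next
  fix X assume "X \<in> ({(x, c, e). e = (\<lambda>i. 0)} :: ('g \<times> ('n \<Rightarrow> 'f) \<times> ('n \<Rightarrow> 'f)) set)"
  then show "X \<in> core sL bL BL H"
    unfolding core_def gen_subalg_def using core_generators_span by blast
qed

lemma centre_L: "centre_of bL {(x, c, e). e = (\<lambda>i. 0)} = {(x, c, e). x = 0 \<and> e = (\<lambda>i. 0)}"
proof (intro equalityI subsetI)
  fix X assume X: "X \<in> centre_of bL {(x, c, e). e = (\<lambda>i. 0)}"
  then obtain x c where Xe: "X = (x, c, \<lambda>i. 0)" by (auto simp: centre_of_def)
  have "b x y = 0" for y
  proof -
    have "bL X (y, \<lambda>i. 0, \<lambda>i. 0) = 0" using X by (simp add: centre_of_def)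
    then show ?thesis by (simp add: Xe bL_eq zero_eq)
  qed
  then have "x = 0" by (rule centre_trivial)
  then show "X \<in> {(x, c, e). x = 0 \<and> e = (\<lambda>i. 0)}" by (simp add: Xe)
qed (auto simp: centre_of_def bL_eq zero_eq)

text \<open>If \<open>(x, c, e)\<close> centralizes the core, then \<open>ad x\<close> acts on
  \<open>\<G>\<close> as minus \<open>der e\<close>. A root vector of weight \<alpha> and degree
  \<sigma> then evaluates \<open>B x (T \<alpha>)\<close> as minus the pairing of \<open>e\<close>
  with \<sigma>. Degree zero makes this value zero for every nonzero root, so \<open>e\<close> is
  orthogonal to all degrees of non-isotropic roots, hence to their differences and to the whole
  support.\<close>

lemma tame_L: "tame sL bL BL H"
  unfolding tame_def core_L
proof
  fix X assume X: "X \<in> centralizer bL {(x, c, e). e = (\<lambda>i. 0)}"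
  obtain x c e where Xe: "X = (x, c, e)" by (cases X) auto
  have comm: "b x y = - der e y" for y
  proof -
    have "bL X (y, \<lambda>i. 0, \<lambda>i. 0) = 0" using X by (simp add: centralizer_def)
    then show ?thesis by (simp add: Xe bL_eq zero_eq eq_neg_iff_add_eq_0)
  qed
  let ?e = "\<lambda>\<sigma>. \<Sum>i\<in>UNIV. e i * of_int (\<sigma> i)"
  have val: "B x (T \<alpha>) = - ?e \<sigma>" if \<alpha>: "\<alpha> \<in> R" "\<alpha> \<noteq> (\<lambda>v. 0)" "gr \<sigma> \<inter> G \<alpha> \<noteq> {0}" for \<alpha> \<sigma>
  proof -
    obtain y where y: "y \<in> gr \<sigma>" "y \<in> G \<alpha>" "y \<noteq> 0"
      using \<alpha>(3) zero_in_gr[of \<sigma>] zero_in_root_space[of \<alpha>] by blast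
    obtain y' where y': "b y y' = T \<alpha>" "B y y' = 1"
      using root_partner[OF \<alpha>(1,2) y] by blast
    have "B x (T \<alpha>) = B (b x y) y'" by (simp add: B_inv y')
    also have "b x y = s (- ?e \<sigma>) y" by (simp add: comm der_deg[OF y(1)])
    finally show ?thesis by (simp add: B_scale_left y' B_minus_left)
  qed
  have val0: "B x (T \<alpha>) = 0" if \<alpha>: "\<alpha> \<in> R" "\<alpha> \<noteq> (\<lambda>v. 0)" for \<alpha>
  proof -
    have "subspace {t. B x t = 0}" by (rule subspaceI) (auto simp: B_add_right B_scale_right)
    then have "T \<alpha> \<in> {t. B x t = 0}"
      using val[of _ "\<lambda>i. 0"] by (intro coroot_in_subspace[OF \<alpha>]) auto
    then show ?thesis by blast
  qed
  have "?e \<sigma> = 0" if \<sigma>: "gr \<sigma> \<noteq> {0}" for \<sigma>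
  proof -
    obtain \<alpha> \<tau> where \<alpha>: "\<alpha> \<in> R" "\<alpha> \<noteq> (\<lambda>v. 0)" "gr \<tau> \<inter> G \<alpha> \<noteq> {0}" "gr (\<lambda>i. \<sigma> i + \<tau> i) \<inter> G \<alpha> \<noteq> {0}"
      using isotropic_shift[OF support_zero_root[OF \<sigma>]] by blast
    have "?e \<tau> = 0" "?e (\<lambda>i. \<sigma> i + \<tau> i) = 0"
      using val[OF \<alpha>(1,2,3)] val[OF \<alpha>(1,2,4)] val0[OF \<alpha>(1,2)] by simp_all
    then show ?thesis by (simp add: distrib_left sum.distrib)
  qed
  then have "e = (\<lambda>i. 0)" by (rule support_orth)
  then show "X \<in> {(x, c, e). e = (\<lambda>i. 0)}" by (simp add: Xe)
qed

text \<open>Projection onto \<open>\<G>\<close> discards the cocycle term, so it is a homomorphism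
  on the core; its kernel there is \<open>C\<close>.\<close>

lemma cc_iso_L: "cc_iso_to sL bL BL H s b"
  unfolding cc_iso_to_def core_L centre_L Let_def
proof (intro exI[of _ fst] conjI)
  show "fst ` {(x, c, e). e = (\<lambda>i. 0)} = UNIV" by (auto simp: image_iff)
qed (auto simp: sL_eq bL_eq)

text \<open>The isomorphism is induced by restriction of functionals to \<open>h\<close>. Its kernel
  on the rational span is the radical because the form is anisotropic on the rational span of
  \<open>R\<close>.\<close>

lemma same_type_L: "same_type (rform BL H) (roots sL bL H) R"
proof -
  define \<phi> where "\<phi> x = (\<lambda>g. if g \<in> h then x (g, \<lambda>i. 0, \<lambda>i. 0) else 0)"
    for x :: "'g \<times> ('n \<Rightarrow> 'f) \<times> ('n \<Rightarrow> 'f) \<Rightarrow> 'f"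
  have \<phi>_lam: "\<phi> (lam \<alpha> m) = \<alpha>" if "\<alpha> \<in> dual_of s h" for \<alpha> m
    using lam_root[OF that] by (simp add: \<phi>_def)
  have dual: "\<alpha> \<in> dual_of s h" if "\<alpha> \<in> rat_span_fun R" for \<alpha>
    using that unfolding rat_span_fun_eq
    by (rule comb_span_least) (auto intro: R_dual dual_zero dual_add dual_scale)
  have span: "x \<in> {lam \<alpha> m | \<alpha> m. \<alpha> \<in> rat_span_fun R}" if "x \<in> rat_span_fun (roots sL bL H)" for x
    using that unfolding rat_span_fun_eq[of "roots sL bL H"]
  proof (rule comb_span_least)
    let ?S = "{lam \<alpha> m | \<alpha> m. \<alpha> \<in> rat_span_fun R}"
    show "roots sL bL H \<subseteq> ?S" unfolding roots_L using R_rat_span by blast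
    have z: "(\<lambda>v. 0) \<in> rat_span_fun R" unfolding rat_span_fun_eq by (rule comb_span_zero)
    then show "(\<lambda>v. 0) \<in> ?S" using lam_zero by (metis (mono_tags, lifting) mem_Collect_eq)
    fix x assume "x \<in> ?S"
    then obtain \<alpha> m where x: "x = lam \<alpha> m" "\<alpha> \<in> rat_span_fun R" by blast
    show "(\<lambda>v. of_rat c * x v) \<in> ?S" for c
    proof -
      have "(\<lambda>v. of_rat c * \<alpha> v) \<in> rat_span_fun R"
        using x(2) unfolding rat_span_fun_eq by (intro comb_span_scale) (auto simp: of_rat_mult)
      then show ?thesis unfolding x(1) lam_scale by blast
    qed
    fix y assume "y \<in> ?S"
    then obtain \<beta> m' where y: "y = lam \<beta> m'" "\<beta> \<in> rat_span_fun R" by blast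
    have "(\<lambda>v. \<alpha> v + \<beta> v) \<in> rat_span_fun R"
      using x(2) y(2) unfolding rat_span_fun_eq by (intro comb_span_add) (auto simp: of_rat_add)
    then show "(\<lambda>v. x v + y v) \<in> ?S" unfolding x(1) y(1) lam_add by blast
  qed
  show ?thesis unfolding same_type_def
  proof (intro exI[of _ \<phi>] conjI ballI)
    show "\<phi> (\<lambda>v. x v + y v) = (\<lambda>w. \<phi> x w + \<phi> y w)" for x y by (auto simp: \<phi>_def)
    show "\<phi> ` roots sL bL H = R"
    proof (intro equalityI subsetI)
      fix \<alpha> assume "\<alpha> \<in> \<phi> ` roots sL bL H"
      then show "\<alpha> \<in> R" unfolding roots_L using \<phi>_lam R_dual by auto
    next
      fix \<alpha> assume \<alpha>: "\<alpha> \<in> R"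
      then obtain \<sigma> where "gr \<sigma> \<inter> G \<alpha> \<noteq> {0}" by (rule homogeneous_root_vector)
      then have "lz \<alpha> \<sigma> \<in> roots sL bL H" unfolding roots_L using \<alpha> by blast
      then show "\<alpha> \<in> \<phi> ` roots sL bL H" using \<phi>_lam[OF R_dual[OF \<alpha>]] by (metis imageI)
    qed
    fix x assume xs: "x \<in> rat_span_fun (roots sL bL H)"
    then obtain \<alpha> m where x: "x = lam \<alpha> m" "\<alpha> \<in> rat_span_fun R" using span by blast
    show "\<phi> x = (\<lambda>w. 0) \<longleftrightarrow> (\<forall>y\<in>rat_span_fun (roots sL bL H). rform BL H x y = 0)"
    proof
      assume "\<phi> x = (\<lambda>w. 0)"
      then have \<alpha>: "\<alpha> = (\<lambda>w. 0)" using x \<phi>_lam dual by simp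
      show "\<forall>y\<in>rat_span_fun (roots sL bL H). rform BL H x y = 0"
      proof
        fix y assume "y \<in> rat_span_fun (roots sL bL H)"
        then obtain \<beta> m' where "y = lam \<beta> m'" "\<beta> \<in> rat_span_fun R" using span by blast
        then show "rform BL H x y = 0"
          using rform_lam[OF dual_zero dual] by (simp add: x(1) \<alpha> rform_zero)
      qed
    next
      assume "\<forall>y\<in>rat_span_fun (roots sL bL H). rform BL H x y = 0"
      then have "rform B h \<alpha> \<alpha> = 0" using xs rform_lam[OF dual dual, OF x(2) x(2)] x(1) by metis
      then show "\<phi> x = (\<lambda>w. 0)" using rform_rat_span_nz x \<phi>_lam dual by metis
    qed
  qed
qed

end

theorem theorem2p17:
  fixes s :: "'f::field_char_0 \<Rightarrow> 'g::ab_group_add \<Rightarrow> 'g"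
    and b :: "'g \<Rightarrow> 'g \<Rightarrow> 'g"
    and B :: "'g \<Rightarrow> 'g \<Rightarrow> 'f"
    and h :: "'g set"
    and gr :: "('n::finite \<Rightarrow> int) \<Rightarrow> 'g set"
    and d :: "'n \<Rightarrow> 'g \<Rightarrow> 'g"
  assumes inD: "class_D s b B h gr"
    and d_add: "\<And>i x y. d i (x + y) = d i x + d i y"
    and d_scale: "\<And>i a x. d i (s a x) = s a (d i x)"
    and d_deg: "\<And>i \<sigma> x. x \<in> gr \<sigma> \<Longrightarrow> d i x = s (of_int (\<sigma> i)) x"
  shows "is_lie_algebra (scaleL s) (bracketL s b B d)
       \<and> class_T (scaleL s) (bracketL s b B d) (formL B) (HL h)
       \<and> tame (scaleL s) (bracketL s b B d) (formL B) (HL h)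
       \<and> nullity (scaleL s) (bracketL s b B d) (formL B) (HL h) = card (UNIV :: 'n set)
       \<and> same_type (rform (formL B) (HL h)) (roots (scaleL s) (bracketL s b B d) (HL h)) (roots s b h)
       \<and> core (scaleL s) (bracketL s b B d) (formL B) (HL h) = {(x, c, e). e = (\<lambda>i. 0)}
       \<and> centre_of (bracketL s b B d) (core (scaleL s) (bracketL s b B d) (formL B) (HL h))
           = {(x, c, e). x = 0 \<and> e = (\<lambda>i. 0)}
       \<and> cc_iso_to (scaleL s) (bracketL s b B d) (formL B) (HL h) s b"
proof -
  interpret class_D_extension s b B h gr d
    using assms by unfold_locales
  show ?thesis
    using lie_L class_T_L tame_L nullity_L same_type_L core_L centre_L cc_iso_L
    by (intro conjI) (simp_all only: core_L)
qed

end
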